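(* Let $I$ be a monomial ideal having linear quotients in $T=\mathbb{K}[z_1,\dots,z_s]$, let $\mathcal{F}=\{f_1,\dots,f_s\}$ be a set of forms in $R=\mathbb{K}[x_0,\dots,x_n]$, and let $\varphi:T\to R$ be the $\mathbb{K}$-algebra homomorphism induced by $z_i\mapsto f_i$ for each $i$. Suppose that one of the following holds: (1) $\mathcal{F}$ is a strongly generic set of forms of a common degree $d$; or (2) $\mathcal{F}$ is $c$-generic for some integer $c$ with $\operatorname{proj\,dim}_T(I)\le c<\dim(R)=n+1$. Then $$\operatorname{proj\,dim}_R(R/\varphi(I))\le \operatorname{proj\,dim}_T(T/I).$$
   Context: $\mathbb{K}$ is an infinite field; polynomial rings are standard graded; a form is a homogeneous polynomial of positive degree. A set of forms in $R$ is $c$-generic if every subset of size at most $c+1$ forms an $R$-regular sequence; it is generic if it is $n$-generic. A set $\{f_1,\dots,f_s\}$ of forms of a common degree is strongly generic if it is generic and $\dim_{\mathbb{K}}(\mathbb{K}f_1+\cdots+\mathbb{K}f_s)=n+1$. A monomial ideal $I$ has linear quotients if its minimal monomial generators can be ordered $u_1,\dots,u_r$ so that each colon ideal $\langle u_1,\dots,u_i\rangle:u_{i+1}$ ($1\le i\le r-1$) is generated by a subset of the variables. $\varphi(I)$ denotes the ideal of $R$ generated by the image of $I$. *)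

theory Defs
  imports
    Complex_Main
    "HOL-Algebra.Algebra"
    "HOL-Library.Poly_Mapping"
    "HOL-Library.Extended_Nat"
    "HOL-Library.Cardinality"
begin

section \<open>Polynomial rings\<close>

text \<open>
  A monomial is its exponent vector \<open>'v \<Rightarrow>\<^sub>0 nat\<close>, and a polynomial in the variables \<open>'v\<close> over
  \<open>'k\<close> is a finitely supported coefficient function on monomials; its product is the
  convolution supplied by \<open>Poly_Mapping\<close>.
\<close>

type_synonym ('v, 'k) mpoly = "('v \<Rightarrow>\<^sub>0 nat) \<Rightarrow>\<^sub>0 'k"

definition mpoly_monom :: "('v \<Rightarrow>\<^sub>0 nat) \<Rightarrow> ('v, 'k::field) mpoly"
  where "mpoly_monom m = Poly_Mapping.single m 1"

definition mpoly_var :: "'v \<Rightarrow> ('v, 'k::field) mpoly"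
  where "mpoly_var i = mpoly_monom (Poly_Mapping.single i 1)"

definition mpoly_const :: "'k::field \<Rightarrow> ('v, 'k) mpoly"
  where "mpoly_const a = Poly_Mapping.single 0 a"

definition kscale :: "'k::field \<Rightarrow> ('v, 'k) mpoly \<Rightarrow> ('v, 'k) mpoly"
  where "kscale a p = mpoly_const a * p"

definition mpoly_ring :: "('v, 'k::field) mpoly ring"
  where "mpoly_ring =
    \<lparr>carrier = UNIV, monoid.mult = (*), monoid.one = 1, ring.zero = 0, ring.add = (+)\<rparr>"

definition mdegree :: "('v::finite \<Rightarrow>\<^sub>0 nat) \<Rightarrow> nat"
  where "mdegree m = (\<Sum>i\<in>UNIV. Poly_Mapping.lookup m i)"

definition form_of_degree :: "nat \<Rightarrow> ('v::finite, 'k::field) mpoly \<Rightarrow> bool"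
  where "form_of_degree d p \<longleftrightarrow> 0 < d \<and> p \<noteq> 0 \<and> (\<forall>m\<in>Poly_Mapping.keys p. mdegree m = d)"

definition is_form :: "('v::finite, 'k::field) mpoly \<Rightarrow> bool"
  where "is_form p \<longleftrightarrow> (\<exists>d. form_of_degree d p)"

text \<open>The \<open>'k\<close>-algebra homomorphism sending the variable \<open>i\<close> to \<open>f i\<close>.\<close>

definition mpoly_subst :: "('z::finite \<Rightarrow> ('x, 'k::field) mpoly) \<Rightarrow> ('z, 'k) mpoly \<Rightarrow> ('x, 'k) mpoly"
  where "mpoly_subst f p =
    (\<Sum>m\<in>Poly_Mapping.keys p.
       mpoly_const (Poly_Mapping.lookup p m) * (\<Prod>i\<in>UNIV. f i ^ Poly_Mapping.lookup m i))"

lemma cring_mpoly_ring: "cring (mpoly_ring :: ('v, 'k::field) mpoly ring)"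
proof (rule cringI)
  show "abelian_group (mpoly_ring :: ('v, 'k) mpoly ring)"
  proof (rule abelian_groupI)
    fix x :: "('v, 'k) mpoly"
    have "- x + x = 0" by simp
    then show "\<exists>y\<in>carrier mpoly_ring. y \<oplus>\<^bsub>mpoly_ring\<^esub> x = \<zero>\<^bsub>mpoly_ring\<^esub>"
      by (intro bexI[of _ "- x"]) (simp_all add: mpoly_ring_def)
  qed (auto simp: mpoly_ring_def algebra_simps)
  show "Group.comm_monoid (mpoly_ring :: ('v, 'k) mpoly ring)"
    by (rule comm_monoidI) (auto simp: mpoly_ring_def algebra_simps)
qed (auto simp: mpoly_ring_def algebra_simps)

lemma vector_space_kscale: "vector_space (kscale :: 'k::field \<Rightarrow> ('v, 'k) mpoly \<Rightarrow> _)"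
proof
  fix a b :: 'k and p q :: "('v, 'k) mpoly"
  have "mpoly_const (a * b) = mpoly_const a * (mpoly_const b :: ('v, 'k) mpoly)"
    by (simp add: mpoly_const_def Poly_Mapping.mult_single)
  then show "kscale a (kscale b p) = kscale (a * b) p"
    by (simp add: kscale_def algebra_simps)
  show "kscale 1 p = p"
    by (simp add: kscale_def mpoly_const_def)
qed (simp_all add: kscale_def mpoly_const_def Poly_Mapping.single_add algebra_simps)

lemma mpoly_subst_superset:
  assumes "finite A" "Poly_Mapping.keys p \<subseteq> A"
  shows "mpoly_subst f p =
    (\<Sum>m\<in>A. mpoly_const (Poly_Mapping.lookup p m) * (\<Prod>i\<in>UNIV. f i ^ Poly_Mapping.lookup m i))"
  unfolding mpoly_subst_def
  using assms by (intro sum.mono_neutral_left) (auto simp: mpoly_const_def Poly_Mapping.in_keys_iff)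

lemma mpoly_subst_add: "mpoly_subst f (p + q) = mpoly_subst f p + mpoly_subst f q"
proof -
  let ?A = "Poly_Mapping.keys p \<union> Poly_Mapping.keys q"
  have "Poly_Mapping.keys (p + q) \<subseteq> ?A" by (rule Poly_Mapping.keys_add)
  then show ?thesis
    by (simp add: mpoly_subst_superset[of ?A] Poly_Mapping.lookup_add mpoly_const_def
        Poly_Mapping.single_add algebra_simps sum.distrib)
qed

lemma mpoly_subst_single:
  "mpoly_subst f (Poly_Mapping.single m a) =
    mpoly_const a * (\<Prod>i\<in>UNIV. f i ^ Poly_Mapping.lookup m i)"
  by (cases "a = 0") (auto simp: mpoly_subst_def mpoly_const_def)

lemma mpoly_subst_const: "mpoly_subst f (mpoly_const a) = mpoly_const a"
  by (simp add: mpoly_const_def mpoly_subst_single)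

lemma mpoly_subst_var: "mpoly_subst f (mpoly_var i) = f i"
proof -
  have "(\<Prod>j\<in>UNIV. f j ^ Poly_Mapping.lookup (Poly_Mapping.single i 1) j) =
      (\<Prod>j\<in>UNIV. if j = i then f j else 1)"
    by (rule prod.cong) (auto simp: Poly_Mapping.lookup_single when_def)
  then show ?thesis
    by (simp add: mpoly_var_def mpoly_monom_def mpoly_subst_single mpoly_const_def)
qed

lemma mpoly_subst_sum: "mpoly_subst f (sum g A) = (\<Sum>a\<in>A. mpoly_subst f (g a))"
  by (induction A rule: infinite_finite_induct)
    (simp_all add: mpoly_subst_add mpoly_subst_def[of f 0])

lemma mpoly_eq_sum_single:
  "p = (\<Sum>m\<in>Poly_Mapping.keys p. Poly_Mapping.single m (Poly_Mapping.lookup p m))"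
  by (rule poly_mapping_eqI) (auto simp: Poly_Mapping.lookup_sum Poly_Mapping.lookup_single
      when_def Poly_Mapping.in_keys_iff sum.delta)

lemma mpoly_subst_mult:
  fixes p q :: "('z::finite, 'k::field) mpoly"
  shows "mpoly_subst f (p * q) = mpoly_subst f p * mpoly_subst f q"
proof -
  have const_mult: "mpoly_const (a * b) = mpoly_const a * mpoly_const b" for a b :: 'k
    by (simp add: mpoly_const_def Poly_Mapping.mult_single)
  have "p * q = (\<Sum>m\<in>Poly_Mapping.keys p. \<Sum>l\<in>Poly_Mapping.keys q.
      Poly_Mapping.single (m + l) (Poly_Mapping.lookup p m * Poly_Mapping.lookup q l))"
    by (subst (1) mpoly_eq_sum_single[of p], subst (1) mpoly_eq_sum_single[of q])
      (simp add: sum_product Poly_Mapping.mult_single)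
  then have "mpoly_subst f (p * q) = (\<Sum>m\<in>Poly_Mapping.keys p. \<Sum>l\<in>Poly_Mapping.keys q.
      mpoly_subst f (Poly_Mapping.single (m + l) (Poly_Mapping.lookup p m * Poly_Mapping.lookup q l)))"
    by (simp add: mpoly_subst_sum)
  also have "\<dots> = mpoly_subst f p * mpoly_subst f q"
    unfolding mpoly_subst_def[of f p] mpoly_subst_def[of f q] sum_product
    by (intro sum.cong refl)
      (simp add: mpoly_subst_single const_mult Poly_Mapping.lookup_add power_add prod.distrib
        algebra_simps)
  finally show ?thesis .
qed


section \<open>Regular sequences and genericity\<close>

definition regular_sequence :: "('a, 'b) ring_scheme \<Rightarrow> 'a list \<Rightarrow> bool"
  where "regular_sequence R fs \<longleftrightarrow>
    set fs \<subseteq> carrier R \<and>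
    (\<forall>i<length fs. \<forall>g\<in>carrier R.
       fs ! i \<otimes>\<^bsub>R\<^esub> g \<in> Idl\<^bsub>R\<^esub> (set (take i fs)) \<longrightarrow> g \<in> Idl\<^bsub>R\<^esub> (set (take i fs))) \<and>
    Idl\<^bsub>R\<^esub> (set fs) \<noteq> carrier R"

text \<open>For forms the order is immaterial, so a set is asked to be regular in some order.\<close>

definition forms_regular_sequence :: "('a, 'b) ring_scheme \<Rightarrow> 'a set \<Rightarrow> bool"
  where "forms_regular_sequence R A \<longleftrightarrow>
    (\<exists>fs. set fs = A \<and> distinct fs \<and> regular_sequence R fs)"

definition c_generic :: "nat \<Rightarrow> ('x, 'k::field) mpoly set \<Rightarrow> bool"
  where "c_generic c F \<longleftrightarrow>
    (\<forall>A\<subseteq>F. finite A \<and> card A \<le> c + 1 \<longrightarrow> forms_regular_sequence mpoly_ring A)"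

text \<open>The ring \<open>('x, 'k) mpoly\<close> has \<open>n + 1 = CARD('x)\<close> variables.\<close>

definition generic :: "('x::finite, 'k::field) mpoly set \<Rightarrow> bool"
  where "generic F \<longleftrightarrow> c_generic (CARD('x) - 1) F"

definition strongly_generic :: "('x::finite, 'k::field) mpoly set \<Rightarrow> bool"
  where "strongly_generic F \<longleftrightarrow>
    (\<exists>d. \<forall>p\<in>F. form_of_degree d p) \<and> generic F \<and> vector_space.dim kscale F = CARD('x)"


section \<open>Monomial ideals with linear quotients\<close>

definition monomial_ideal :: "('z, 'k::field) mpoly set \<Rightarrow> bool"
  where "monomial_ideal I \<longleftrightarrow> (\<exists>G. I = Idl\<^bsub>mpoly_ring\<^esub> (mpoly_monom ` G))"

definition minimal_monomial_generators :: "('z, 'k::field) mpoly set \<Rightarrow> ('z \<Rightarrow>\<^sub>0 nat) set \<Rightarrow> bool"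
  where "minimal_monomial_generators I G \<longleftrightarrow>
    I = Idl\<^bsub>mpoly_ring\<^esub> (mpoly_monom ` G) \<and> (\<forall>G'. G' \<subset> G \<longrightarrow> I \<noteq> Idl\<^bsub>mpoly_ring\<^esub> (mpoly_monom ` G'))"

definition colon_ideal :: "('a, 'b) ring_scheme \<Rightarrow> 'a set \<Rightarrow> 'a \<Rightarrow> 'a set"
  where "colon_ideal R J u = {p \<in> carrier R. p \<otimes>\<^bsub>R\<^esub> u \<in> J}"

text \<open>The list \<open>us\<close> is indexed from 0: \<open>take i us\<close> is \<open>u\<^sub>1, \<dots>, u\<^sub>i\<close> and \<open>us ! i\<close> is \<open>u\<^sub>i\<^sub>+\<^sub>1\<close>.\<close>

definition linear_quotients :: "('z, 'k::field) mpoly set \<Rightarrow> bool"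
  where "linear_quotients I \<longleftrightarrow>
    (\<exists>us. distinct us \<and> minimal_monomial_generators I (set us) \<and>
      (\<forall>i. 1 \<le> i \<and> i < length us \<longrightarrow>
        (\<exists>V. colon_ideal mpoly_ring (Idl\<^bsub>mpoly_ring\<^esub> (mpoly_monom ` set (take i us)))
               (mpoly_monom (us ! i))
             = Idl\<^bsub>mpoly_ring\<^esub> ((mpoly_var :: 'z \<Rightarrow> ('z, 'k) mpoly) ` V))))"


section \<open>Projective dimension\<close>

text \<open>
  The record \<open>module\<close> extends \<open>ring\<close>; the fields \<open>mult\<close> and \<open>one\<close> of a module play no role.
\<close>

definition ideal_module :: "('a, 'b) ring_scheme \<Rightarrow> 'a set \<Rightarrow> ('a, 'a) module"
  where "ideal_module R I =
    \<lparr>carrier = I, monoid.mult = monoid.mult R, monoid.one = \<one>\<^bsub>R\<^esub>,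
     ring.zero = \<zero>\<^bsub>R\<^esub>, ring.add = ring.add R, smult = monoid.mult R\<rparr>"

definition quotient_module :: "('a, 'b) ring_scheme \<Rightarrow> 'a set \<Rightarrow> ('a, 'a set) module"
  where "quotient_module R I =
    \<lparr>carrier = carrier (R Quot I), monoid.mult = monoid.mult (R Quot I),
     monoid.one = \<one>\<^bsub>R Quot I\<^esub>, ring.zero = \<zero>\<^bsub>R Quot I\<^esub>,
     ring.add = ring.add (R Quot I), smult = (\<lambda>r C. (I +>\<^bsub>R\<^esub> r) \<otimes>\<^bsub>R Quot I\<^esub> C)\<rparr>"

text \<open>The free module with basis \<open>B\<close>, as finitely supported functions on \<open>B\<close>.\<close>

definition free_module :: "('a, 'b) ring_scheme \<Rightarrow> 'c set \<Rightarrow> ('a, 'c \<Rightarrow> 'a) module"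
  where "free_module R B =
    \<lparr>carrier = {v. (\<forall>b. v b \<in> carrier R) \<and> (\<forall>b. b \<notin> B \<longrightarrow> v b = \<zero>\<^bsub>R\<^esub>) \<and> finite {b. v b \<noteq> \<zero>\<^bsub>R\<^esub>}},
     monoid.mult = undefined, monoid.one = undefined,
     ring.zero = (\<lambda>_. \<zero>\<^bsub>R\<^esub>), ring.add = (\<lambda>v w b. v b \<oplus>\<^bsub>R\<^esub> w b),
     smult = (\<lambda>r v b. r \<otimes>\<^bsub>R\<^esub> v b)\<rparr>"

lemma module_ideal_module:
  fixes R (structure)
  assumes "cring R" "ideal I R"
  shows "Module.module R (ideal_module R I)"
proof -
  interpret cring R by fact
  interpret ideal I R by fact
  show ?thesis
  proof (rule module.intro)
    show "abelian_group (ideal_module R I)"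
    proof (rule abelian_groupI)
      fix x assume "x \<in> carrier (ideal_module R I)"
      then show "\<exists>y\<in>carrier (ideal_module R I).
          y \<oplus>\<^bsub>ideal_module R I\<^esub> x = \<zero>\<^bsub>ideal_module R I\<^esub>"
        by (auto simp: ideal_module_def Icarr l_neg intro!: bexI[of _ "\<ominus> x"])
    qed (auto simp: ideal_module_def Icarr a_assoc a_comm a_lcomm)
    show "module_axioms R (ideal_module R I)"
      by (rule module_axioms.intro)
        (auto simp: ideal_module_def Icarr I_l_closed l_distr r_distr m_assoc)
  qed fact
qed

lemma module_quotient_module:
  fixes R (structure)
  assumes "cring R" "ideal I R"
  shows "Module.module R (quotient_module R I)"
proof -
  interpret cring R by fact
  interpret ideal I R by fact
  interpret Q: cring "R Quot I" by (rule quotient_is_cring) fact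
  have hom: "a_r_coset R I \<in> ring_hom R (R Quot I)" by (rule rcos_ring_hom)
  note h = ring_hom_closed[OF hom] ring_hom_add[OF hom] ring_hom_mult[OF hom] ring_hom_one[OF hom]
  show ?thesis
  proof (rule module.intro)
    show "abelian_group (quotient_module R I)"
    proof (rule abelian_groupI)
      fix x assume "x \<in> carrier (quotient_module R I)"
      then show "\<exists>y\<in>carrier (quotient_module R I).
          y \<oplus>\<^bsub>quotient_module R I\<^esub> x = \<zero>\<^bsub>quotient_module R I\<^esub>"
        by (auto simp: quotient_module_def Q.l_neg intro!: bexI[of _ "\<ominus>\<^bsub>R Quot I\<^esub> x"])
    qed (simp_all add: quotient_module_def Q.a_assoc Q.a_comm Q.a_lcomm)
    show "module_axioms R (quotient_module R I)"
      by (rule module_axioms.intro)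
        (simp_all add: quotient_module_def h Q.l_distr Q.r_distr Q.m_assoc)
  qed fact
qed

lemma module_free_module:
  fixes R (structure)
  assumes "cring R"
  shows "Module.module R (free_module R B)"
proof -
  interpret cring R by fact
  show ?thesis
  proof (rule module.intro)
    show "abelian_group (free_module R B)"
    proof (rule abelian_groupI)
      fix v w assume vw: "v \<in> carrier (free_module R B)" "w \<in> carrier (free_module R B)"
      have "{b. v b \<oplus> w b \<noteq> \<zero>} \<subseteq> {b. v b \<noteq> \<zero>} \<union> {b. w b \<noteq> \<zero>}"
        by auto
      with vw show "v \<oplus>\<^bsub>free_module R B\<^esub> w \<in> carrier (free_module R B)"
        by (auto simp: free_module_def intro: finite_subset)
    next
      fix v assume v: "v \<in> carrier (free_module R B)"
      have "{b. \<ominus> v b \<noteq> \<zero>} \<subseteq> {b. v b \<noteq> \<zero>}"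
        by auto
      with v show "\<exists>w\<in>carrier (free_module R B).
          w \<oplus>\<^bsub>free_module R B\<^esub> v = \<zero>\<^bsub>free_module R B\<^esub>"
        by (auto simp: free_module_def l_neg intro!: exI[of _ "\<lambda>b. \<ominus> v b"] intro: finite_subset)
    qed (auto simp: free_module_def a_assoc a_comm a_lcomm)
    show "module_axioms R (free_module R B)"
    proof (rule module_axioms.intro)
      fix r v assume rv: "r \<in> carrier R" "v \<in> carrier (free_module R B)"
      have "{b. r \<otimes> v b \<noteq> \<zero>} \<subseteq> {b. v b \<noteq> \<zero>}"
        using rv by auto
      with rv show "r \<odot>\<^bsub>free_module R B\<^esub> v \<in> carrier (free_module R B)"
        by (auto simp: free_module_def intro: finite_subset)
    qed (auto simp: free_module_def l_distr r_distr m_assoc)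
  qed fact
qed

definition module_hom_set ::
  "('a, 'b) ring_scheme \<Rightarrow> ('a, 'm, 'c) module_scheme \<Rightarrow> ('a, 'n, 'd) module_scheme \<Rightarrow> ('m \<Rightarrow> 'n) set"
  where "module_hom_set R M N = {h \<in> carrier M \<rightarrow> carrier N.
    (\<forall>x\<in>carrier M. \<forall>y\<in>carrier M. h (x \<oplus>\<^bsub>M\<^esub> y) = h x \<oplus>\<^bsub>N\<^esub> h y) \<and>
    (\<forall>r\<in>carrier R. \<forall>x\<in>carrier M. h (r \<odot>\<^bsub>M\<^esub> x) = r \<odot>\<^bsub>N\<^esub> h x)}"

text \<open>
  A module is projective if it is a direct summand of a free module. Bases inside the type of
  the elements of \<open>P\<close> suffice: a projective \<open>P\<close> is a summand of the free module on
  \<open>carrier P\<close>.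
\<close>

definition projective_module :: "('a, 'b) ring_scheme \<Rightarrow> ('a, 'p, 'c) module_scheme \<Rightarrow> bool"
  where "projective_module R P \<longleftrightarrow> Module.module R P \<and>
    (\<exists>(B :: 'p set) \<iota> \<pi>. \<iota> \<in> module_hom_set R P (free_module R B) \<and>
       \<pi> \<in> module_hom_set R (free_module R B) P \<and> (\<forall>x\<in>carrier P. \<pi> (\<iota> x) = x))"

text \<open>
  \<open>\<dots> \<rightarrow> P 1 \<rightarrow> P 0 \<rightarrow> M \<rightarrow> 0\<close> is exact with differentials \<open>d i : P (i + 1) \<rightarrow> P i\<close>, augmentation
  \<open>\<epsilon> : P 0 \<rightarrow> M\<close>, and \<open>P i = 0\<close> for \<open>i > n\<close>.
\<close>

definition projective_resolution ::
  "('a, 'b) ring_scheme \<Rightarrow> ('a, 'm, 'c) module_scheme \<Rightarrow> nat \<Rightarrow>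
   (nat \<Rightarrow> ('a, 'p) module) \<Rightarrow> (nat \<Rightarrow> 'p \<Rightarrow> 'p) \<Rightarrow> ('p \<Rightarrow> 'm) \<Rightarrow> bool"
  where "projective_resolution R M n P d \<epsilon> \<longleftrightarrow>
    (\<forall>i. projective_module R (P i)) \<and>
    (\<forall>i>n. carrier (P i) = {\<zero>\<^bsub>P i\<^esub>}) \<and>
    \<epsilon> \<in> module_hom_set R (P 0) M \<and>
    (\<forall>i. d i \<in> module_hom_set R (P (Suc i)) (P i)) \<and>
    \<epsilon> ` carrier (P 0) = carrier M \<and>
    d 0 ` carrier (P 1) = a_kernel (P 0) M \<epsilon> \<and>
    (\<forall>i. d (Suc i) ` carrier (P (Suc (Suc i))) = a_kernel (P (Suc i)) (P i) (d i))"

text \<open>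
  The least length of a projective resolution, \<open>\<infinity>\<close> if there is no finite one. (The zero module
  gets 0.) The terms of a resolution are taken in the type \<open>('a + 'm) list \<Rightarrow> 'a\<close>, which loses no
  generality: \<open>('a + 'm) list\<close> is infinite and at least as large as \<open>R\<close> and \<open>M\<close>, so free covers of
  \<open>M\<close> and of all its successive syzygies can be built on bases of that type, and the
  projective syzygies that end a resolution are submodules of such free modules.
\<close>

definition proj_dim :: "('a, 'b) ring_scheme \<Rightarrow> ('a, 'm, 'c) module_scheme \<Rightarrow> enat"
  where "proj_dim R M = Inf {enat n | n.
    \<exists>(P :: nat \<Rightarrow> ('a, ('a + 'm) list \<Rightarrow> 'a) module) d \<epsilon>. projective_resolution R M n P d \<epsilon>}"

end

theory Submission
  imports Defs
begin

text \<open>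
  Let \<open>u\<^sub>1, \<dots>, u\<^sub>r\<close> be the generators of \<open>I\<close>, let \<open>V\<^sub>i\<close> be the variables of the \<open>i\<close>-th colon ideal,
  and let \<open>k\<close> be the largest cardinality of the \<open>V\<^sub>i\<close>. Iterated mapping cones over Koszul complexes
  resolve \<open>T/I\<close> by a complex of length \<open>k + 1\<close>. Once the generators are sorted by degree, which keeps
  the sets \<open>V\<^sub>i\<close>, degree reasons put the image of some top basis vector into the irrelevant ideal,
  so \<open>T/I\<close> has projective dimension at least \<open>k + 1\<close> and \<open>I\<close> at least \<open>k\<close>.

  Over \<open>R\<close> the same cones have length at most \<open>k + 1\<close>, provided that \<open>\<phi>\<close> respects the colon
  ideals. For \<open>\<bar>V\<^sub>i\<bar> \<le> c\<close> this is quasi-regularity of the sequence \<open>f v\<close>, \<open>v \<in> V\<^sub>i\<close>, together with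
  the regularity of the remaining forms modulo it. In the strongly generic case with
  \<open>\<bar>V\<^sub>i\<bar> > n\<close> the \<open>f v\<close> generate the same ideal \<open>(y\<^sub>0, \<dots>, y\<^sub>n)\<close> as all of the forms, and since \<open>R\<close> is
  free over \<open>K[y]\<close>, the colon ideal in \<open>R\<close> is this ideal or the unit ideal.
\<close>


section \<open>Regular sequences of forms\<close>

text \<open>The map \<phi> is in general not flat, so a resolution over \<open>T\<close> cannot be
  carried to \<open>R\<close> by base change. Linear quotients avoid this: they reduce the matter to
  one statement about a colon ideal per generator, and the cone is then built anew over
  \<open>R\<close>. The image of a generator may be redundant over \<open>R\<close>; its cone is
  skipped, so only an upper bound is obtained there. Over \<open>T\<close> the cones need not be
  shown minimal: one good basis vector at the top is enough, because a shorter projective resolution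
  would make the last map a split injection. The lower bound for \<open>I\<close> itself serves case
  (2), where it turns the bound on the projective dimension of \<open>I\<close> into
  \<open>k \<le> c\<close>, so that each \<open>V\<^sub>i\<close> with one variable added has at
  most \<open>c + 1\<close> elements. In case (1) the forms of \<open>V\<^sub>i\<close> need not be
  a regular sequence, as there may be more than \<open>n + 1\<close> of them; a subset of
  \<open>n + 1\<close> variables then replaces \<open>V\<^sub>i\<close>, which cannot increase the
  length.\<close>

unbundle no m_inv_syntax

abbreviation "lookup \<equiv> Poly_Mapping.lookup"
abbreviation "keys \<equiv> Poly_Mapping.keys"
abbreviation "single \<equiv> Poly_Mapping.single"

text \<open>The ring acts on itself, so subspaces are ideals and spans are generated ideals; the
  general theory of spans becomes available for ideals.\<close>

interpretation ideals: Modules.module "(*) :: 'a::comm_ring_1 \<Rightarrow> 'a \<Rightarrow> 'a"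
  by unfold_locales (simp_all add: algebra_simps)

text \<open>For scalar multiplication in the ring itself this rule is the inverse of \<open>mult.assoc\<close>.\<close>

declare ideals.scale_scale [simp del]

abbreviation rspan :: "'a::comm_ring_1 set \<Rightarrow> 'a set"
  where "rspan \<equiv> ideals.span"

lemma rspan_mult_left: "x \<in> rspan S \<Longrightarrow> r * x \<in> rspan S"
  by (rule ideals.span_scale)

lemma rspan_mult_right: "x \<in> rspan S \<Longrightarrow> x * r \<in> rspan S"
  using ideals.span_scale[of x S r] by (simp add: mult.commute)

lemma rspan_insertE:
  assumes "x \<in> rspan (insert a S)"
  obtains r s where "s \<in> rspan S" "x = a * r + s"
  using assms unfolding ideals.span_insert
  by (smt (verit, ccfv_threshold) add.commute diff_add_cancel mem_Collect_eq mult.commute)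

lemma rspan_insertI:
  assumes "s \<in> rspan S"
  shows "a * r + s \<in> rspan (insert a S)"
  unfolding ideals.span_insert using assms
  by (auto intro!: exI[of _ r] simp: mult.commute)

lemma rspan_mono_span:
  assumes "S \<subseteq> rspan T"
  shows "rspan S \<subseteq> rspan T"
  using assms ideals.span_minimal ideals.subspace_span by blast

text \<open>The elements that multiply \<open>c\<close> into a given ideal form an ideal, so
  generators suffice.\<close>

lemma rspan_colon:
  assumes "\<And>s. s \<in> S \<Longrightarrow> s * c \<in> rspan T" "g \<in> rspan S"
  shows "g * c \<in> rspan T"
proof -
  have "ideals.subspace {g. g * c \<in> rspan T}"
    by (auto simp: ideals.subspace_def ideals.span_zero distrib_right mult.assoc
        intro: ideals.span_add rspan_mult_left)
  with assms show ?thesis using ideals.span_minimal[of S "{g. g * c \<in> rspan T}"] by blast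
qed

section \<open>Powers in a regular sequence and quasi-regularity\<close>

definition regular_mod :: "'a::comm_ring_1 set \<Rightarrow> 'a \<Rightarrow> bool"
  where "regular_mod S a \<longleftrightarrow> (\<forall>g. a * g \<in> rspan S \<longrightarrow> g \<in> rspan S)"

lemma regular_modD: "regular_mod S a \<Longrightarrow> a * g \<in> rspan S \<Longrightarrow> g \<in> rspan S"
  by (auto simp: regular_mod_def)

lemma regular_mod_one: "regular_mod S 1"
  by (simp add: regular_mod_def)

lemma regular_mod_mult: "regular_mod S a \<Longrightarrow> regular_mod S b \<Longrightarrow> regular_mod S (a * b)"
  unfolding regular_mod_def by (metis mult.assoc)

lemma regular_mod_power: "regular_mod S a \<Longrightarrow> regular_mod S (a ^ e)"
  by (induction e) (simp_all add: regular_mod_one regular_mod_mult)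

lemma regular_mod_prod:
  "(\<And>i. i \<in> A \<Longrightarrow> regular_mod S (f i)) \<Longrightarrow> regular_mod S (prod f A)"
  by (induction A rule: infinite_finite_induct)
    (simp_all add: regular_mod_one regular_mod_mult)

text \<open>Regularity in every order, for a family indexed by variables, so that subsets of
  \<open>V\<close> can be handled directly. As in \<open>regular_mod\<close>, properness of the
  ideals is not part of the notion.\<close>

definition permutable_regular :: "('z \<Rightarrow> 'a::comm_ring_1) \<Rightarrow> 'z set \<Rightarrow> bool"
  where "permutable_regular f V \<longleftrightarrow> (\<forall>B\<subseteq>V. \<forall>w\<in>V - B. regular_mod (f ` B) (f w))"

lemma permutable_regular_subset: "permutable_regular f V \<Longrightarrow> W \<subseteq> V \<Longrightarrow> permutable_regular f W"
  unfolding permutable_regular_def by blast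

text \<open>The forms are replaced by powers one at a time, by induction on the exponent
  \<open>k\<close>. From \<open>f w * g = f b ^ Suc k * r + s\<close> the case \<open>k\<close>
  gives \<open>g = f b ^ k * h + q\<close>; cancelling \<open>f b ^ k\<close> modulo
  \<open>Q\<close> puts \<open>f w * h\<close>, and hence \<open>h\<close>, into the ideal of
  \<open>f b\<close> and \<open>Q\<close>, which yields the missing factor
  \<open>f b\<close>.\<close>

lemma regular_mod_mixed_powers:
  assumes "finite B0" "permutable_regular f V"
  shows "B0 \<union> B1 \<subseteq> V \<Longrightarrow> w \<in> V - (B0 \<union> B1) \<Longrightarrow> B0 \<inter> B1 = {} \<Longrightarrow>
    regular_mod ((\<lambda>b. f b ^ e b) ` B0 \<union> f ` B1) (f w)"
  using assms(1)
proof (induction B0 arbitrary: B1 w rule: finite_induct)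
  case empty
  with assms(2) show ?case by (simp add: permutable_regular_def)
next
  case (insert b B0)
  define Q where "Q = (\<lambda>b. f b ^ e b) ` B0 \<union> f ` B1"
  have b: "regular_mod Q (f b)"
    unfolding Q_def using insert.prems insert.hyps by (intro insert.IH) auto
  \<comment> \<open>Here \<open>b\<close> counts among the elements with exponent one, which is why
    \<open>B1\<close> is generalised.\<close>
  have w: "regular_mod (insert (f b) Q) (f w)"
    using insert.IH[of "insert b B1" w] insert.prems insert.hyps unfolding Q_def by auto
  have "regular_mod (insert (f b ^ k) Q) (f w)" for k
  proof (induction k)
    case 0
    have "g \<in> rspan (insert 1 Q)" for g
      using rspan_mult_left[OF ideals.span_base[of 1 "insert 1 Q"], of g] by simp
    then show ?case by (simp add: regular_mod_def)
  next
    case (Suc k)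
    show ?case unfolding regular_mod_def
    proof (intro allI impI)
      fix g assume "f w * g \<in> rspan (insert (f b ^ Suc k) Q)"
      then obtain r s where 1: "s \<in> rspan Q" "f w * g = f b ^ Suc k * r + s"
        by (rule rspan_insertE)
      have "f w * g = f b ^ k * (f b * r) + s"
        by (simp only: 1(2) power_Suc2 mult.assoc)
      then have "f w * g \<in> rspan (insert (f b ^ k) Q)"
        by (simp only: rspan_insertI[OF 1(1)])
      from regular_modD[OF Suc.IH this] obtain h q
        where 2: "q \<in> rspan Q" "g = f b ^ k * h + q" by (rule rspan_insertE)
      have "f b ^ k * (f w * h - f b * r) = s - f w * q"
        using 1(2) unfolding 2(2) by (simp add: algebra_simps)
      also have "\<dots> \<in> rspan Q"
        by (intro ideals.span_diff 1 rspan_mult_left 2)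
      finally have "f w * h - f b * r \<in> rspan Q"
        by (rule regular_modD[OF regular_mod_power[OF b]])
      from rspan_insertI[OF this, of "f b" r] have "f w * h \<in> rspan (insert (f b) Q)"
        by simp
      from regular_modD[OF w this] obtain h' q'
        where 3: "q' \<in> rspan Q" "h = f b * h' + q'" by (rule rspan_insertE)
      have "g = f b ^ Suc k * h' + (f b ^ k * q' + q)"
        unfolding 2(2) 3(2) by (simp add: algebra_simps)
      also have "\<dots> \<in> rspan (insert (f b ^ Suc k) Q)"
        by (intro rspan_insertI ideals.span_add rspan_mult_left 2 3)
      finally show "g \<in> rspan (insert (f b ^ Suc k) Q)" .
    qed
  qed
  from this[of "e b"] show ?case by (simp add: Q_def)
qed

text \<open>Modulo the other powers \<open>f b\<close> is regular, so \<open>f b ^ e b\<close>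
  cancels from a relation that involves \<open>f b ^ Suc (e b)\<close> and leaves \<open>f b\<close>
  itself. This moves \<open>b\<close> from \<open>B0\<close> to \<open>B1\<close>.\<close>

lemma quasi_regular_mixed_powers:
  assumes "finite B0" "permutable_regular f V"
  shows "B0 \<union> B1 \<subseteq> V \<Longrightarrow> B0 \<inter> B1 = {} \<Longrightarrow>
    g * (\<Prod>b\<in>B0. f b ^ e b) \<in> rspan ((\<lambda>b. f b ^ Suc (e b)) ` B0 \<union> f ` B1) \<Longrightarrow>
    g \<in> rspan (f ` (B0 \<union> B1))"
  using assms(1)
proof (induction B0 arbitrary: B1 rule: finite_induct)
  case empty
  then show ?case by simp
next
  case (insert b B0)
  define Q where "Q = (\<lambda>b. f b ^ Suc (e b)) ` B0 \<union> f ` B1"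
  have b: "regular_mod Q (f b)"
    unfolding Q_def using insert.prems insert.hyps
    by (intro regular_mod_mixed_powers[OF insert.hyps(1) assms(2)]) auto
  have "g * (\<Prod>b\<in>insert b B0. f b ^ e b) \<in> rspan (insert (f b ^ Suc (e b)) Q)"
    using insert.prems(3) by (simp add: Q_def)
  then obtain r s where 1: "s \<in> rspan Q"
    "g * (\<Prod>b\<in>insert b B0. f b ^ e b) = f b ^ Suc (e b) * r + s"
    by (rule rspan_insertE)
  have "f b ^ e b * (g * (\<Prod>b\<in>B0. f b ^ e b) - f b * r) = s"
    using 1(2) insert.hyps by (simp add: algebra_simps)
  with 1(1) have "g * (\<Prod>b\<in>B0. f b ^ e b) - f b * r \<in> rspan Q"
    using regular_modD[OF regular_mod_power[OF b]] by metis
  from rspan_insertI[OF this, of "f b" r]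
  have "g * (\<Prod>b\<in>B0. f b ^ e b) \<in> rspan (insert (f b) Q)" by simp
  then have "g \<in> rspan (f ` (B0 \<union> insert b B1))"
    using insert.prems insert.hyps by (intro insert.IH) (auto simp: Q_def)
  then show ?case by simp
qed

text \<open>This form of quasi-regularity is used twice: for the colon ideals in
  \<open>colon_of_values\<close> and for the uniqueness of expansions in
  \<open>socle_colon\<close>.\<close>

lemma quasi_regular:
  assumes "finite V" "permutable_regular f V"
    and "g * (\<Prod>v\<in>V. f v ^ e v) \<in> rspan ((\<lambda>v. f v ^ Suc (e v)) ` V)"
  shows "g \<in> rspan (f ` V)"
  using quasi_regular_mixed_powers[of V f V "{}" g e] assms by simp

section \<open>Homogeneous components\<close>

definition hcomp :: "nat \<Rightarrow> ('x::finite, 'k::field) mpoly \<Rightarrow> ('x, 'k) mpoly"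
  where "hcomp e p = (\<Sum>m\<in>{m\<in>keys p. mdegree m = e}. single m (lookup p m))"

text \<open>In contrast to \<open>form_of_degree\<close>, zero is homogeneous of every degree and
  degree 0 is allowed, so that components are always homogeneous.\<close>

definition homogeneous :: "nat \<Rightarrow> ('x::finite, 'k::field) mpoly \<Rightarrow> bool"
  where "homogeneous e p \<longleftrightarrow> (\<forall>m\<in>keys p. mdegree m = e)"

lemma lookup_hcomp: "lookup (hcomp e p) m = (if mdegree m = e then lookup p m else 0)"
  unfolding hcomp_def lookup_sum lookup_single when_def
  by (auto simp: in_keys_iff)

lemma hcomp_0 [simp]: "hcomp e 0 = 0"
  by (rule poly_mapping_eqI) (simp add: lookup_hcomp)

lemma hcomp_add: "hcomp e (p + q) = hcomp e p + hcomp e q"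
  by (rule poly_mapping_eqI) (simp add: lookup_hcomp lookup_add)

lemma hcomp_diff: "hcomp e (p - q) = hcomp e p - hcomp e q"
  by (rule poly_mapping_eqI) (simp add: lookup_hcomp lookup_minus)

lemma hcomp_sum: "hcomp e (sum f A) = (\<Sum>a\<in>A. hcomp e (f a))"
  by (induction A rule: infinite_finite_induct) (simp_all add: hcomp_add)

lemma homogeneous_hcomp [simp]: "homogeneous e (hcomp e p)"
  by (auto simp: homogeneous_def in_keys_iff lookup_hcomp split: if_splits)

lemma hcomp_homogeneous: "homogeneous e p \<Longrightarrow> hcomp e' p = (if e = e' then p else 0)"
  by (rule poly_mapping_eqI) (auto simp: lookup_hcomp homogeneous_def in_keys_iff)

lemma mdegree_add: "mdegree (m + l) = mdegree m + mdegree l"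
  by (simp add: mdegree_def lookup_add sum.distrib)

lemma homogeneous_mult:
  assumes "homogeneous d p" "homogeneous e q"
  shows "homogeneous (d + e) (p * q)"
proof -
  have "m \<in> {a + b |a b. a \<in> keys p \<and> b \<in> keys q}"
    if "m \<in> keys (p * q)" for m
    using that Poly_Mapping.keys_mult[of p q] by blast
  then show ?thesis
    using assms unfolding homogeneous_def by (fastforce simp: mdegree_add)
qed

lemma sum_hcomp:
  obtains N where "\<And>M. N \<le> M \<Longrightarrow> p = (\<Sum>e\<le>M. hcomp e p)"
proof
  fix M assume M: "Max (mdegree ` keys p) \<le> M"
  have "mdegree m \<le> M" if "m \<in> keys p" for m
    using that M by (meson Max_ge finite_imageI finite_keys image_eqI order_trans)
  then show "p = (\<Sum>e\<le>M. hcomp e p)"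
    by (intro poly_mapping_eqI) (auto simp: lookup_sum lookup_hcomp in_keys_iff)
qed

lemma hcomp_mult:
  "hcomp e (p * q) = (\<Sum>i\<le>e. hcomp i p * hcomp (e - i) q)"
proof -
  obtain N1 where N1: "\<And>M. N1 \<le> M \<Longrightarrow> p = (\<Sum>e\<le>M. hcomp e p)" by (rule sum_hcomp[of p]) blast
  obtain N2 where N2: "\<And>M. N2 \<le> M \<Longrightarrow> q = (\<Sum>e\<le>M. hcomp e q)" by (rule sum_hcomp[of q]) blast
  define M where "M = max e (max N1 N2)"
  have "p * q = (\<Sum>i\<le>M. \<Sum>j\<le>M. hcomp i p * hcomp j q)"
    unfolding sum_product[symmetric]
    by (rule arg_cong2[where f = "(*)", OF N1 N2]) (simp_all add: M_def)
  then have "hcomp e (p * q) = (\<Sum>i\<le>M. \<Sum>j\<le>M. if i + j = e then hcomp i p * hcomp j q else 0)"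
    by (simp add: hcomp_sum hcomp_homogeneous[OF homogeneous_mult[OF homogeneous_hcomp homogeneous_hcomp]])
  also have "\<dots> = (\<Sum>i\<le>M. if i \<le> e then hcomp i p * hcomp (e - i) q else 0)"
  proof (rule sum.cong[OF refl])
    fix i assume "i \<in> {..M}"
    have "(\<Sum>j\<le>M. if i + j = e then hcomp i p * hcomp j q else 0) =
      (\<Sum>j\<le>M. if j = e - i then (if i \<le> e then hcomp i p * hcomp (e - i) q else 0) else 0)"
      by (rule sum.cong) auto
    also have "\<dots> = (if i \<le> e then hcomp i p * hcomp (e - i) q else 0)"
      by (auto simp: M_def)
    finally show "(\<Sum>j\<le>M. if i + j = e then hcomp i p * hcomp j q else 0) = \<dots>" .
  qed
  also have "\<dots> = (\<Sum>i\<le>e. hcomp i p * hcomp (e - i) q)"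
    by (intro sum.mono_neutral_cong_right) (auto simp: M_def)
  finally show ?thesis .
qed

lemma hcomp_mult_homogeneous:
  assumes "homogeneous d a"
  shows "hcomp e (a * p) = (if d \<le> e then a * hcomp (e - d) p else 0)"
proof -
  have "hcomp e (a * p) = (\<Sum>i\<le>e. if i = d then a * hcomp (e - i) p else 0)"
    unfolding hcomp_mult by (intro sum.cong) (auto simp: hcomp_homogeneous[OF assms])
  then show ?thesis by simp
qed

definition homogeneous_closed :: "('x::finite, 'k::field) mpoly set \<Rightarrow> bool"
  where "homogeneous_closed A \<longleftrightarrow> (\<forall>e. \<forall>p\<in>A. hcomp e p \<in> A)"

text \<open>The polynomials with all components in the ideal form an ideal themselves, since
  \<open>hcomp_mult\<close> writes a component of a product as a combination of components of one
  factor.\<close>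

lemma homogeneous_closed_rspan:
  assumes "\<And>s. s \<in> S \<Longrightarrow> \<exists>e. homogeneous e s"
  shows "homogeneous_closed (rspan S)"
proof -
  have "rspan S \<subseteq> {p. \<forall>e. hcomp e p \<in> rspan S}"
  proof (rule ideals.span_minimal)
    show "S \<subseteq> {p. \<forall>e. hcomp e p \<in> rspan S}"
    proof
      fix s assume s: "s \<in> S"
      with assms obtain d where d: "homogeneous d s" by blast
      from s show "s \<in> {p. \<forall>e. hcomp e p \<in> rspan S}"
        by (auto simp: hcomp_homogeneous[OF d] ideals.span_base ideals.span_zero)
    qed
    show "ideals.subspace {p. \<forall>e. hcomp e p \<in> rspan S}"
      unfolding ideals.subspace_def
      by (auto simp: hcomp_add hcomp_mult ideals.span_zero
          intro!: ideals.span_add ideals.span_sum rspan_mult_left)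
  qed
  then show ?thesis by (auto simp: homogeneous_closed_def)
qed

section \<open>Permuting a regular sequence of forms\<close>

fun rec_regular :: "'a::comm_ring_1 set \<Rightarrow> 'a list \<Rightarrow> bool"
  where "rec_regular S [] \<longleftrightarrow> True"
  | "rec_regular S (a # as) \<longleftrightarrow> regular_mod S a \<and> rec_regular (insert a S) as"

text \<open>
  \<open>K = {k. b * k \<in> rspan S}\<close> satisfies \<open>K = a K\<close> modulo \<open>S\<close>, and \<open>a\<close> has positive degree.
\<close>

lemma regular_mod_swap:
  fixes S :: "('x::finite, 'k::field) mpoly set"
  assumes S: "\<And>s. s \<in> S \<Longrightarrow> \<exists>e. homogeneous e s"
    and a: "homogeneous da a" "0 < da" and b: "homogeneous db b"
    and reg: "regular_mod S a" "regular_mod (insert a S) b"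
  shows "regular_mod S b"
proof -
  have hS: "hcomp e p \<in> rspan S" if "p \<in> rspan S" for e p
    using homogeneous_closed_rspan[OF S] that by (auto simp: homogeneous_closed_def)
  have hom: "k \<in> rspan S" if "homogeneous e k" "b * k \<in> rspan S" for k e
    using that
  proof (induction e arbitrary: k rule: less_induct)
    case (less e)
    have "b * k \<in> rspan (insert a S)"
      using less.prems(2) ideals.span_mono[of S "insert a S"] by blast
    from regular_modD[OF reg(2) this] obtain r s
      where rs: "s \<in> rspan S" "k = a * r + s" by (rule rspan_insertE)
    \<comment> \<open>Passing to degree \<open>e\<close> replaces \<open>r\<close> by a component of
      degree \<open>e - da\<close>, to which the induction hypothesis applies because
      \<open>da\<close> is positive. For \<open>e < da\<close> only the part in the ideal of
      \<open>S\<close> remains.\<close>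
    have k: "k = (if da \<le> e then a * hcomp (e - da) r else 0) + hcomp e s"
      using arg_cong[OF rs(2), of "hcomp e"]
      by (simp add: hcomp_add hcomp_mult_homogeneous[OF a(1)] hcomp_homogeneous[OF less.prems(1)])
    show ?case
    proof (cases "da \<le> e")
      case False
      then show ?thesis using k hS[OF rs(1)] by simp
    next
      case True
      have "a * (b * hcomp (e - da) r) = b * k - b * hcomp e s"
        by (subst k) (simp add: True algebra_simps)
      also have "\<dots> \<in> rspan S"
        by (intro ideals.span_diff less.prems rspan_mult_left hS[OF rs(1)])
      finally have "b * hcomp (e - da) r \<in> rspan S" by (rule regular_modD[OF reg(1)])
      moreover have "e - da < e" using True a(2) by linarith
      ultimately have "hcomp (e - da) r \<in> rspan S"
        by (metis less.IH homogeneous_hcomp)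
      then have "a * hcomp (e - da) r + hcomp e s \<in> rspan S"
        by (intro ideals.span_add rspan_mult_left hS[OF rs(1)])
      then show ?thesis
        by (subst k) (simp only: True if_True)
    qed
  qed
  show ?thesis unfolding regular_mod_def
  proof (intro allI impI)
    fix g assume g: "b * g \<in> rspan S"
    have "hcomp e g \<in> rspan S" for e
    proof (rule hom[OF homogeneous_hcomp])
      show "b * hcomp e g \<in> rspan S"
        using hS[OF g, of "db + e"] by (simp add: hcomp_mult_homogeneous[OF b])
    qed
    then have sum: "(\<Sum>e\<le>N. hcomp e g) \<in> rspan S" for N
      by (rule ideals.span_sum)
    obtain N where N: "g = (\<Sum>e\<le>N. hcomp e g)" by (rule sum_hcomp[of g]) blast
    show "g \<in> rspan S" by (subst N) (rule sum)
  qed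
qed

text \<open>Only the regularity of \<open>b\<close> needs the grading. That of \<open>a\<close>
  modulo \<open>b\<close> is formal: from \<open>a * g = b * r + s\<close> one gets
  \<open>r = a * h + q\<close>, and \<open>a\<close> cancels from
  \<open>a * (g - b * h)\<close>.\<close>

lemma rec_regular_swap:
  fixes S :: "('x::finite, 'k::field) mpoly set"
  assumes S: "\<And>s. s \<in> S \<Longrightarrow> \<exists>e. homogeneous e s"
    and a: "homogeneous da a" "0 < da" and b: "homogeneous db b"
    and reg: "rec_regular S (a # b # as)"
  shows "rec_regular S (b # a # as)"
proof -
  from reg have 1: "regular_mod S a" "regular_mod (insert a S) b" by auto
  have "regular_mod S b" by (rule regular_mod_swap[OF S a b 1])
  moreover have "regular_mod (insert b S) a" unfolding regular_mod_def
  proof (intro allI impI)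
    fix g assume "a * g \<in> rspan (insert b S)"
    then obtain r s where rs: "s \<in> rspan S" "a * g = b * r + s" by (rule rspan_insertE)
    have "b * r = a * g + (- s)" using rs by simp
    also have "\<dots> \<in> rspan (insert a S)" by (intro rspan_insertI ideals.span_neg rs)
    finally have "r \<in> rspan (insert a S)" by (rule regular_modD[OF 1(2)])
    then obtain h q where hq: "q \<in> rspan S" "r = a * h + q" by (rule rspan_insertE)
    have "a * (g - b * h) = b * q + s" using rs(2) hq(2) by (simp add: algebra_simps)
    also have "\<dots> \<in> rspan S" by (intro ideals.span_add rspan_mult_left rs hq)
    finally have "g - b * h \<in> rspan S" by (rule regular_modD[OF 1(1)])
    from rspan_insertI[OF this, of b h] show "g \<in> rspan (insert b S)" by simp
  qed
  ultimately show ?thesis using reg by (simp add: insert_commute)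
qed

lemma rec_regular_move:
  fixes S :: "('x::finite, 'k::field) mpoly set"
  assumes "\<And>s. s \<in> S \<Longrightarrow> \<exists>e. homogeneous e s"
    and "\<And>s. s \<in> set xs \<Longrightarrow> \<exists>e>0. homogeneous e s" and "homogeneous da a" "0 < da"
    and "rec_regular S (xs @ a # ys)"
  shows "rec_regular S (a # xs @ ys)"
  using assms
proof (induction xs arbitrary: S)
  case Nil
  then show ?case by simp
next
  case (Cons x xs)
  obtain e where e: "0 < e" "homogeneous e x" using Cons.prems(2) by auto
  have "rec_regular (insert x S) (a # xs @ ys)"
    using Cons.prems e by (intro Cons.IH) auto
  with Cons.prems(5) have "rec_regular S (x # a # xs @ ys)" by simp
  from rec_regular_swap[OF Cons.prems(1) e(2,1) Cons.prems(3) this] show ?case by simp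
qed

lemma rec_regular_permute:
  fixes S :: "('x::finite, 'k::field) mpoly set"
  assumes "\<And>s. s \<in> S \<Longrightarrow> \<exists>e. homogeneous e s"
    and "\<And>s. s \<in> set xs \<Longrightarrow> \<exists>e>0. homogeneous e s"
    and "mset xs = mset ys" and "rec_regular S xs"
  shows "rec_regular S ys"
  using assms
proof (induction ys arbitrary: xs S)
  case Nil
  then show ?case by simp
next
  case (Cons y ys)
  have "y \<in> set xs" using Cons.prems(3) by (metis list.set_intros(1) mset_eq_setD)
  then obtain us vs where xs: "xs = us @ y # vs" by (meson split_list)
  obtain e where e: "0 < e" "homogeneous e y" using Cons.prems(2) xs by auto
  have 1: "rec_regular S (y # us @ vs)"
    using Cons.prems e by (intro rec_regular_move[where da = e]) (auto simp: xs)
  have "rec_regular (insert y S) ys"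
    using Cons.prems e 1 by (intro Cons.IH[of _ "us @ vs"]) (auto simp: xs)
  with 1 show ?case by simp
qed

lemma rec_regular_append:
  "rec_regular S (xs @ ys) \<longleftrightarrow> rec_regular S xs \<and> rec_regular (S \<union> set xs) ys"
  by (induction xs arbitrary: S) auto

lemma rec_regular_permutable:
  fixes fs :: "('x::finite, 'k::field) mpoly list"
  assumes "rec_regular {} fs" "\<And>s. s \<in> set fs \<Longrightarrow> \<exists>e>0. homogeneous e s" "distinct fs"
    and "B \<subseteq> set fs" "w \<in> set fs - B"
  shows "regular_mod B w"
proof -
  \<comment> \<open>The sequence is reordered as \<open>B\<close>, then \<open>w\<close>, then the
    rest.\<close>
  define bs where "bs = filter (\<lambda>x. x \<in> B) fs"
  define cs where "cs = filter (\<lambda>x. x \<notin> B \<and> x \<noteq> w) fs"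
  have "mset fs = mset (bs @ w # cs)"
    using assms(3,5) unfolding bs_def cs_def
    by (intro iffD1[OF set_eq_iff_mset_eq_distinct]) auto
  from rec_regular_permute[OF _ assms(2) this assms(1)]
  have "rec_regular {} (bs @ w # cs)" by auto
  moreover have "set bs = B" using assms(4) by (auto simp: bs_def)
  ultimately show ?thesis by (simp add: rec_regular_append)
qed

section \<open>From the ring record to ideals as spans\<close>

lemma mpoly_ring_simps [simp]:
  "carrier mpoly_ring = UNIV" "x \<otimes>\<^bsub>mpoly_ring\<^esub> y = x * y" "x \<oplus>\<^bsub>mpoly_ring\<^esub> y = x + y"
  "\<one>\<^bsub>mpoly_ring\<^esub> = 1" "\<zero>\<^bsub>mpoly_ring\<^esub> = 0"
  by (simp_all add: mpoly_ring_def)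

lemma genideal_mpoly_ring: "Idl\<^bsub>mpoly_ring\<^esub> S = rspan S"
  for S :: "('x, 'k::field) mpoly set"
proof -
  interpret C: cring "mpoly_ring :: ('x, 'k) mpoly ring" by (rule cring_mpoly_ring)
  have carr: "carrier (mpoly_ring :: ('x, 'k) mpoly ring) = UNIV" by (simp add: mpoly_ring_def)
  show ?thesis
  proof
    have "ideal (rspan S) (mpoly_ring :: ('x, 'k) mpoly ring)"
    proof (rule idealI)
      show "subgroup (rspan S) (add_monoid (mpoly_ring :: ('x, 'k) mpoly ring))"
      proof (rule C.add.subgroupI)
        show "\<ominus>\<^bsub>mpoly_ring\<^esub> a \<in> rspan S" if "a \<in> rspan S" for a
        proof -
          have "\<ominus>\<^bsub>mpoly_ring\<^esub> a = - a"
            using C.add.inv_equality[of "- a" a] by (simp add: mpoly_ring_def a_inv_def)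
          then show ?thesis using that by (simp add: ideals.span_neg)
        qed
      qed (use ideals.span_zero in \<open>auto simp: mpoly_ring_def intro: ideals.span_add\<close>)
    qed (auto simp: mpoly_ring_def rspan_mult_left rspan_mult_right intro: C.ring_axioms[unfolded mpoly_ring_def])
    then show "Idl\<^bsub>mpoly_ring\<^esub> S \<subseteq> rspan S"
      by (rule C.genideal_minimal) (rule ideals.span_superset)
    interpret I: ideal "Idl\<^bsub>mpoly_ring\<^esub> S" "mpoly_ring :: ('x, 'k) mpoly ring"
      by (rule C.genideal_ideal) (simp add: carr)
    have "ideals.subspace (Idl\<^bsub>mpoly_ring\<^esub> S)"
      unfolding ideals.subspace_def
      using I.zero_closed I.a_closed I.I_l_closed by (simp add: mpoly_ring_def)
    then show "rspan S \<subseteq> Idl\<^bsub>mpoly_ring\<^esub> S"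
      using C.genideal_self[of S] by (intro ideals.span_minimal) (simp_all add: carr)
  qed
qed

lemma regular_sequence_rec_regular:
  assumes "regular_sequence mpoly_ring fs"
  shows "rec_regular {} fs"
proof -
  have reg: "regular_mod (set (take i fs)) (fs ! i)" if "i < length fs" for i
    using assms that by (simp add: regular_sequence_def genideal_mpoly_ring regular_mod_def)
  have "rec_regular {} (take i fs)" if "i \<le> length fs" for i
    using that reg by (induction i) (simp_all add: take_Suc_conv_app_nth rec_regular_append)
  from this[of "length fs"] show ?thesis by simp
qed

text \<open>Genericity provides one regular order, and for forms one order gives all. Injectivity of
  \<open>f\<close> translates between sets of forms and sets of variables.\<close>

lemma c_generic_permutable_regular:
  fixes f :: "'z::finite \<Rightarrow> ('x::finite, 'k::field) mpoly"
  assumes "c_generic c F" "bij_betw f UNIV F" "\<forall>p\<in>F. is_form p" "card V \<le> c + 1"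
  shows "permutable_regular f V"
proof -
  have inj: "inj f" using assms(2) by (simp add: bij_betw_def)
  have "f ` V \<subseteq> F" using assms(2) by (auto simp: bij_betw_def)
  moreover have "card (f ` V) \<le> c + 1"
    using assms(4) card_image_le[of V f] by simp
  ultimately have "forms_regular_sequence mpoly_ring (f ` V)"
    using assms(1) by (simp add: c_generic_def)
  then obtain fs where fs: "set fs = f ` V" "distinct fs" "regular_sequence mpoly_ring fs"
    by (auto simp: forms_regular_sequence_def)
  have forms: "\<exists>e>0. homogeneous e s" if "s \<in> set fs" for s
  proof -
    have "is_form s" using that assms(3) \<open>f ` V \<subseteq> F\<close> unfolding fs(1) by blast
    then show ?thesis by (auto simp: is_form_def form_of_degree_def homogeneous_def)
  qed
  show ?thesis unfolding permutable_regular_def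
  proof (intro allI impI ballI)
    fix B w assume "B \<subseteq> V" "w \<in> V - B"
    then show "regular_mod (f ` B) (f w)"
      using inj fs(1) by (intro rec_regular_permutable[OF regular_sequence_rec_regular[OF fs(3)] forms fs(2)])
        (auto dest: injD)
  qed
qed


section \<open>Graded free resolutions\<close>

type_synonym ('x, 'k) vec = "nat \<Rightarrow> ('x, 'k) mpoly"

text \<open>The list holds the degrees of the basis vectors; the underlying module depends on its
  length alone.\<close>

definition free_vecs :: "nat list \<Rightarrow> ('x::finite, 'k::field) vec set"
  where "free_vecs \<delta> = {v. \<forall>i\<ge>length \<delta>. v i = 0}"

text \<open>The comparison of \<open>\<delta> ! i\<close> with \<open>e\<close> guards against
  truncated subtraction, here and in \<open>vhom\<close>.\<close>

definition vcomp :: "nat list \<Rightarrow> nat \<Rightarrow> ('x::finite, 'k::field) vec \<Rightarrow> ('x, 'k) vec"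
  where "vcomp \<delta> e v = (\<lambda>i. if i < length \<delta> \<and> \<delta> ! i \<le> e then hcomp (e - \<delta> ! i) (v i) else 0)"

definition vhom :: "nat list \<Rightarrow> nat \<Rightarrow> ('x::finite, 'k::field) vec \<Rightarrow> bool"
  where "vhom \<delta> e v \<longleftrightarrow>
    (\<forall>i. v i \<noteq> 0 \<longrightarrow> i < length \<delta> \<and> \<delta> ! i \<le> e \<and> homogeneous (e - \<delta> ! i) (v i))"

text \<open>Commuting with \<open>vcomp\<close> says that the map is homogeneous of degree 0. All
  conditions are confined to \<open>free_vecs\<close>, so values elsewhere are arbitrary.\<close>

definition graded_linear :: "nat list \<Rightarrow> nat list \<Rightarrow>
    (('x::finite, 'k::field) vec \<Rightarrow> ('x, 'k) vec) \<Rightarrow> bool"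
  where "graded_linear \<gamma> \<delta> \<pi> \<longleftrightarrow>
    (\<forall>v\<in>free_vecs \<gamma>. \<pi> v \<in> free_vecs \<delta> \<and>
      (\<forall>w\<in>free_vecs \<gamma>. \<pi> (\<lambda>i. v i + w i) = (\<lambda>i. \<pi> v i + \<pi> w i)) \<and>
      (\<forall>r. \<pi> (\<lambda>i. r * v i) = (\<lambda>i. r * \<pi> v i)) \<and>
      (\<forall>e. \<pi> (vcomp \<gamma> e v) = vcomp \<delta> e (\<pi> v)))"

definition graded_kernel :: "nat list \<Rightarrow>
    (('x::finite, 'k::field) vec \<Rightarrow> ('x, 'k) vec) \<Rightarrow> ('x, 'k) vec set"
  where "graded_kernel \<gamma> \<pi> = {v \<in> free_vecs \<gamma>. \<pi> v = (\<lambda>_. 0)}"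

definition graded_submodule :: "nat list \<Rightarrow> ('x::finite, 'k::field) vec set \<Rightarrow> bool"
  where "graded_submodule \<delta> B \<longleftrightarrow> B \<subseteq> free_vecs \<delta> \<and> (\<lambda>_. 0) \<in> B \<and>
    (\<forall>v\<in>B. (\<forall>w\<in>B. (\<lambda>i. v i + w i) \<in> B) \<and> (\<forall>r. (\<lambda>i. r * v i) \<in> B) \<and> (\<forall>e. vcomp \<delta> e v \<in> B))"

definition lincomb :: "nat \<Rightarrow> (nat \<Rightarrow> nat \<Rightarrow> 'a::comm_ring_1) \<Rightarrow> (nat \<Rightarrow> 'a) \<Rightarrow> nat \<Rightarrow> 'a"
  where "lincomb n x v = (\<lambda>i. \<Sum>j<n. v j * x j i)"

definition unit_vec :: "nat \<Rightarrow> nat \<Rightarrow> 'a::comm_ring_1"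
  where "unit_vec j = (\<lambda>i. if i = j then 1 else 0)"

definition vec_join :: "nat \<Rightarrow> (nat \<Rightarrow> 'a) \<Rightarrow> (nat \<Rightarrow> 'a) \<Rightarrow> nat \<Rightarrow> 'a"
  where "vec_join m v w = (\<lambda>i. if i < m then v i else w (i - m))"

definition vec_take :: "nat \<Rightarrow> (nat \<Rightarrow> 'a::zero) \<Rightarrow> nat \<Rightarrow> 'a"
  where "vec_take m z = (\<lambda>i. if i < m then z i else 0)"

definition vec_drop :: "nat \<Rightarrow> (nat \<Rightarrow> 'a) \<Rightarrow> nat \<Rightarrow> 'a"
  where "vec_drop m z = (\<lambda>i. z (i + m))"

text \<open>All coordinates lie in the irrelevant ideal.\<close>

definition minimal_vec :: "('x::finite, 'k::field) vec \<Rightarrow> bool"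
  where "minimal_vec v \<longleftrightarrow> (\<forall>i. lookup (v i) 0 = 0)"

lemma zero_in_free_vecs [simp]: "(\<lambda>_. 0) \<in> free_vecs \<delta>"
  by (simp add: free_vecs_def)

lemma free_vecs_add: "v \<in> free_vecs \<delta> \<Longrightarrow> w \<in> free_vecs \<delta> \<Longrightarrow> (\<lambda>i. v i + w i) \<in> free_vecs \<delta>"
  by (simp add: free_vecs_def)

lemma free_vecs_scale: "v \<in> free_vecs \<delta> \<Longrightarrow> (\<lambda>i. r * v i) \<in> free_vecs \<delta>"
  by (simp add: free_vecs_def)

lemma vcomp_in_free_vecs: "vcomp \<delta> e v \<in> free_vecs \<delta>"
  by (simp add: free_vecs_def vcomp_def)

lemma unit_vec_in_free_vecs: "j < length \<delta> \<Longrightarrow> unit_vec j \<in> free_vecs \<delta>"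
  by (simp add: free_vecs_def unit_vec_def)

lemma vcomp_zero: "vcomp \<delta> e (\<lambda>_. 0) = (\<lambda>_. 0)"
  by (auto simp: vcomp_def)

lemma vcomp_add: "vcomp \<delta> e (\<lambda>i. v i + w i) = (\<lambda>i. vcomp \<delta> e v i + vcomp \<delta> e w i)"
  by (simp add: vcomp_def hcomp_add fun_eq_iff)

lemma vhom_vcomp: "vhom \<delta> e (vcomp \<delta> e v)"
  by (simp add: vhom_def vcomp_def)

lemma vcomp_vhom: "vhom \<delta> e v \<Longrightarrow> vcomp \<delta> e v = v"
  unfolding vhom_def vcomp_def by (rule ext) (metis hcomp_0 hcomp_homogeneous)

lemma vhom_in_free_vecs: "vhom \<delta> e v \<Longrightarrow> v \<in> free_vecs \<delta>"
  unfolding vhom_def free_vecs_def using linorder_not_less by blast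

lemma homogeneous_1: "homogeneous 0 (1 :: ('x::finite, 'k::field) mpoly)"
  by (simp add: homogeneous_def mdegree_def)

lemma vhom_unit_vec: "j < length \<gamma> \<Longrightarrow> vhom \<gamma> (\<gamma> ! j) (unit_vec j)"
  by (simp add: vhom_def unit_vec_def homogeneous_1)

lemma graded_linearD:
  assumes "graded_linear \<gamma> \<delta> \<pi>" "v \<in> free_vecs \<gamma>"
  shows "\<pi> v \<in> free_vecs \<delta>"
    and "w \<in> free_vecs \<gamma> \<Longrightarrow> \<pi> (\<lambda>i. v i + w i) = (\<lambda>i. \<pi> v i + \<pi> w i)"
    and "\<pi> (\<lambda>i. r * v i) = (\<lambda>i. r * \<pi> v i)"
    and "\<pi> (vcomp \<gamma> e v) = vcomp \<delta> e (\<pi> v)"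
  using assms unfolding graded_linear_def by blast+

lemma graded_linear_zero: "graded_linear \<gamma> \<delta> \<pi> \<Longrightarrow> \<pi> (\<lambda>_. 0) = (\<lambda>_. 0)"
  using graded_linearD(3)[of \<gamma> \<delta> \<pi> "\<lambda>_. 0" 0] by simp

lemma graded_linear_vhom:
  assumes "graded_linear \<gamma> \<delta> \<pi>" "vhom \<gamma> e v"
  shows "vhom \<delta> e (\<pi> v)"
  using graded_linearD(4)[OF assms(1) vhom_in_free_vecs[OF assms(2)], of e]
  by (metis assms(2) vcomp_vhom vhom_vcomp)

lemma graded_linear_lincomb:
  fixes x :: "nat \<Rightarrow> nat \<Rightarrow> ('x::finite, 'k::field) mpoly"
  assumes "\<And>j. j < length \<gamma> \<Longrightarrow> vhom \<delta> (\<gamma> ! j) (x j)"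
  shows "graded_linear \<gamma> \<delta> (lincomb (length \<gamma>) x)"
  unfolding graded_linear_def
proof (intro ballI conjI allI)
  fix v w :: "('x, 'k) vec" and r :: "('x, 'k) mpoly" and e
  have x0: "x j i = 0" if "j < length \<gamma>" "length \<delta> \<le> i" for i j
    using assms[OF that(1)] that(2) by (auto simp: vhom_def)
  then show "lincomb (length \<gamma>) x v \<in> free_vecs \<delta>"
    by (simp add: free_vecs_def lincomb_def)
  show "lincomb (length \<gamma>) x (\<lambda>i. v i + w i) =
      (\<lambda>i. lincomb (length \<gamma>) x v i + lincomb (length \<gamma>) x w i)"
    by (simp add: lincomb_def algebra_simps sum.distrib)
  show "lincomb (length \<gamma>) x (\<lambda>i. r * v i) = (\<lambda>i. r * lincomb (length \<gamma>) x v i)"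
    by (simp add: lincomb_def sum_distrib_left mult.assoc)
  have "vcomp \<gamma> e v j * x j i =
      (if i < length \<delta> \<and> \<delta> ! i \<le> e then hcomp (e - \<delta> ! i) (v j * x j i) else 0)"
    if j: "j < length \<gamma>" for i j
  proof (cases "x j i = 0")
    case False
    then have x: "i < length \<delta>" "\<delta> ! i \<le> \<gamma> ! j" "homogeneous (\<gamma> ! j - \<delta> ! i) (x j i)"
      using assms[OF j] by (auto simp: vhom_def)
    then show ?thesis
      using j by (auto simp: vcomp_def mult.commute[of _ "x j i"] hcomp_mult_homogeneous[OF x(3)])
  qed simp
  then show "lincomb (length \<gamma>) x (vcomp \<gamma> e v) = vcomp \<delta> e (lincomb (length \<gamma>) x v)"
    by (auto simp: lincomb_def vcomp_def hcomp_sum fun_eq_iff)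
qed

text \<open>The grading is left out because \<open>minimal_no_retraction\<close> applies this to a
  splitting that need not be graded.\<close>

lemma free_linear_eq_lincomb:
  fixes f :: "('x::finite, 'k::field) vec \<Rightarrow> ('x, 'k) vec"
  assumes add: "\<And>v w. v \<in> free_vecs \<gamma> \<Longrightarrow> w \<in> free_vecs \<gamma> \<Longrightarrow> f (\<lambda>i. v i + w i) = (\<lambda>i. f v i + f w i)"
    and scale: "\<And>r v. v \<in> free_vecs \<gamma> \<Longrightarrow> f (\<lambda>i. r * v i) = (\<lambda>i. r * f v i)"
    and v: "v \<in> free_vecs \<gamma>"
  shows "f v = lincomb (length \<gamma>) (\<lambda>j. f (unit_vec j)) v"
proof -
  have free: "(\<lambda>i. v j * unit_vec j i) \<in> free_vecs \<gamma>" if "j < length \<gamma>" for j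
    using that by (intro free_vecs_scale unit_vec_in_free_vecs)
  have sum: "(\<lambda>i. \<Sum>j<m. v j * unit_vec j i) \<in> free_vecs \<gamma> \<and>
      f (\<lambda>i. \<Sum>j<m. v j * unit_vec j i) = lincomb m (\<lambda>j. f (unit_vec j)) v"
    if "m \<le> length \<gamma>" for m
    using that
  proof (induction m)
    case 0
    show ?case using scale[of "\<lambda>_. 0" 0] by (simp add: lincomb_def)
  next
    case (Suc m)
    then have m: "m < length \<gamma>" by simp
    from Suc show ?case
      using free_vecs_add[of "\<lambda>i. \<Sum>j<m. v j * unit_vec j i" \<gamma>, OF _ free[OF m]]
        add[of "\<lambda>i. \<Sum>j<m. v j * unit_vec j i", OF _ free[OF m]]
        scale[OF unit_vec_in_free_vecs[OF m]]
      by (simp add: lincomb_def fun_eq_iff)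
  qed
  have "(\<lambda>i. \<Sum>j<length \<gamma>. v j * unit_vec j i) = v"
  proof
    fix i
    have "(\<Sum>j<length \<gamma>. v j * unit_vec j i) = (\<Sum>j<length \<gamma>. if i = j then v j else 0)"
      by (rule sum.cong) (auto simp: unit_vec_def)
    then show "(\<Sum>j<length \<gamma>. v j * unit_vec j i) = v i"
      using v by (simp add: free_vecs_def)
  qed
  then show ?thesis using sum[of "length \<gamma>"] by simp
qed

lemma graded_linear_eq_lincomb:
  assumes "graded_linear \<gamma> \<delta> \<pi>" "v \<in> free_vecs \<gamma>"
  shows "\<pi> v = lincomb (length \<gamma>) (\<lambda>j. \<pi> (unit_vec j)) v"
  by (rule free_linear_eq_lincomb) (simp_all add: assms(2) graded_linearD[OF assms(1)])

lemma graded_submoduleD: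
  assumes "graded_submodule \<delta> B" "v \<in> B"
  shows "w \<in> B \<Longrightarrow> (\<lambda>i. v i + w i) \<in> B" and "(\<lambda>i. r * v i) \<in> B" and "vcomp \<delta> e v \<in> B"
    and "v \<in> free_vecs \<delta>"
  using assms unfolding graded_submodule_def by blast+

lemma graded_submodule_kernel:
  assumes "graded_linear \<gamma> \<delta> \<pi>"
  shows "graded_submodule \<gamma> (graded_kernel \<gamma> \<pi>)"
  unfolding graded_submodule_def graded_kernel_def
  by (auto simp: free_vecs_add free_vecs_scale vcomp_in_free_vecs graded_linear_zero[OF assms]
      graded_linearD[OF assms] vcomp_zero)

lemma graded_submodule_lincomb:
  assumes "graded_submodule \<delta> B" "\<And>j. j < n \<Longrightarrow> y j \<in> B"
  shows "lincomb n y v \<in> B"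
  using assms(2)
proof (induction n)
  case 0
  then show ?case using assms(1) by (simp add: graded_submodule_def lincomb_def)
next
  case (Suc n)
  then have "lincomb n y v \<in> B" "y n \<in> B" by auto
  then have "(\<lambda>i. lincomb n y v i + v n * y n i) \<in> B"
    using assms(1) unfolding graded_submodule_def by auto
  then show ?case by (simp add: lincomb_def)
qed

section \<open>Vectors in a direct sum of two free modules\<close>

lemma vec_join_take_drop: "vec_join m (vec_take m z) (vec_drop m z) = z"
  by (auto simp: vec_join_def vec_take_def vec_drop_def)

lemma vec_take_join: "v \<in> free_vecs \<alpha> \<Longrightarrow> m = length \<alpha> \<Longrightarrow> vec_take m (vec_join m v w) = v"
  by (auto simp: vec_join_def vec_take_def free_vecs_def fun_eq_iff)

lemma vec_drop_join: "vec_drop m (vec_join m v w) = w"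
  by (auto simp: vec_join_def vec_drop_def)

lemma vec_take_in: "vec_take (length \<alpha>) z \<in> free_vecs \<alpha>"
  by (simp add: vec_take_def free_vecs_def)

lemma vec_drop_in: "z \<in> free_vecs (\<alpha> @ \<gamma>) \<Longrightarrow> vec_drop (length \<alpha>) z \<in> free_vecs \<gamma>"
  by (simp add: vec_drop_def free_vecs_def)

lemma vec_join_in:
  "v \<in> free_vecs \<alpha> \<Longrightarrow> w \<in> free_vecs \<gamma> \<Longrightarrow> vec_join (length \<alpha>) v w \<in> free_vecs (\<alpha> @ \<gamma>)"
  by (auto simp: vec_join_def free_vecs_def)

lemma vec_join_zero: "vec_join m (\<lambda>_. 0) (\<lambda>_. 0) = (\<lambda>_. 0)"
  by (auto simp: vec_join_def)

lemma vec_join_eq_zero_iff: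
  assumes "v \<in> free_vecs \<alpha>"
  shows "vec_join (length \<alpha>) v w = (\<lambda>_. 0) \<longleftrightarrow> v = (\<lambda>_. 0) \<and> w = (\<lambda>_. 0)"
proof
  assume "vec_join (length \<alpha>) v w = (\<lambda>_. 0)"
  then show "v = (\<lambda>_. 0) \<and> w = (\<lambda>_. 0)"
    using vec_take_join[OF assms refl, of w] vec_drop_join[of "length \<alpha>" v w]
    by (auto simp: vec_take_def vec_drop_def)
qed (simp add: vec_join_zero)

lemma vec_join_add:
  "vec_join m (\<lambda>i. v i + v' i) (\<lambda>i. w i + w' i) = (\<lambda>i. vec_join m v w i + vec_join m v' w' i)"
  by (auto simp: vec_join_def)

lemma vec_join_scale:
  "vec_join m (\<lambda>i. r * v i) (\<lambda>i. r * w i) = (\<lambda>i. r * vec_join m v w i)"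
  by (auto simp: vec_join_def)

lemma vec_join_lincomb:
  "vec_join m (lincomb n x v) (lincomb n y v) = lincomb n (\<lambda>j. vec_join m (x j) (y j)) v"
  by (auto simp: vec_join_def lincomb_def fun_eq_iff)

lemma vcomp_append:
  "vcomp (\<alpha> @ \<gamma>) e z =
    vec_join (length \<alpha>) (vcomp \<alpha> e (vec_take (length \<alpha>) z)) (vcomp \<gamma> e (vec_drop (length \<alpha>) z))"
  by (auto simp: vec_join_def vec_take_def vec_drop_def vcomp_def nth_append fun_eq_iff)

lemma vcomp_join:
  "v \<in> free_vecs \<alpha> \<Longrightarrow>
    vcomp (\<alpha> @ \<gamma>) e (vec_join (length \<alpha>) v w) = vec_join (length \<alpha>) (vcomp \<alpha> e v) (vcomp \<gamma> e w)"
  by (simp add: vcomp_append vec_take_join vec_drop_join)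

lemma vec_take_vcomp:
  "vec_take (length \<alpha>) (vcomp (\<alpha> @ \<gamma>) e z) = vcomp \<alpha> e (vec_take (length \<alpha>) z)"
  unfolding vcomp_append by (rule vec_take_join[OF vcomp_in_free_vecs refl])

lemma vec_drop_vcomp:
  "vec_drop (length \<alpha>) (vcomp (\<alpha> @ \<gamma>) e z) = vcomp \<gamma> e (vec_drop (length \<alpha>) z)"
  by (simp add: vcomp_append vec_drop_join)

lemma vec_take_add: "vec_take m (\<lambda>i. v i + w i) = (\<lambda>i. vec_take m v i + vec_take m w i)"
  for v w :: "nat \<Rightarrow> 'a::comm_ring_1"
  by (auto simp: vec_take_def)

lemma vec_take_scale: "vec_take m (\<lambda>i. r * v i) = (\<lambda>i. r * vec_take m v i)"
  for v :: "nat \<Rightarrow> 'a::comm_ring_1"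
  by (auto simp: vec_take_def)

lemma vec_drop_add: "vec_drop m (\<lambda>i. v i + w i) = (\<lambda>i. vec_drop m v i + vec_drop m w i)"
  by (auto simp: vec_drop_def)

lemma vec_drop_scale: "vec_drop m (\<lambda>i. r * v i) = (\<lambda>i. r * vec_drop m v i)"
  by (auto simp: vec_drop_def)

definition vec_copair :: "nat \<Rightarrow> ((nat \<Rightarrow> 'a::comm_ring_1) \<Rightarrow> nat \<Rightarrow> 'a) \<Rightarrow> ((nat \<Rightarrow> 'a) \<Rightarrow> nat \<Rightarrow> 'a) \<Rightarrow>
    (nat \<Rightarrow> 'a) \<Rightarrow> nat \<Rightarrow> 'a"
  where "vec_copair m F G z = (\<lambda>i. F (vec_take m z) i + G (vec_drop m z) i)"

lemma graded_linear_copair: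
  fixes F G :: "('x::finite, 'k::field) vec \<Rightarrow> ('x, 'k) vec"
  assumes F: "graded_linear \<alpha> \<delta> F" and G: "graded_linear \<gamma> \<delta> G"
  shows "graded_linear (\<alpha> @ \<gamma>) \<delta> (vec_copair (length \<alpha>) F G)"
  unfolding graded_linear_def
proof (intro ballI conjI allI)
  fix v :: "('x, 'k) vec" assume "v \<in> free_vecs (\<alpha> @ \<gamma>)"
  note v = vec_take_in[of \<alpha> v] vec_drop_in[OF this]
  note Fv = graded_linearD[OF F v(1)] and Gv = graded_linearD[OF G v(2)]
  show "vec_copair (length \<alpha>) F G v \<in> free_vecs \<delta>"
    unfolding vec_copair_def by (intro free_vecs_add Fv Gv)
  show "vec_copair (length \<alpha>) F G (\<lambda>i. r * v i) = (\<lambda>i. r * vec_copair (length \<alpha>) F G v i)" for r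
    by (simp add: vec_copair_def vec_take_scale vec_drop_scale Fv Gv algebra_simps)
  show "vec_copair (length \<alpha>) F G (vcomp (\<alpha> @ \<gamma>) e v) = vcomp \<delta> e (vec_copair (length \<alpha>) F G v)" for e
    by (simp add: vec_copair_def vec_take_vcomp vec_drop_vcomp Fv Gv vcomp_add)
  fix w :: "('x, 'k) vec" assume "w \<in> free_vecs (\<alpha> @ \<gamma>)"
  note w = vec_take_in[of \<alpha> w] vec_drop_in[OF this]
  show "vec_copair (length \<alpha>) F G (\<lambda>i. v i + w i) =
      (\<lambda>i. vec_copair (length \<alpha>) F G v i + vec_copair (length \<alpha>) F G w i)"
    by (simp add: vec_copair_def vec_take_add vec_drop_add Fv(2)[OF w(1)] Gv(2)[OF w(2)] algebra_simps)
qed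

lemma graded_linear_zero_map: "graded_linear \<gamma> \<delta> (\<lambda>_ _. 0)"
  by (auto simp: graded_linear_def vcomp_zero)

lemma graded_linear_join:
  fixes F G :: "('x::finite, 'k::field) vec \<Rightarrow> ('x, 'k) vec"
  assumes F: "graded_linear \<beta> \<alpha> F" and G: "graded_linear \<beta> \<gamma> G"
  shows "graded_linear \<beta> (\<alpha> @ \<gamma>) (\<lambda>v. vec_join (length \<alpha>) (F v) (G v))"
  unfolding graded_linear_def
proof (intro ballI conjI allI)
  fix v :: "('x, 'k) vec" assume "v \<in> free_vecs \<beta>"
  note Fv = graded_linearD[OF F this] and Gv = graded_linearD[OF G this]
  show "vec_join (length \<alpha>) (F v) (G v) \<in> free_vecs (\<alpha> @ \<gamma>)" by (intro vec_join_in Fv Gv)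
  show "vec_join (length \<alpha>) (F (\<lambda>i. r * v i)) (G (\<lambda>i. r * v i)) =
      (\<lambda>i. r * vec_join (length \<alpha>) (F v) (G v) i)" for r
    by (simp add: Fv Gv flip: vec_join_scale)
  show "vec_join (length \<alpha>) (F (vcomp \<beta> e v)) (G (vcomp \<beta> e v)) =
      vcomp (\<alpha> @ \<gamma>) e (vec_join (length \<alpha>) (F v) (G v))" for e
    by (simp add: Fv Gv vcomp_join)
  fix w :: "('x, 'k) vec" assume w: "w \<in> free_vecs \<beta>"
  show "vec_join (length \<alpha>) (F (\<lambda>i. v i + w i)) (G (\<lambda>i. v i + w i)) =
      (\<lambda>i. vec_join (length \<alpha>) (F v) (G v) i + vec_join (length \<alpha>) (F w) (G w) i)"
    by (simp add: Fv(2)[OF w] Gv(2)[OF w] flip: vec_join_add)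
qed

text \<open>
  \<open>free_resolution b n d N\<close>: the submodule \<open>N\<close> of the graded free module with generator degrees
  \<open>d 0\<close> has a graded free resolution with free modules in degrees \<open>d 1, \<dots>, d n\<close>. The flag \<open>b\<close>
  demands that the last map sends some basis vector into the irrelevant ideal times the free
  module before it.
\<close>

primrec free_resolution :: "bool \<Rightarrow> nat \<Rightarrow> (nat \<Rightarrow> nat list) \<Rightarrow> ('x::finite, 'k::field) vec set \<Rightarrow> bool"
  where "free_resolution b 0 d N \<longleftrightarrow> \<not> b \<and> N = {\<lambda>_. 0}"
  | "free_resolution b (Suc n) d N \<longleftrightarrow> (\<exists>\<pi>. graded_linear (d (Suc 0)) (d 0) \<pi> \<and>
      \<pi> ` free_vecs (d (Suc 0)) = N \<and>
      free_resolution (b \<and> n \<noteq> 0) n (\<lambda>i. d (Suc i)) (graded_kernel (d (Suc 0)) \<pi>) \<and>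
      (b \<and> n = 0 \<longrightarrow> (\<exists>j<length (d (Suc 0)). minimal_vec (\<pi> (unit_vec j)))))"

text \<open>The horseshoe lemma for an extension of \<open>C\<close> by \<open>A\<close>, with
  \<open>B\<close> a submodule of the direct sum of the two ambient free modules. In this form it
  applies again to the kernels, which drives the induction. The flag comes from \<open>A\<close>,
  since the basis vectors of its block keep their images up to padding by zeros.\<close>

lemma horseshoe:
  assumes "free_resolution b n dA A" "free_resolution False n dC C"
    and "graded_submodule (dA 0 @ dC 0) B"
    and "A = {v \<in> free_vecs (dA 0). vec_join (length (dA 0)) v (\<lambda>_. 0) \<in> B}"
    and "C = {w \<in> free_vecs (dC 0). \<exists>v\<in>free_vecs (dA 0). vec_join (length (dA 0)) v w \<in> B}"
  shows "free_resolution b n (\<lambda>i. dA i @ dC i) B"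
  using assms
proof (induction n arbitrary: b dA dC A B C)
  case 0
  have "z = (\<lambda>_. 0)" if z: "z \<in> B" for z
  proof -
    define v where "v = vec_take (length (dA 0)) z"
    define w where "w = vec_drop (length (dA 0)) z"
    have zvw: "z = vec_join (length (dA 0)) v w" by (simp add: v_def w_def vec_join_take_drop)
    have "z \<in> free_vecs (dA 0 @ dC 0)" using z 0(3) by (auto simp: graded_submodule_def)
    then have vw: "v \<in> free_vecs (dA 0)" "w \<in> free_vecs (dC 0)"
      by (simp_all add: v_def w_def vec_take_in vec_drop_in)
    then have "w \<in> C" using z zvw 0(5) by blast
    then have w: "w = (\<lambda>_. 0)" using 0(2) by simp
    then have "v \<in> A" using z zvw vw 0(4) by blast
    then have "v = (\<lambda>_. 0)" using 0(1) by simp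
    with w zvw show ?thesis by (simp add: vec_join_zero)
  qed
  then show ?case using 0 by (auto simp: graded_submodule_def)
next
  case (Suc n)
  define \<alpha> \<gamma> \<alpha>1 \<gamma>1 where "\<alpha> = dA 0" "\<gamma> = dC 0" "\<alpha>1 = dA (Suc 0)" "\<gamma>1 = dC (Suc 0)"
  note defs = this
  obtain \<pi>A where A: "graded_linear \<alpha>1 \<alpha> \<pi>A" "\<pi>A ` free_vecs \<alpha>1 = A"
    "free_resolution (b \<and> n \<noteq> 0) n (\<lambda>i. dA (Suc i)) (graded_kernel \<alpha>1 \<pi>A)"
    "b \<and> n = 0 \<longrightarrow> (\<exists>j<length \<alpha>1. minimal_vec (\<pi>A (unit_vec j)))"
    using Suc.prems(1) by (auto simp: defs)
  obtain \<pi>C where C: "graded_linear \<gamma>1 \<gamma> \<pi>C" "\<pi>C ` free_vecs \<gamma>1 = C"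
    "free_resolution False n (\<lambda>i. dC (Suc i)) (graded_kernel \<gamma>1 \<pi>C)"
    using Suc.prems(2) by (auto simp: defs)
  note B = Suc.prems(3)[folded defs]
  note AB = Suc.prems(4)[folded defs]
  note CB = Suc.prems(5)[folded defs]
  \<comment> \<open>A lift to \<open>B\<close> can be taken homogeneous: its component of degree
    \<open>\<gamma>1 ! j\<close> lies in \<open>B\<close> and has the same second block.\<close>
  have "\<exists>x. vhom \<alpha> (\<gamma>1 ! j) x \<and> vec_join (length \<alpha>) x (\<pi>C (unit_vec j)) \<in> B"
    if j: "j < length \<gamma>1" for j
  proof -
    have "\<pi>C (unit_vec j) \<in> C" using C(2) unit_vec_in_free_vecs[OF j] by blast
    then obtain v where v: "v \<in> free_vecs \<alpha>" "vec_join (length \<alpha>) v (\<pi>C (unit_vec j)) \<in> B"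
      using CB by blast
    have "vcomp (\<alpha> @ \<gamma>) (\<gamma>1 ! j) (vec_join (length \<alpha>) v (\<pi>C (unit_vec j))) \<in> B"
      using B v(2) by (simp add: graded_submodule_def)
    then have "vec_join (length \<alpha>) (vcomp \<alpha> (\<gamma>1 ! j) v) (\<pi>C (unit_vec j)) \<in> B"
      by (simp add: vcomp_join[OF v(1)] vcomp_vhom[OF graded_linear_vhom[OF C(1) vhom_unit_vec[OF j]]])
    then show ?thesis using vhom_vcomp by blast
  qed
  then obtain x where x: "vhom \<alpha> (\<gamma>1 ! j) (x j)" "vec_join (length \<alpha>) (x j) (\<pi>C (unit_vec j)) \<in> B"
    if "j < length \<gamma>1" for j by metis
  define \<tau> where "\<tau> = lincomb (length \<gamma>1) x"
  have \<tau>: "graded_linear \<gamma>1 \<alpha> \<tau>" unfolding \<tau>_def by (rule graded_linear_lincomb) (rule x)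
  define F where "F = (\<lambda>v. vec_join (length \<alpha>) (\<pi>A v) (\<lambda>_. 0))"
  define G where "G = (\<lambda>w. vec_join (length \<alpha>) (\<tau> w) (\<pi>C w))"
  have F: "graded_linear \<alpha>1 (\<alpha> @ \<gamma>) F"
    unfolding F_def by (rule graded_linear_join[OF A(1) graded_linear_zero_map])
  have G: "graded_linear \<gamma>1 (\<alpha> @ \<gamma>) G"
    unfolding G_def by (rule graded_linear_join[OF \<tau> C(1)])
  have GB: "G w \<in> B" if w: "w \<in> free_vecs \<gamma>1" for w
    unfolding G_def \<tau>_def
    by (subst graded_linear_eq_lincomb[OF C(1) w], subst vec_join_lincomb,
        rule graded_submodule_lincomb[OF B]) (rule x)
  have FB: "F v \<in> B" if "v \<in> free_vecs \<alpha>1" for v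
    using that A(2) AB unfolding F_def by blast
  define \<pi> where "\<pi> = vec_copair (length \<alpha>1) F G"
  have \<pi>: "graded_linear (\<alpha>1 @ \<gamma>1) (\<alpha> @ \<gamma>) \<pi>"
    unfolding \<pi>_def by (rule graded_linear_copair[OF F G])
  have \<pi>_join: "\<pi> (vec_join (length \<alpha>1) v w) =
      vec_join (length \<alpha>) (\<lambda>i. \<pi>A v i + \<tau> w i) (\<pi>C w)" if "v \<in> free_vecs \<alpha>1" for v w
    using that by (simp add: \<pi>_def vec_copair_def vec_take_join vec_drop_join F_def G_def flip: vec_join_add)
  have \<pi>B: "\<pi> z \<in> B" if "z \<in> free_vecs (\<alpha>1 @ \<gamma>1)" for z
    unfolding \<pi>_def vec_copair_def
    using B FB[OF vec_take_in[of \<alpha>1 z]] GB[OF vec_drop_in[OF that]]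
    by (simp add: graded_submodule_def)
  have "z \<in> \<pi> ` free_vecs (\<alpha>1 @ \<gamma>1)" if z: "z \<in> B" for z
  proof -
    define v where "v = vec_take (length \<alpha>) z"
    define w where "w = vec_drop (length \<alpha>) z"
    have zvw: "z = vec_join (length \<alpha>) v w" by (simp add: v_def w_def vec_join_take_drop)
    have "z \<in> free_vecs (\<alpha> @ \<gamma>)" using z B by (auto simp: graded_submodule_def)
    then have vw: "v \<in> free_vecs \<alpha>" "w \<in> free_vecs \<gamma>"
      by (simp_all add: v_def w_def vec_take_in vec_drop_in)
    then have "w \<in> C" using z zvw CB by blast
    then obtain w' where w': "w' \<in> free_vecs \<gamma>1" "w = \<pi>C w'" using C(2) by blast
    have "(\<lambda>i. -1 * G w' i) \<in> B"
      by (rule graded_submoduleD(2)[OF B GB[OF w'(1)]])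
    then have "(\<lambda>i. z i + -1 * G w' i) \<in> B"
      by (rule graded_submoduleD(1)[OF B z])
    also have "(\<lambda>i. z i + -1 * G w' i) = vec_join (length \<alpha>) (\<lambda>i. v i - \<tau> w' i) (\<lambda>_. 0)"
      by (auto simp: zvw G_def w'(2) vec_join_def)
    finally have "(\<lambda>i. v i - \<tau> w' i) \<in> A"
      using vw graded_linearD(1)[OF \<tau> w'(1)] AB by (auto simp: free_vecs_def)
    then obtain v' where v': "v' \<in> free_vecs \<alpha>1" "(\<lambda>i. v i - \<tau> w' i) = \<pi>A v'" using A(2) by blast
    have "v = (\<lambda>i. \<pi>A v' i + \<tau> w' i)"
      by (rule ext) (metis v'(2) diff_add_cancel)
    then have "z = \<pi> (vec_join (length \<alpha>1) v' w')"
      by (simp add: \<pi>_join[OF v'(1)] zvw w'(2))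
    then show ?thesis using vec_join_in[OF v'(1) w'(1)] by blast
  qed
  with \<pi>B have im: "\<pi> ` free_vecs (\<alpha>1 @ \<gamma>1) = B" by blast
  have kerA: "graded_kernel \<alpha>1 \<pi>A =
      {v \<in> free_vecs \<alpha>1. vec_join (length \<alpha>1) v (\<lambda>_. 0) \<in> graded_kernel (\<alpha>1 @ \<gamma>1) \<pi>}"
  proof -
    have "\<pi>A v = (\<lambda>_. 0) \<longleftrightarrow> \<pi> (vec_join (length \<alpha>1) v (\<lambda>_. 0)) = (\<lambda>_. 0)" if v: "v \<in> free_vecs \<alpha>1" for v
    proof -
      have "\<pi> (vec_join (length \<alpha>1) v (\<lambda>_. 0)) = vec_join (length \<alpha>) (\<pi>A v) (\<lambda>_. 0)"
        by (simp add: \<pi>_join[OF v] graded_linear_zero[OF \<tau>] graded_linear_zero[OF C(1)])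
      then show ?thesis
        by (simp add: vec_join_eq_zero_iff[OF graded_linearD(1)[OF A(1) v]])
    qed
    then show ?thesis by (auto simp: graded_kernel_def vec_join_in)
  qed
  \<comment> \<open>Surjectivity on kernels: for \<open>w\<close> in the kernel of
    \<open>\<pi>C\<close> the second block of \<open>G w\<close> is zero, so \<open>\<tau> w\<close>
    lies in \<open>A\<close> and is cancelled by a preimage under \<open>\<pi>A\<close>.\<close>
  have kerC: "graded_kernel \<gamma>1 \<pi>C =
      {w \<in> free_vecs \<gamma>1. \<exists>v\<in>free_vecs \<alpha>1. vec_join (length \<alpha>1) v w \<in> graded_kernel (\<alpha>1 @ \<gamma>1) \<pi>}"
  proof (intro equalityI subsetI)
    fix w assume "w \<in> graded_kernel \<gamma>1 \<pi>C"
    then have w: "w \<in> free_vecs \<gamma>1" "\<pi>C w = (\<lambda>_. 0)" by (auto simp: graded_kernel_def)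
    have "\<tau> w \<in> A" using GB[OF w(1)] graded_linearD(1)[OF \<tau> w(1)] AB by (simp add: G_def w(2))
    then obtain v' where v': "v' \<in> free_vecs \<alpha>1" "\<tau> w = \<pi>A v'" using A(2) by blast
    define v where "v = (\<lambda>i. - 1 * v' i)"
    have v: "v \<in> free_vecs \<alpha>1" unfolding v_def by (rule free_vecs_scale[OF v'(1)])
    have "\<pi> (vec_join (length \<alpha>1) v w) = (\<lambda>_. 0)"
      unfolding \<pi>_join[OF v] unfolding v_def graded_linearD(3)[OF A(1) v'(1)]
      by (simp add: v'(2) w(2) vec_join_zero)
    then show "w \<in> {w \<in> free_vecs \<gamma>1. \<exists>v\<in>free_vecs \<alpha>1. vec_join (length \<alpha>1) v w \<in> graded_kernel (\<alpha>1 @ \<gamma>1) \<pi>}"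
      using v w(1) vec_join_in[OF v w(1)] by (auto simp: graded_kernel_def)
  next
    fix w assume "w \<in> {w \<in> free_vecs \<gamma>1. \<exists>v\<in>free_vecs \<alpha>1. vec_join (length \<alpha>1) v w \<in> graded_kernel (\<alpha>1 @ \<gamma>1) \<pi>}"
    then obtain v where v: "w \<in> free_vecs \<gamma>1" "v \<in> free_vecs \<alpha>1"
      "\<pi> (vec_join (length \<alpha>1) v w) = (\<lambda>_. 0)" by (auto simp: graded_kernel_def)
    have "\<pi>C w = (\<lambda>_. 0)"
      using arg_cong[OF v(3), of "vec_drop (length \<alpha>)"]
      unfolding \<pi>_join[OF v(2)] vec_drop_join by (simp add: vec_drop_def)
    with v(1) show "w \<in> graded_kernel \<gamma>1 \<pi>C" by (simp add: graded_kernel_def)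
  qed
  have res: "free_resolution (b \<and> n \<noteq> 0) n (\<lambda>i. dA (Suc i) @ dC (Suc i)) (graded_kernel (\<alpha>1 @ \<gamma>1) \<pi>)"
    using graded_submodule_kernel[OF \<pi>] kerA kerC
    by (intro Suc.IH[OF A(3) C(3)]) (simp_all add: defs)
  have "\<exists>j<length (\<alpha>1 @ \<gamma>1). minimal_vec (\<pi> (unit_vec j))" if "b \<and> n = 0"
  proof -
    from A(4) that obtain j where j: "j < length \<alpha>1" "minimal_vec (\<pi>A (unit_vec j))" by blast
    have "(unit_vec j :: nat \<Rightarrow> ('a, 'b) mpoly) = vec_join (length \<alpha>1) (unit_vec j) (\<lambda>_. 0)"
      using j(1) by (auto simp: vec_join_def unit_vec_def)
    then have "\<pi> (unit_vec j) = vec_join (length \<alpha>) (\<pi>A (unit_vec j)) (\<lambda>_. 0)"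
      using \<pi>_join[OF unit_vec_in_free_vecs[OF j(1)], of "\<lambda>_. 0"]
      by (simp add: graded_linear_zero[OF \<tau>] graded_linear_zero[OF C(1)])
    then have "minimal_vec (\<pi> (unit_vec j))"
      using j(2) by (simp add: minimal_vec_def vec_join_def)
    then show ?thesis using j(1) by (intro exI[of _ j]) simp
  qed
  with \<pi> im res show ?case
    by (auto simp: defs intro!: exI[of _ \<pi>])
qed

text \<open>Padding brings resolutions to a common length before they are combined. The flag is off
  because a map from the zero module has no basis vector to mark.\<close>

lemma free_resolution_lengthen:
  assumes "free_resolution False n d N" "d (Suc n) = []"
  shows "free_resolution False (Suc n) d N"
  using assms
proof (induction n arbitrary: d N)
  case 0
  have free_Nil: "free_vecs [] = {\<lambda>_. 0}" by (auto simp: free_vecs_def)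
  show ?case
    using 0 graded_linear_zero_map[of "[]" "d 0"]
    by (auto simp: free_Nil graded_kernel_def intro!: exI[of _ "\<lambda>_ _. 0"])
next
  case (Suc n)
  from Suc.prems obtain \<pi> where \<pi>: "graded_linear (d (Suc 0)) (d 0) \<pi>"
      "\<pi> ` free_vecs (d (Suc 0)) = N"
      "free_resolution False n (\<lambda>i. d (Suc i)) (graded_kernel (d (Suc 0)) \<pi>)" by auto
  have "free_resolution False (Suc n) (\<lambda>i. d (Suc i)) (graded_kernel (d (Suc 0)) \<pi>)"
    by (rule Suc.IH[OF \<pi>(3)]) (use Suc.prems in simp)
  with \<pi>(1,2) show ?case
    by (subst free_resolution.simps(2)) (auto simp del: free_resolution.simps)
qed

lemma free_resolution_mono:
  assumes "free_resolution False n d N" "\<And>i. i > n \<Longrightarrow> d i = []" "n \<le> m"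
  shows "free_resolution False m d N"
  using assms(3)
proof (induction m rule: dec_induct)
  case base
  show ?case by (rule assms(1))
next
  case (step m)
  then show ?case using assms(2) by (intro free_resolution_lengthen) auto
qed

text \<open>Each nonzero entry of the image of the \<open>j\<close>-th basis vector has degree
  \<open>d (Suc n) ! j - e\<close> for some \<open>e\<close> in \<open>d n\<close>. This is
  positive, so there is no constant term.\<close>

lemma free_resolution_mark:
  assumes "free_resolution False (Suc n) d N" "j < length (d (Suc n))"
    and "\<And>e. e \<in> set (d n) \<Longrightarrow> e < d (Suc n) ! j"
  shows "free_resolution True (Suc n) d N"
  using assms
proof (induction n arbitrary: d N)
  case 0
  then obtain \<pi> where \<pi>: "graded_linear (d (Suc 0)) (d 0) \<pi>"
      "\<pi> ` free_vecs (d (Suc 0)) = N" "graded_kernel (d (Suc 0)) \<pi> = {\<lambda>_. 0}" by auto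
  have hom: "vhom (d 0) (d (Suc 0) ! j) (\<pi> (unit_vec j))"
    by (rule graded_linear_vhom[OF \<pi>(1) vhom_unit_vec[OF 0(2)]])
  have "minimal_vec (\<pi> (unit_vec j))"
    unfolding minimal_vec_def
  proof
    fix i
    show "lookup (\<pi> (unit_vec j) i) 0 = 0"
    proof (rule ccontr)
      assume nz: "lookup (\<pi> (unit_vec j) i) 0 \<noteq> 0"
      then have "\<pi> (unit_vec j) i \<noteq> 0" by auto
      then have i: "i < length (d 0)" "homogeneous (d (Suc 0) ! j - d 0 ! i) (\<pi> (unit_vec j) i)"
        using hom by (auto simp: vhom_def)
      moreover have "d 0 ! i < d (Suc 0) ! j" using i(1) 0(3) by simp
      ultimately show False
        using nz by (auto simp: homogeneous_def in_keys_iff mdegree_def dest!: bspec[of _ _ 0])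
    qed
  qed
  with \<pi> 0(2) show ?case by (auto intro!: exI[of _ \<pi>])
next
  case (Suc n)
  from Suc.prems obtain \<pi> where \<pi>: "graded_linear (d (Suc 0)) (d 0) \<pi>"
      "\<pi> ` free_vecs (d (Suc 0)) = N"
      "free_resolution False (Suc n) (\<lambda>i. d (Suc i)) (graded_kernel (d (Suc 0)) \<pi>)"
    by (subst (asm) free_resolution.simps(2)) (auto simp del: free_resolution.simps)
  have "free_resolution True (Suc n) (\<lambda>i. d (Suc i)) (graded_kernel (d (Suc 0)) \<pi>)"
    by (rule Suc.IH[OF \<pi>(3)]) (use Suc.prems in simp_all)
  with \<pi>(1,2) show ?case
    by (subst free_resolution.simps(2)) (auto simp del: free_resolution.simps)
qed

text \<open>The ideal as a submodule of the free module of rank one, on coordinate 0.\<close>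

definition ideal_vecs :: "('x::finite, 'k::field) mpoly set \<Rightarrow> ('x, 'k) vec set"
  where "ideal_vecs J = {v. v 0 \<in> J \<and> (\<forall>i>0. v i = 0)}"

lemma in_ideal_vecs_iff: "v \<in> ideal_vecs J \<longleftrightarrow> v \<in> free_vecs [e] \<and> v 0 \<in> J"
  by (auto simp: ideal_vecs_def free_vecs_def Suc_le_eq)

lemma ideal_vecs_image: "v \<in> ideal_vecs J \<longleftrightarrow> (\<exists>p\<in>J. v = (\<lambda>i. if i = 0 then p else 0))"
  by (auto simp: ideal_vecs_def intro!: bexI[of _ "v 0"])

text \<open>The map onto \<open>J + (u)\<close> from the first free module of \<open>J\<close> plus
  one basis vector for \<open>u\<close> has as kernel an extension of \<open>J : u\<close> by the
  first syzygies of \<open>J\<close>. The horseshoe lemma resolves this kernel, so no comparison map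
  between complexes has to be constructed.\<close>

lemma mapping_cone:
  fixes J A :: "('x::finite, 'k::field) mpoly set"
  assumes J: "free_resolution b (Suc n) dJ (ideal_vecs J)" "dJ 0 = [0]"
    and A: "free_resolution False n dA (ideal_vecs A)" "dA 0 = [du]"
    and u: "homogeneous du u" and colon: "\<And>g. g * u \<in> J \<longleftrightarrow> g \<in> A"
  shows "free_resolution b (Suc n) (case_nat [0] (\<lambda>i. dJ (Suc i) @ dA i)) (ideal_vecs {p + r * u |p r. p \<in> J})"
proof -
  define \<alpha> where "\<alpha> = dJ (Suc 0)"
  obtain \<pi>J where \<pi>J: "graded_linear \<alpha> [0] \<pi>J" "\<pi>J ` free_vecs \<alpha> = ideal_vecs J"
    "free_resolution (b \<and> n \<noteq> 0) n (\<lambda>i. dJ (Suc i)) (graded_kernel \<alpha> \<pi>J)"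
    "b \<and> n = 0 \<longrightarrow> (\<exists>j<length \<alpha>. minimal_vec (\<pi>J (unit_vec j)))"
    using J by (auto simp: \<alpha>_def)
  define y :: "nat \<Rightarrow> ('x, 'k) vec" where "y = (\<lambda>_ i. if i = 0 then u else 0)"
  \<comment> \<open>Multiplication by \<open>u\<close>, of degree 0 once its basis vector is placed
    in degree \<open>du\<close>.\<close>
  define G where "G = lincomb (length [du]) y"
  have G: "graded_linear [du] [0] G"
    unfolding G_def by (rule graded_linear_lincomb) (use u in \<open>auto simp: vhom_def y_def split: if_splits\<close>)
  have G_eq: "G w = (\<lambda>i. if i = 0 then w 0 * u else 0)" for w
    by (auto simp: G_def lincomb_def y_def)
  define \<pi> where "\<pi> = vec_copair (length \<alpha>) \<pi>J G"
  have \<pi>: "graded_linear (\<alpha> @ [du]) [0] \<pi>"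
    unfolding \<pi>_def by (rule graded_linear_copair[OF \<pi>J(1) G])
  have \<pi>_join: "\<pi> (vec_join (length \<alpha>) v w) = (\<lambda>i. \<pi>J v i + G w i)" if "v \<in> free_vecs \<alpha>" for v w
    using that by (simp add: \<pi>_def vec_copair_def vec_take_join vec_drop_join)
  have G0: "G (\<lambda>_. 0) = (\<lambda>_. 0)" by (auto simp: G_eq)
  have \<pi>Jv: "\<pi>J v 0 \<in> J \<and> (\<forall>i>0. \<pi>J v i = 0)" if "v \<in> free_vecs \<alpha>" for v
  proof -
    have "\<pi>J v \<in> ideal_vecs J" using that \<pi>J(2) by blast
    then show ?thesis by (simp add: ideal_vecs_def)
  qed
  have \<pi>J_ex: "\<exists>v\<in>free_vecs \<alpha>. \<pi>J v = (\<lambda>i. if i = 0 then p else 0)" if "p \<in> J" for p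
  proof -
    have "(\<lambda>i. if i = 0 then p else 0) \<in> ideal_vecs J" using that by (simp add: ideal_vecs_def)
    then show ?thesis using \<pi>J(2) by (metis (no_types, lifting) imageE)
  qed
  have im: "\<pi> ` free_vecs (\<alpha> @ [du]) = ideal_vecs {p + r * u |p r. p \<in> J}"
  proof (intro equalityI subsetI)
    fix x assume "x \<in> \<pi> ` free_vecs (\<alpha> @ [du])"
    then obtain z where z: "z \<in> free_vecs (\<alpha> @ [du])" "x = \<pi> z" by blast
    show "x \<in> ideal_vecs {p + r * u |p r. p \<in> J}"
      using \<pi>Jv[OF vec_take_in[of \<alpha> z]]
      by (auto simp: z(2) \<pi>_def vec_copair_def ideal_vecs_def G_eq)
  next
    fix x assume "x \<in> ideal_vecs {p + r * u |p r. p \<in> J}"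
    then obtain p r where pr: "p \<in> J" "x = (\<lambda>i. if i = 0 then p + r * u else 0)"
      unfolding ideal_vecs_image by blast
    obtain v where v: "v \<in> free_vecs \<alpha>" "\<pi>J v = (\<lambda>i. if i = 0 then p else 0)"
      using \<pi>J_ex[OF pr(1)] by blast
    define w where "w = (\<lambda>i. if i = (0::nat) then r else 0)"
    have "w \<in> free_vecs [du]" by (simp add: w_def free_vecs_def)
    then have "vec_join (length \<alpha>) v w \<in> free_vecs (\<alpha> @ [du])" by (rule vec_join_in[OF v(1)])
    moreover have "\<pi> (vec_join (length \<alpha>) v w) = x"
      by (auto simp: \<pi>_join[OF v(1)] v(2) G_eq w_def pr(2))
    ultimately show "x \<in> \<pi> ` free_vecs (\<alpha> @ [du])" by blast
  qed
  \<comment> \<open>With \<open>kerC\<close> this is the exact sequence that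
    \<open>horseshoe\<close> needs: the first syzygies of \<open>J\<close>, the kernel of
    \<open>\<pi>\<close>, and the colon ideal \<open>A\<close>.\<close>
  have kerA: "graded_kernel \<alpha> \<pi>J =
      {v \<in> free_vecs \<alpha>. vec_join (length \<alpha>) v (\<lambda>_. 0) \<in> graded_kernel (\<alpha> @ [du]) \<pi>}"
    by (auto simp: graded_kernel_def \<pi>_join G0 vec_join_in)
  have kerC: "ideal_vecs A =
      {w \<in> free_vecs [du]. \<exists>v\<in>free_vecs \<alpha>. vec_join (length \<alpha>) v w \<in> graded_kernel (\<alpha> @ [du]) \<pi>}"
  proof (intro equalityI subsetI)
    fix w assume "w \<in> ideal_vecs A"
    then have w: "w \<in> free_vecs [du]" "w 0 * u \<in> J"
      using in_ideal_vecs_iff[of w A du] by (auto simp: colon)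
    obtain v where v: "v \<in> free_vecs \<alpha>" "\<pi>J v = (\<lambda>i. if i = 0 then w 0 * u else 0)"
      using \<pi>J_ex[OF w(2)] by blast
    have v': "(\<lambda>i. - v i) \<in> free_vecs \<alpha>" using free_vecs_scale[OF v(1), of "-1"] by simp
    have "\<pi>J (\<lambda>i. - v i) = (\<lambda>i. - \<pi>J v i)"
      using graded_linearD(3)[OF \<pi>J(1) v(1), of "-1"] by simp
    then have "\<pi> (vec_join (length \<alpha>) (\<lambda>i. - v i) w) = (\<lambda>_. 0)"
      by (auto simp: \<pi>_join[OF v'] v(2) G_eq)
    then show "w \<in> {w \<in> free_vecs [du]. \<exists>v\<in>free_vecs \<alpha>. vec_join (length \<alpha>) v w \<in> graded_kernel (\<alpha> @ [du]) \<pi>}"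
      using v' w(1) vec_join_in[OF v' w(1)] by (auto simp: graded_kernel_def)
  next
    fix w assume "w \<in> {w \<in> free_vecs [du]. \<exists>v\<in>free_vecs \<alpha>. vec_join (length \<alpha>) v w \<in> graded_kernel (\<alpha> @ [du]) \<pi>}"
    then obtain v where v: "w \<in> free_vecs [du]" "v \<in> free_vecs \<alpha>"
      "\<pi> (vec_join (length \<alpha>) v w) = (\<lambda>_. 0)" by (auto simp: graded_kernel_def)
    have "\<pi>J v 0 + w 0 * u = 0"
      using fun_cong[OF v(3), of 0] by (simp add: \<pi>_join[OF v(2)] G_eq)
    then have "w 0 * u = -1 * \<pi>J v 0" by (simp add: add_eq_0_iff)
    also have "\<dots> = \<pi>J (\<lambda>i. -1 * v i) 0" by (simp only: graded_linearD(3)[OF \<pi>J(1) v(2)])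
    also have "\<dots> \<in> J" using \<pi>Jv[OF free_vecs_scale[OF v(2)]] by blast
    finally show "w \<in> ideal_vecs A"
      using in_ideal_vecs_iff[of w A du] v(1) by (simp add: colon)
  qed
  have "free_resolution (b \<and> n \<noteq> 0) n (\<lambda>i. dJ (Suc i) @ dA i) (graded_kernel (\<alpha> @ [du]) \<pi>)"
    using graded_submodule_kernel[OF \<pi>] kerA kerC
    by (intro horseshoe[OF \<pi>J(3) A(1)]) (simp_all add: A(2) \<alpha>_def)
  moreover have "\<exists>j<length (\<alpha> @ [du]). minimal_vec (\<pi> (unit_vec j))" if bn: "b \<and> n = 0"
  proof -
    from \<pi>J(4) bn obtain j where j: "j < length \<alpha>" "minimal_vec (\<pi>J (unit_vec j))" by blast
    have "(unit_vec j :: nat \<Rightarrow> ('x, 'k) mpoly) = vec_join (length \<alpha>) (unit_vec j) (\<lambda>_. 0)"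
      using j(1) by (auto simp: vec_join_def unit_vec_def)
    then have "\<pi> (unit_vec j) = \<pi>J (unit_vec j)"
      using \<pi>_join[OF unit_vec_in_free_vecs[OF j(1)], of "\<lambda>_. 0"] by (simp add: G0)
    then show ?thesis using j by (intro exI[of _ j]) simp
  qed
  ultimately show ?thesis
    using \<pi> im by (auto simp: A(2) \<alpha>_def intro!: exI[of _ \<pi>])
qed


section \<open>Comparison of resolutions\<close>

lemma module_hom_closed: "h \<in> module_hom_set R M N \<Longrightarrow> x \<in> carrier M \<Longrightarrow> h x \<in> carrier N"
  by (auto simp: module_hom_set_def)

lemma module_hom_add:
  "h \<in> module_hom_set R M N \<Longrightarrow> x \<in> carrier M \<Longrightarrow> y \<in> carrier M \<Longrightarrow> h (x \<oplus>\<^bsub>M\<^esub> y) = h x \<oplus>\<^bsub>N\<^esub> h y"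
  by (auto simp: module_hom_set_def)

lemma module_hom_smult:
  "h \<in> module_hom_set R M N \<Longrightarrow> r \<in> carrier R \<Longrightarrow> x \<in> carrier M \<Longrightarrow> h (r \<odot>\<^bsub>M\<^esub> x) = r \<odot>\<^bsub>N\<^esub> h x"
  by (auto simp: module_hom_set_def)

lemma module_hom_compose:
  "h \<in> module_hom_set R M N \<Longrightarrow> g \<in> module_hom_set R N K \<Longrightarrow> (\<lambda>x. g (h x)) \<in> module_hom_set R M K"
  unfolding module_hom_set_def by (auto simp: Pi_def)

lemma module_hom_zero:
  assumes "Module.module R M" "Module.module R N" "h \<in> module_hom_set R M N"
  shows "h \<zero>\<^bsub>M\<^esub> = \<zero>\<^bsub>N\<^esub>"
proof -
  interpret M: Module.module R M by fact
  interpret N: Module.module R N by fact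
  have "h \<zero>\<^bsub>M\<^esub> \<in> carrier N" by (rule module_hom_closed[OF assms(3)]) simp
  moreover have "h \<zero>\<^bsub>M\<^esub> \<oplus>\<^bsub>N\<^esub> h \<zero>\<^bsub>M\<^esub> = h \<zero>\<^bsub>M\<^esub>"
    using module_hom_add[OF assms(3), of "\<zero>\<^bsub>M\<^esub>" "\<zero>\<^bsub>M\<^esub>"] by simp
  ultimately show ?thesis by (metis N.add.l_cancel_one')
qed

lemma module_hom_minus:
  assumes "Module.module R M" "Module.module R N" "h \<in> module_hom_set R M N" "x \<in> carrier M" "y \<in> carrier M"
  shows "h (x \<ominus>\<^bsub>M\<^esub> y) = h x \<ominus>\<^bsub>N\<^esub> h y"
proof -
  interpret M: Module.module R M by fact
  interpret N: Module.module R N by fact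
  have c: "h x \<in> carrier N" "h y \<in> carrier N" "h (\<ominus>\<^bsub>M\<^esub> y) \<in> carrier N"
    using assms by (simp_all add: module_hom_closed[OF assms(3)])
  have "h (\<ominus>\<^bsub>M\<^esub> y) \<oplus>\<^bsub>N\<^esub> h y = \<zero>\<^bsub>N\<^esub>"
    using module_hom_add[OF assms(3), of "\<ominus>\<^bsub>M\<^esub> y" y] assms(5)
    by (simp add: M.l_neg module_hom_zero[OF assms(1-3)])
  then have "h (\<ominus>\<^bsub>M\<^esub> y) = \<ominus>\<^bsub>N\<^esub> h y"
    using c by (metis N.minus_equality)
  then show ?thesis
    using module_hom_add[OF assms(3), of x "\<ominus>\<^bsub>M\<^esub> y"] assms(4,5) by (simp add: a_minus_def)
qed

lemma module_hom_diff:
  assumes "Module.module R M" "Module.module R N" "h \<in> module_hom_set R M N" "g \<in> module_hom_set R M N"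
  shows "(\<lambda>x. h x \<ominus>\<^bsub>N\<^esub> g x) \<in> module_hom_set R M N"
proof -
  interpret M: Module.module R M by fact
  interpret N: Module.module R N by fact
  have c: "h x \<in> carrier N" "g x \<in> carrier N" if "x \<in> carrier M" for x
    using that module_hom_closed assms(3,4) by metis+
  show ?thesis
    unfolding module_hom_set_def
  proof (intro CollectI conjI ballI)
    show "(\<lambda>x. h x \<ominus>\<^bsub>N\<^esub> g x) \<in> carrier M \<rightarrow> carrier N" using c by auto
    fix x y assume xy: "x \<in> carrier M" "y \<in> carrier M"
    show "h (x \<oplus>\<^bsub>M\<^esub> y) \<ominus>\<^bsub>N\<^esub> g (x \<oplus>\<^bsub>M\<^esub> y) = (h x \<ominus>\<^bsub>N\<^esub> g x) \<oplus>\<^bsub>N\<^esub> (h y \<ominus>\<^bsub>N\<^esub> g y)"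
      using c[OF xy(1)] c[OF xy(2)]
      by (simp add: module_hom_add[OF assms(3) xy] module_hom_add[OF assms(4) xy] a_minus_def
          N.minus_add N.a_ac)
  next
    fix r x assume rx: "r \<in> carrier R" "x \<in> carrier M"
    show "h (r \<odot>\<^bsub>M\<^esub> x) \<ominus>\<^bsub>N\<^esub> g (r \<odot>\<^bsub>M\<^esub> x) = r \<odot>\<^bsub>N\<^esub> (h x \<ominus>\<^bsub>N\<^esub> g x)"
      using c[OF rx(2)] rx(1)
      by (simp add: module_hom_smult[OF assms(3) rx] module_hom_smult[OF assms(4) rx] a_minus_def
          N.smult_r_distr N.smult_r_minus)
  qed
qed

lemma module_hom_id: "(\<lambda>x. x) \<in> module_hom_set R M M"
  by (simp add: module_hom_set_def)

text \<open>The basis may be infinite, since the resolutions to be compared with are arbitrary. The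
  lift is defined by finitely supported sums, and its property is checked by induction on a finite
  set containing the support.\<close>

lemma free_module_lift:
  fixes R (structure) and B :: "'c set"
  assumes "cring R" "Module.module R U" "Module.module R Y"
    and h: "h \<in> module_hom_set R (free_module R B) Y" and d: "d \<in> module_hom_set R U Y"
    and im: "h ` carrier (free_module R B) \<subseteq> d ` carrier U"
  obtains g where "g \<in> module_hom_set R (free_module R B) U"
    "\<And>v. v \<in> carrier (free_module R B) \<Longrightarrow> d (g v) = h v"
proof -
  interpret R: cring R by fact
  interpret U: Module.module R U by fact
  interpret Y: Module.module R Y by fact
  interpret F: Module.module R "free_module R B" by (rule module_free_module) fact
  define e :: "'c \<Rightarrow> 'c \<Rightarrow> 'a" where "e b = (\<lambda>b'. if b' = b then \<one>\<^bsub>R\<^esub> else \<zero>\<^bsub>R\<^esub>)" for b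
  have e: "e b \<in> carrier (free_module R B)" if "b \<in> B" for b
    using that by (auto simp: free_module_def e_def)
  have "\<exists>x\<in>carrier U. d x = h (e b)" if "b \<in> B" for b
    using im e[OF that] by (metis (no_types, lifting) image_iff subset_iff)
  then obtain x where x: "\<And>b. b \<in> B \<Longrightarrow> x b \<in> carrier U" "\<And>b. b \<in> B \<Longrightarrow> d (x b) = h (e b)"
    by metis
  define g where "g v = finsum U (\<lambda>b. v b \<odot>\<^bsub>U\<^esub> x b) {b. v b \<noteq> \<zero>\<^bsub>R\<^esub>}" for v
  have vc: "v b \<in> carrier R" if "v \<in> carrier (free_module R B)" for v b
    using that by (simp add: free_module_def)
  have supp: "finite {b. v b \<noteq> \<zero>\<^bsub>R\<^esub>}" "{b. v b \<noteq> \<zero>\<^bsub>R\<^esub>} \<subseteq> B" if "v \<in> carrier (free_module R B)" for v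
    using that by (auto simp: free_module_def)
  have summand: "v b \<odot>\<^bsub>U\<^esub> x b \<in> carrier U" if "v \<in> carrier (free_module R B)" "b \<in> B" for v b
    using vc[OF that(1)] x(1)[OF that(2)] by simp
  have g_eq: "g v = finsum U (\<lambda>b. v b \<odot>\<^bsub>U\<^esub> x b) S"
    if v: "v \<in> carrier (free_module R B)" and S: "finite S" "S \<subseteq> B" "{b. v b \<noteq> \<zero>\<^bsub>R\<^esub>} \<subseteq> S" for v S
    unfolding g_def
    by (rule U.add.finprod_mono_neutral_cong_left) (use S x(1) summand[OF v] in \<open>auto simp: subset_iff\<close>)
  have add_eval: "(v \<oplus>\<^bsub>free_module R B\<^esub> w) b = v b \<oplus> w b" for v w b by (simp add: free_module_def)
  have smult_eval: "(r \<odot>\<^bsub>free_module R B\<^esub> v) b = r \<otimes> v b" for r v b by (simp add: free_module_def)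
  have g_hom: "g \<in> module_hom_set R (free_module R B) U"
    unfolding module_hom_set_def
  proof (intro CollectI conjI ballI)
    show "g \<in> carrier (free_module R B) \<rightarrow> carrier U"
    proof
      fix v assume v: "v \<in> carrier (free_module R B)"
      then have "(\<lambda>b. v b \<odot>\<^bsub>U\<^esub> x b) \<in> {b. v b \<noteq> \<zero>} \<rightarrow> carrier U"
        using supp(2)[OF v] by (intro Pi_I summand) auto
      then show "g v \<in> carrier U" unfolding g_def by (rule U.finsum_closed)
    qed
    fix v w assume vw: "v \<in> carrier (free_module R B)" "w \<in> carrier (free_module R B)"
    define S where "S = {b. v b \<noteq> \<zero>} \<union> {b. w b \<noteq> \<zero>}"
    have S: "finite S" "S \<subseteq> B" using supp vw by (auto simp: S_def)
    have "g (v \<oplus>\<^bsub>free_module R B\<^esub> w) = finsum U (\<lambda>b. (v b \<oplus> w b) \<odot>\<^bsub>U\<^esub> x b) S"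
      unfolding add_eval[symmetric] using vw S by (intro g_eq) (auto simp: S_def add_eval)
    also have "\<dots> = finsum U (\<lambda>b. v b \<odot>\<^bsub>U\<^esub> x b \<oplus>\<^bsub>U\<^esub> w b \<odot>\<^bsub>U\<^esub> x b) S"
      using vw S x(1) vc
      by (intro U.add.finprod_cong) (auto simp: simp_implies_def U.smult_l_distr subset_iff)
    also have "\<dots> = finsum U (\<lambda>b. v b \<odot>\<^bsub>U\<^esub> x b) S \<oplus>\<^bsub>U\<^esub> finsum U (\<lambda>b. w b \<odot>\<^bsub>U\<^esub> x b) S"
      using vw S summand by (intro U.finsum_addf) auto
    also have "\<dots> = g v \<oplus>\<^bsub>U\<^esub> g w"
      using g_eq[OF vw(1) S] g_eq[OF vw(2) S] by (simp add: S_def)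
    finally show "g (v \<oplus>\<^bsub>free_module R B\<^esub> w) = g v \<oplus>\<^bsub>U\<^esub> g w" .
  next
    fix r v assume rv: "r \<in> carrier R" "v \<in> carrier (free_module R B)"
    define S where "S = {b. v b \<noteq> \<zero>}"
    have S: "finite S" "S \<subseteq> B" using supp rv by (auto simp: S_def)
    have "g (r \<odot>\<^bsub>free_module R B\<^esub> v) = finsum U (\<lambda>b. (r \<otimes> v b) \<odot>\<^bsub>U\<^esub> x b) S"
      unfolding smult_eval[symmetric] using rv S by (intro g_eq) (auto simp: S_def smult_eval)
    also have "\<dots> = finsum U (\<lambda>b. r \<odot>\<^bsub>U\<^esub> (v b \<odot>\<^bsub>U\<^esub> x b)) S"
      using rv S x(1) vc
      by (intro U.add.finprod_cong) (auto simp: simp_implies_def U.smult_assoc1 subset_iff)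
    also have "\<dots> = r \<odot>\<^bsub>U\<^esub> finsum U (\<lambda>b. v b \<odot>\<^bsub>U\<^esub> x b) S"
      using rv S summand by (intro U.finsum_smult_ldistr[symmetric]) auto
    also have "\<dots> = r \<odot>\<^bsub>U\<^esub> g v" using g_eq[OF rv(2) S] by (simp add: S_def)
    finally show "g (r \<odot>\<^bsub>free_module R B\<^esub> v) = r \<odot>\<^bsub>U\<^esub> g v" .
  qed
  note dg = module_hom_compose[OF g_hom d]
  have "d (g v) = h v" if "finite S" "S \<subseteq> B" "v \<in> carrier (free_module R B)" "{b. v b \<noteq> \<zero>} \<subseteq> S" for S v
    using that
  proof (induction S arbitrary: v rule: finite_induct)
    case empty
    then have "v = \<zero>\<^bsub>free_module R B\<^esub>" by (auto simp: free_module_def)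
    then show ?case
      using module_hom_zero[OF F.module_axioms Y.module_axioms dg]
        module_hom_zero[OF F.module_axioms Y.module_axioms h] by simp
  next
    case (insert s S)
    define w where "w = v(s := \<zero>)"
    have w: "w \<in> carrier (free_module R B)"
    proof -
      have "{b. w b \<noteq> \<zero>} \<subseteq> {b. v b \<noteq> \<zero>}" by (auto simp: w_def)
      with insert.prems(2) show ?thesis
        by (auto simp: free_module_def w_def intro: finite_subset)
    qed
    have s: "s \<in> B" using insert.prems by auto
    have vs: "v s \<in> carrier R" using vc insert.prems by blast
    have v: "v = w \<oplus>\<^bsub>free_module R B\<^esub> (v s \<odot>\<^bsub>free_module R B\<^esub> e s)"
      using vc[OF insert.prems(2)] by (auto simp: free_module_def w_def e_def)
    have w_eq: "d (g w) = h w"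
      by (rule insert.IH[OF _ w]) (use insert.prems in \<open>auto simp: w_def\<close>)
    have "g (e s) = x s"
    proof -
      have "{b. e s b \<noteq> \<zero>} \<subseteq> {s}" by (auto simp: e_def)
      then have "g (e s) = finsum U (\<lambda>b. e s b \<odot>\<^bsub>U\<^esub> x b) {s}"
        using s by (intro g_eq e) auto
      also have "\<dots> = x s" using x(1)[OF s] by (simp add: e_def)
      finally show ?thesis .
    qed
    then have es: "d (g (e s)) = h (e s)" using x(2)[OF s] by simp
    have se: "v s \<odot>\<^bsub>free_module R B\<^esub> e s \<in> carrier (free_module R B)"
      using vs e[OF s] by simp
    have "d (g v) = d (g w) \<oplus>\<^bsub>Y\<^esub> (v s \<odot>\<^bsub>Y\<^esub> d (g (e s)))"
      by (subst v) (simp only: module_hom_add[OF dg w se] module_hom_smult[OF dg vs e[OF s]])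
    also have "\<dots> = h w \<oplus>\<^bsub>Y\<^esub> (v s \<odot>\<^bsub>Y\<^esub> h (e s))" by (simp only: w_eq es)
    also have "\<dots> = h v"
      by (simp only: arg_cong[OF v, of h] module_hom_add[OF h w se] module_hom_smult[OF h vs e[OF s]])
    finally show ?case .
  qed
  from this[OF supp] have "d (g v) = h v" if "v \<in> carrier (free_module R B)" for v
    using that by blast
  with g_hom show ?thesis by (rule that)
qed

text \<open>The map is lifted from the free module of which \<open>P\<close> is a summand, then
  restricted along the inclusion of the summand.\<close>

lemma projective_lift:
  fixes P :: "('a, 'p, 'c) module_scheme"
  assumes R: "cring R" and P: "projective_module R P" and U: "Module.module R U" and Y: "Module.module R Y"
    and h: "h \<in> module_hom_set R P Y" and d: "d \<in> module_hom_set R U Y"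
    and im: "\<And>x. x \<in> carrier P \<Longrightarrow> h x \<in> d ` carrier U"
  obtains g where "g \<in> module_hom_set R P U" "\<And>x. x \<in> carrier P \<Longrightarrow> d (g x) = h x"
proof -
  from P obtain B :: "'p set" and \<iota> \<pi> where i: "\<iota> \<in> module_hom_set R P (free_module R B)"
    and p: "\<pi> \<in> module_hom_set R (free_module R B) P" and pi: "\<forall>x\<in>carrier P. \<pi> (\<iota> x) = x"
    unfolding projective_module_def by blast
  have "(\<lambda>v. h (\<pi> v)) ` carrier (free_module R B) \<subseteq> d ` carrier U"
    using im module_hom_closed[OF p] by blast
  from free_module_lift[OF R U Y module_hom_compose[OF p h] d this] obtain g
    where g: "g \<in> module_hom_set R (free_module R B) U"
      "\<And>v. v \<in> carrier (free_module R B) \<Longrightarrow> d (g v) = h (\<pi> v)" by blast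
  show ?thesis
    using module_hom_closed[OF i] pi
    by (intro that[OF module_hom_compose[OF i g(1)]]) (simp add: g(2))
qed

lemma projective_resolutionD:
  assumes "projective_resolution R M n P d \<epsilon>"
  shows "projective_module R (P i)" and "Module.module R (P i)"
    and "n < i \<Longrightarrow> carrier (P i) = {\<zero>\<^bsub>P i\<^esub>}"
    and "\<epsilon> \<in> module_hom_set R (P 0) M" and "d i \<in> module_hom_set R (P (Suc i)) (P i)"
    and "\<epsilon> ` carrier (P 0) = carrier M"
    and "x \<in> carrier (P 0) \<Longrightarrow> x \<in> d 0 ` carrier (P (Suc 0)) \<longleftrightarrow> \<epsilon> x = \<zero>\<^bsub>M\<^esub>"
    and "x \<in> carrier (P (Suc i)) \<Longrightarrow> x \<in> d (Suc i) ` carrier (P (Suc (Suc i))) \<longleftrightarrow> d i x = \<zero>\<^bsub>P i\<^esub>"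
  using assms unfolding projective_resolution_def projective_module_def a_kernel_def' One_nat_def
  by auto

lemma projective_resolution_d_d:
  assumes "projective_resolution R M n P d \<epsilon>" "x \<in> carrier (P (Suc (Suc i)))"
  shows "d i (d (Suc i) x) = \<zero>\<^bsub>P i\<^esub>"
  using projective_resolutionD(8)[OF assms(1), of "d (Suc i) x" i]
    module_hom_closed[OF projective_resolutionD(5)[OF assms(1)] assms(2)] assms(2) by blast

lemma projective_resolution_eps_d:
  assumes "projective_resolution R M n P d \<epsilon>" "x \<in> carrier (P (Suc 0))"
  shows "\<epsilon> (d 0 x) = \<zero>\<^bsub>M\<^esub>"
  using projective_resolutionD(7)[OF assms(1), of "d 0 x"]
    module_hom_closed[OF projective_resolutionD(5)[OF assms(1)] assms(2)] assms(2) by blast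

lemma comparison_map:
  assumes R: "cring R" and M: "Module.module R M"
    and U: "projective_resolution R M n U dU \<epsilon>U" and Y: "projective_resolution R M m Y dY \<epsilon>Y"
  obtains \<alpha> where "\<And>i. \<alpha> i \<in> module_hom_set R (U i) (Y i)"
    "\<And>x. x \<in> carrier (U 0) \<Longrightarrow> \<epsilon>Y (\<alpha> 0 x) = \<epsilon>U x"
    "\<And>i x. x \<in> carrier (U (Suc i)) \<Longrightarrow> dY i (\<alpha> (Suc i) x) = \<alpha> i (dU i x)"
proof -
  note UD = projective_resolutionD[OF U] and YD = projective_resolutionD[OF Y]
  \<comment> \<open>Besides the map, \<open>P\<close> records that its composite with the next
    differential can be lifted again; this is what dependent choice has to carry along.\<close>
  define P where "P n a \<longleftrightarrow> a \<in> module_hom_set R (U n) (Y n) \<and>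
    (n = 0 \<longrightarrow> (\<forall>x\<in>carrier (U 0). \<epsilon>Y (a x) = \<epsilon>U x)) \<and>
    (\<forall>x\<in>carrier (U (Suc n)). a (dU n x) \<in> dY n ` carrier (Y (Suc n)))" for n a
  define Q where "Q n a b \<longleftrightarrow> (\<forall>x\<in>carrier (U (Suc n)). dY n (b x) = a (dU n x))" for n a b
  have "\<exists>\<alpha>. \<forall>n. P n (\<alpha> n) \<and> Q n (\<alpha> n) (\<alpha> (Suc n))"
  proof (rule dependent_nat_choice)
    have "\<And>x. x \<in> carrier (U 0) \<Longrightarrow> \<epsilon>U x \<in> \<epsilon>Y ` carrier (Y 0)"
      using UD(6) YD(6) by blast
    from projective_lift[OF R UD(1) YD(2) M UD(4) YD(4) this] obtain a
      where a: "a \<in> module_hom_set R (U 0) (Y 0)" "\<And>x. x \<in> carrier (U 0) \<Longrightarrow> \<epsilon>Y (a x) = \<epsilon>U x" by blast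
    have "a (dU 0 x) \<in> dY 0 ` carrier (Y (Suc 0))" if x: "x \<in> carrier (U (Suc 0))" for x
    proof -
      have dx: "dU 0 x \<in> carrier (U 0)" by (rule module_hom_closed[OF UD(5) x])
      show ?thesis
        using YD(7)[OF module_hom_closed[OF a(1) dx]] a(2)[OF dx] projective_resolution_eps_d[OF U x]
        by simp
    qed
    with a show "\<exists>a. P 0 a" by (auto simp: P_def)
  next
    fix a n assume P: "P n a"
    then have a: "a \<in> module_hom_set R (U n) (Y n)"
      and im: "\<And>x. x \<in> carrier (U (Suc n)) \<Longrightarrow> a (dU n x) \<in> dY n ` carrier (Y (Suc n))"
      by (auto simp: P_def)
    from projective_lift[OF R UD(1) YD(2) YD(2) module_hom_compose[OF UD(5) a] YD(5) im] obtain b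
      where b: "b \<in> module_hom_set R (U (Suc n)) (Y (Suc n))"
        "\<And>x. x \<in> carrier (U (Suc n)) \<Longrightarrow> dY n (b x) = a (dU n x)" by blast
    have "b (dU (Suc n) x) \<in> dY (Suc n) ` carrier (Y (Suc (Suc n)))"
      if x: "x \<in> carrier (U (Suc (Suc n)))" for x
    proof -
      have dx: "dU (Suc n) x \<in> carrier (U (Suc n))" by (rule module_hom_closed[OF UD(5) x])
      show ?thesis
        using YD(8)[OF module_hom_closed[OF b(1) dx]] b(2)[OF dx] projective_resolution_d_d[OF U x]
          module_hom_zero[OF UD(2) YD(2) a]
        by simp
    qed
    with b have "P (Suc n) b" "Q n a b" by (auto simp: P_def Q_def)
    then show "\<exists>b. P (Suc n) b \<and> Q n a b" by blast
  qed
  then obtain \<alpha> where "\<And>n. P n (\<alpha> n)" "\<And>n. Q n (\<alpha> n) (\<alpha> (Suc n))" by blast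
  then show ?thesis by (intro that[of \<alpha>]) (auto simp: P_def Q_def)
qed

text \<open>
  Comparison maps \<open>G \<rightarrow> P \<rightarrow> G\<close> compose to \<open>\<gamma>\<close>, which is homotopic to the identity, via \<open>s\<close>;
  where \<open>P\<close> vanishes so does \<open>\<gamma>\<close>.
\<close>

lemma resolution_retraction:
  assumes R: "cring R" and M: "Module.module R M"
    and P: "projective_resolution R M p P dP \<epsilon>P" and G: "projective_resolution R M (Suc r) G dG \<epsilon>G"
    and p: "p < Suc r"
  obtains s where "s \<in> module_hom_set R (G r) (G (Suc r))"
    "\<And>x. x \<in> carrier (G (Suc r)) \<Longrightarrow> s (dG r x) = x"
proof -
  note GD = projective_resolutionD[OF G]
  obtain \<alpha> where \<alpha>: "\<And>i. \<alpha> i \<in> module_hom_set R (G i) (P i)"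
    "\<And>x. x \<in> carrier (G 0) \<Longrightarrow> \<epsilon>P (\<alpha> 0 x) = \<epsilon>G x"
    "\<And>i x. x \<in> carrier (G (Suc i)) \<Longrightarrow> dP i (\<alpha> (Suc i) x) = \<alpha> i (dG i x)"
    using comparison_map[OF R M G P] by blast
  obtain \<beta> where \<beta>: "\<And>i. \<beta> i \<in> module_hom_set R (P i) (G i)"
    "\<And>x. x \<in> carrier (P 0) \<Longrightarrow> \<epsilon>G (\<beta> 0 x) = \<epsilon>P x"
    "\<And>i x. x \<in> carrier (P (Suc i)) \<Longrightarrow> dG i (\<beta> (Suc i) x) = \<beta> i (dP i x)"
    using comparison_map[OF R M P G] by blast
  define \<gamma> where "\<gamma> i x = \<beta> i (\<alpha> i x)" for i x
  have \<gamma>: "\<gamma> i \<in> module_hom_set R (G i) (G i)" for i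
    unfolding \<gamma>_def by (rule module_hom_compose[OF \<alpha>(1) \<beta>(1)])
  have \<gamma>_eps: "\<epsilon>G (\<gamma> 0 x) = \<epsilon>G x" if "x \<in> carrier (G 0)" for x
    using that \<alpha>(2) \<beta>(2) module_hom_closed[OF \<alpha>(1)] by (simp add: \<gamma>_def)
  have \<gamma>_d: "dG i (\<gamma> (Suc i) x) = \<gamma> i (dG i x)" if "x \<in> carrier (G (Suc i))" for i x
    using that \<alpha>(3) \<beta>(3) module_hom_closed[OF \<alpha>(1)] by (simp add: \<gamma>_def)
  have id\<gamma>: "(\<lambda>x. x \<ominus>\<^bsub>G i\<^esub> \<gamma> i x) \<in> module_hom_set R (G i) (G i)" for i
    by (rule module_hom_diff[OF GD(2) GD(2) module_hom_id \<gamma>])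
  \<comment> \<open>This is the homotopy equation composed with the differential. The preceding
    homotopy map drops out of it, so the state consists of one map; \<open>Q\<close> is the full
    equation.\<close>
  define A where "A n s \<longleftrightarrow> s \<in> module_hom_set R (G n) (G (Suc n)) \<and>
    (\<forall>x\<in>carrier (G (Suc n)). dG n (s (dG n x)) = dG n x \<ominus>\<^bsub>G n\<^esub> \<gamma> n (dG n x))" for n s
  define Q where "Q n s t \<longleftrightarrow> (\<forall>x\<in>carrier (G (Suc n)).
    dG (Suc n) (t x) = (x \<ominus>\<^bsub>G (Suc n)\<^esub> \<gamma> (Suc n) x) \<ominus>\<^bsub>G (Suc n)\<^esub> s (dG n x))" for n s t
  have "\<exists>s. \<forall>n. A n (s n) \<and> Q n (s n) (s (Suc n))"
  proof (rule dependent_nat_choice)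
    have "x \<ominus>\<^bsub>G 0\<^esub> \<gamma> 0 x \<in> dG 0 ` carrier (G (Suc 0))" if x: "x \<in> carrier (G 0)" for x
    proof -
      interpret M: Module.module R M by fact
      have gx: "\<gamma> 0 x \<in> carrier (G 0)" by (rule module_hom_closed[OF \<gamma> x])
      have "\<epsilon>G (x \<ominus>\<^bsub>G 0\<^esub> \<gamma> 0 x) = \<epsilon>G x \<ominus>\<^bsub>M\<^esub> \<epsilon>G x"
        by (simp add: module_hom_minus[OF GD(2) M GD(4) x gx] \<gamma>_eps[OF x])
      also have "\<dots> = \<zero>\<^bsub>M\<^esub>" using module_hom_closed[OF GD(4) x] by (simp add: a_minus_def M.r_neg)
      finally show ?thesis using GD(7)[OF module_hom_closed[OF id\<gamma> x]] by simp
    qed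
    from projective_lift[OF R GD(1) GD(2) GD(2) id\<gamma> GD(5) this] obtain s
      where "s \<in> module_hom_set R (G 0) (G (Suc 0))"
        "\<And>x. x \<in> carrier (G 0) \<Longrightarrow> dG 0 (s x) = x \<ominus>\<^bsub>G 0\<^esub> \<gamma> 0 x" by blast
    then show "\<exists>s. A 0 s" using module_hom_closed[OF GD(5)] by (auto simp: A_def)
  next
    fix s n assume "A n s"
    then have s: "s \<in> module_hom_set R (G n) (G (Suc n))"
      and sd: "\<And>x. x \<in> carrier (G (Suc n)) \<Longrightarrow> dG n (s (dG n x)) = dG n x \<ominus>\<^bsub>G n\<^esub> \<gamma> n (dG n x)"
      by (auto simp: A_def)
    note hom = module_hom_diff[OF GD(2) GD(2) id\<gamma>[of "Suc n"] module_hom_compose[OF GD(5) s]]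
    have "(x \<ominus>\<^bsub>G (Suc n)\<^esub> \<gamma> (Suc n) x) \<ominus>\<^bsub>G (Suc n)\<^esub> s (dG n x) \<in> dG (Suc n) ` carrier (G (Suc (Suc n)))"
      if x: "x \<in> carrier (G (Suc n))" for x
    proof -
      interpret Gn: Module.module R "G n" by (rule GD(2))
      have dx: "dG n x \<in> carrier (G n)" by (rule module_hom_closed[OF GD(5) x])
      have gx: "\<gamma> (Suc n) x \<in> carrier (G (Suc n))" by (rule module_hom_closed[OF \<gamma> x])
      have ix: "x \<ominus>\<^bsub>G (Suc n)\<^esub> \<gamma> (Suc n) x \<in> carrier (G (Suc n))" by (rule module_hom_closed[OF id\<gamma> x])
      have sx: "s (dG n x) \<in> carrier (G (Suc n))" by (rule module_hom_closed[OF s dx])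
      have c: "dG n x \<ominus>\<^bsub>G n\<^esub> \<gamma> n (dG n x) \<in> carrier (G n)" by (rule module_hom_closed[OF id\<gamma> dx])
      have "dG n ((x \<ominus>\<^bsub>G (Suc n)\<^esub> \<gamma> (Suc n) x) \<ominus>\<^bsub>G (Suc n)\<^esub> s (dG n x)) = \<zero>\<^bsub>G n\<^esub>"
        unfolding module_hom_minus[OF GD(2) GD(2) GD(5) ix sx] sd[OF x]
          module_hom_minus[OF GD(2) GD(2) GD(5) x gx] \<gamma>_d[OF x]
        using c by (simp add: a_minus_def[of _ "a_minus _ _ _" "a_minus _ _ _"] Gn.r_neg)
      then show ?thesis using GD(8)[OF module_hom_closed[OF hom x]] by simp
    qed
    from projective_lift[OF R GD(1) GD(2) GD(2) hom GD(5) this] obtain t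
      where t: "t \<in> module_hom_set R (G (Suc n)) (G (Suc (Suc n)))"
        "\<And>x. x \<in> carrier (G (Suc n)) \<Longrightarrow>
          dG (Suc n) (t x) = (x \<ominus>\<^bsub>G (Suc n)\<^esub> \<gamma> (Suc n) x) \<ominus>\<^bsub>G (Suc n)\<^esub> s (dG n x)" by blast
    have "dG (Suc n) (t (dG (Suc n) x)) = dG (Suc n) x \<ominus>\<^bsub>G (Suc n)\<^esub> \<gamma> (Suc n) (dG (Suc n) x)"
      if x: "x \<in> carrier (G (Suc (Suc n)))" for x
    proof -
      interpret Gn: Module.module R "G (Suc n)" by (rule GD(2))
      have dx: "dG (Suc n) x \<in> carrier (G (Suc n))" by (rule module_hom_closed[OF GD(5) x])
      have c: "dG (Suc n) x \<ominus>\<^bsub>G (Suc n)\<^esub> \<gamma> (Suc n) (dG (Suc n) x) \<in> carrier (G (Suc n))"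
        by (rule module_hom_closed[OF id\<gamma> dx])
      show ?thesis
        unfolding t(2)[OF dx] projective_resolution_d_d[OF G x] module_hom_zero[OF GD(2) GD(2) s]
        using c by (simp add: a_minus_def[of _ "a_minus _ _ _"])
    qed
    with t have "A (Suc n) t" "Q n s t" by (auto simp: A_def Q_def)
    then show "\<exists>t. A (Suc n) t \<and> Q n s t" by blast
  qed
  then obtain s where s: "\<And>n. A n (s n)" "\<And>n. Q n (s n) (s (Suc n))" by blast
  \<comment> \<open>At position \<open>Suc r\<close> the map \<open>\<gamma>\<close> vanishes since
    it factors through a zero module of \<open>P\<close>, and \<open>s (Suc r)\<close> vanishes
    since \<open>G\<close> has ended. What remains of the homotopy equation is the
    retraction.\<close>
  have "s r (dG r x) = x" if x: "x \<in> carrier (G (Suc r))" for x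
  proof -
    interpret Gn: Module.module R "G (Suc r)" by (rule GD(2))
    have "\<alpha> (Suc r) x = \<zero>\<^bsub>P (Suc r)\<^esub>"
      using projective_resolutionD(3)[OF P p] module_hom_closed[OF \<alpha>(1) x] by blast
    then have g0: "\<gamma> (Suc r) x = \<zero>\<^bsub>G (Suc r)\<^esub>"
      using module_hom_zero[OF projective_resolutionD(2)[OF P] GD(2) \<beta>(1)] by (simp add: \<gamma>_def)
    have "s (Suc r) x \<in> carrier (G (Suc (Suc r)))"
      using s(1)[of "Suc r"] x by (auto simp: A_def dest: module_hom_closed)
    then have "s (Suc r) x = \<zero>\<^bsub>G (Suc (Suc r))\<^esub>" using GD(3)[of "Suc (Suc r)"] by auto
    moreover have "dG (Suc r) (s (Suc r) x) =
        (x \<ominus>\<^bsub>G (Suc r)\<^esub> \<gamma> (Suc r) x) \<ominus>\<^bsub>G (Suc r)\<^esub> s r (dG r x)"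
      using s(2)[of r] x unfolding Q_def by blast
    ultimately have "\<zero>\<^bsub>G (Suc r)\<^esub> = (x \<ominus>\<^bsub>G (Suc r)\<^esub> \<zero>\<^bsub>G (Suc r)\<^esub>) \<ominus>\<^bsub>G (Suc r)\<^esub> s r (dG r x)"
      by (simp only: g0 module_hom_zero[OF GD(2) GD(2) GD(5)[of "Suc r"]])
    moreover have "s r (dG r x) \<in> carrier (G (Suc r))"
      using s(1)[of r] module_hom_closed[OF GD(5) x] by (auto simp: A_def dest: module_hom_closed)
    ultimately have y: "s r (dG r x) \<in> carrier (G (Suc r))" "x \<oplus>\<^bsub>G (Suc r)\<^esub> \<ominus>\<^bsub>G (Suc r)\<^esub> s r (dG r x) = \<zero>\<^bsub>G (Suc r)\<^esub>"
      using x Gn.add.inv_one by (simp_all add: a_minus_def a_inv_def)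
    have "x = x \<oplus>\<^bsub>G (Suc r)\<^esub> (\<ominus>\<^bsub>G (Suc r)\<^esub> s r (dG r x) \<oplus>\<^bsub>G (Suc r)\<^esub> s r (dG r x))"
      using x y(1) by (simp add: Gn.l_neg)
    also have "\<dots> = (x \<oplus>\<^bsub>G (Suc r)\<^esub> \<ominus>\<^bsub>G (Suc r)\<^esub> s r (dG r x)) \<oplus>\<^bsub>G (Suc r)\<^esub> s r (dG r x)"
      using x y(1) by (simp only: Gn.a_assoc Gn.a_inv_closed)
    also have "\<dots> = s r (dG r x)" using y by simp
    finally show ?thesis ..
  qed
  moreover have "s r \<in> module_hom_set R (G r) (G (Suc r))" using s(1)[of r] by (simp add: A_def)
  ultimately show ?thesis by (intro that)
qed


section \<open>From graded resolutions to projective dimension\<close>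

text \<open>The recursion is unrolled into one sequence of maps. The given \<open>d\<close> is
  unconstrained beyond \<open>n\<close>, so \<open>d'\<close> replaces it by zero modules there, as
  \<open>projective_resolution\<close> demands.\<close>

lemma free_resolution_sequence:
  fixes N :: "('x::finite, 'k::field) vec set"
  assumes "free_resolution b n d N"
  obtains d' \<pi> where "\<And>i. graded_linear (d' (Suc i)) (d' i) (\<pi> i)" "d' 0 = d 0"
    "\<And>i. i > n \<Longrightarrow> d' i = []" "\<pi> 0 ` free_vecs (d' (Suc 0)) = N"
    "\<And>i. \<pi> (Suc i) ` free_vecs (d' (Suc (Suc i))) = graded_kernel (d' (Suc i)) (\<pi> i)"
    "b \<Longrightarrow> 0 < n \<and> (\<exists>j<length (d' n). minimal_vec (\<pi> (n - 1) (unit_vec j)))"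
proof -
  have "\<exists>d' \<pi>. (\<forall>i. graded_linear (d' (Suc i)) (d' i) (\<pi> i)) \<and> d' 0 = d 0 \<and>
    (\<forall>i>n. d' i = []) \<and> \<pi> 0 ` free_vecs (d' (Suc 0)) = N \<and>
    (\<forall>i. \<pi> (Suc i) ` free_vecs (d' (Suc (Suc i))) = graded_kernel (d' (Suc i)) (\<pi> i)) \<and>
    (b \<longrightarrow> 0 < n \<and> (\<exists>j<length (d' n). minimal_vec (\<pi> (n - 1) (unit_vec j))))"
    using assms
  proof (induction n arbitrary: b d N)
    case 0
    have free_Nil: "free_vecs [] = {\<lambda>_. 0}" by (auto simp: free_vecs_def)
    show ?case
      using 0 graded_linear_zero_map by (intro exI[of _ "case_nat (d 0) (\<lambda>_. [])"] exI[of _ "\<lambda>_ _ _. 0"])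
        (auto simp: free_Nil graded_kernel_def split: nat.splits)
  next
    case (Suc n)
    from Suc.prems obtain \<pi> where \<pi>: "graded_linear (d (Suc 0)) (d 0) \<pi>"
        "\<pi> ` free_vecs (d (Suc 0)) = N"
        "free_resolution (b \<and> n \<noteq> 0) n (\<lambda>i. d (Suc i)) (graded_kernel (d (Suc 0)) \<pi>)"
        "b \<and> n = 0 \<longrightarrow> (\<exists>j<length (d (Suc 0)). minimal_vec (\<pi> (unit_vec j)))"
      by auto
    from Suc.IH[OF \<pi>(3)] obtain d' \<rho> where IH: "\<And>i. graded_linear (d' (Suc i)) (d' i) (\<rho> i)"
      "d' 0 = d (Suc 0)" "\<And>i. i > n \<Longrightarrow> d' i = []"
      "\<rho> 0 ` free_vecs (d' (Suc 0)) = graded_kernel (d (Suc 0)) \<pi>"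
      "\<And>i. \<rho> (Suc i) ` free_vecs (d' (Suc (Suc i))) = graded_kernel (d' (Suc i)) (\<rho> i)"
      "b \<and> n \<noteq> 0 \<longrightarrow> 0 < n \<and> (\<exists>j<length (d' n). minimal_vec (\<rho> (n - 1) (unit_vec j)))"
      by blast
    show ?case
    proof (intro exI[of _ "case_nat (d 0) d'"] exI[of _ "case_nat \<pi> \<rho>"] conjI allI impI)
      show "graded_linear (case_nat (d 0) d' (Suc i)) (case_nat (d 0) d' i) (case_nat \<pi> \<rho> i)" for i
        using IH \<pi> by (cases i) auto
      show "case_nat \<pi> \<rho> (Suc i) ` free_vecs (case_nat (d 0) d' (Suc (Suc i))) =
          graded_kernel (case_nat (d 0) d' (Suc i)) (case_nat \<pi> \<rho> i)" for i
        using IH by (cases i) auto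
      show "case_nat (d 0) d' i = []" if "i > Suc n" for i
        using IH that by (cases i) auto
      show "\<exists>j<length (case_nat (d 0) d' (Suc n)). minimal_vec (case_nat \<pi> \<rho> (Suc n - 1) (unit_vec j))" if b
        using IH(2,6) \<pi>(4) that by (cases n) auto
    qed (use \<pi> IH in auto)
  qed
  then show ?thesis using that by blast
qed

text \<open>In \<open>proj_dim\<close> the terms are sets of functions on lists. The basis index
  \<open>i\<close> is encoded by the list of length \<open>i\<close> with constant entry
  \<open>undefined\<close>, which works for every type of entries.\<close>

definition vec_module :: "nat list \<Rightarrow> (('x, 'k::field) mpoly, 'c list \<Rightarrow> ('x, 'k) mpoly) module"
  where "vec_module \<delta> = free_module mpoly_ring ((\<lambda>i. replicate i undefined) ` {..<length \<delta>})"

definition to_fun :: "(nat \<Rightarrow> 'a::zero) \<Rightarrow> 'c list \<Rightarrow> 'a"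
  where "to_fun v = (\<lambda>b. if b = replicate (length b) undefined then v (length b) else 0)"

definition of_fun :: "('c list \<Rightarrow> 'a) \<Rightarrow> nat \<Rightarrow> 'a"
  where "of_fun w = (\<lambda>i. w (replicate i undefined))"

lemma of_fun_to_fun [simp]: "of_fun (to_fun v) = v"
  by (simp add: of_fun_def to_fun_def)

lemma in_vec_module_iff:
  "w \<in> carrier (vec_module \<delta>) \<longleftrightarrow> (\<forall>b. b \<notin> (\<lambda>i. replicate i undefined) ` {..<length \<delta>} \<longrightarrow> w b = 0)"
proof -
  have "finite {b. w b \<noteq> 0}" if "\<And>b. b \<notin> (\<lambda>i. replicate i undefined) ` {..<length \<delta>} \<Longrightarrow> w b = 0"
    by (rule finite_subset[of _ "(\<lambda>i. replicate i undefined) ` {..<length \<delta>}"]) (use that in auto)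
  then show ?thesis by (auto simp: vec_module_def free_module_def)
qed

lemma replicate_image_iff:
  "b \<in> (\<lambda>i. replicate i undefined) ` {..<n} \<longleftrightarrow> b = replicate (length b) undefined \<and> length b < n"
  by (auto simp: image_iff)

lemma of_fun_in: "w \<in> carrier (vec_module \<delta>) \<Longrightarrow> of_fun w \<in> free_vecs \<delta>"
  by (auto simp: in_vec_module_iff replicate_image_iff free_vecs_def of_fun_def)

lemma to_fun_in: "v \<in> free_vecs \<delta> \<Longrightarrow> to_fun v \<in> carrier (vec_module \<delta>)"
  by (auto simp: in_vec_module_iff replicate_image_iff free_vecs_def to_fun_def)

lemma to_fun_of_fun: "w \<in> carrier (vec_module \<delta>) \<Longrightarrow> to_fun (of_fun w) = w"
  by (rule ext) (auto simp: in_vec_module_iff replicate_image_iff of_fun_def to_fun_def)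

lemma vec_module_simps [simp]:
  "v \<oplus>\<^bsub>vec_module \<delta>\<^esub> w = (\<lambda>b. v b + w b)" "r \<odot>\<^bsub>vec_module \<delta>\<^esub> v = (\<lambda>b. r * v b)"
  "\<zero>\<^bsub>vec_module \<delta>\<^esub> = (\<lambda>_. 0)"
  by (simp_all add: vec_module_def free_module_def)

lemma of_fun_add: "of_fun (\<lambda>b. v b + w b) = (\<lambda>i. of_fun v i + of_fun w i)"
  by (simp add: of_fun_def)

lemma of_fun_scale: "of_fun (\<lambda>b. r * v b) = (\<lambda>i. r * of_fun v i)"
  by (simp add: of_fun_def)

lemma to_fun_add: "to_fun (\<lambda>i. v i + w i) = (\<lambda>b. to_fun v b + to_fun w b)"
  for v w :: "nat \<Rightarrow> 'a::comm_ring_1"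
  by (auto simp: to_fun_def)

lemma to_fun_scale: "to_fun (\<lambda>i. r * v i) = (\<lambda>b. r * to_fun v b)"
  for v :: "nat \<Rightarrow> 'a::comm_ring_1"
  by (auto simp: to_fun_def)

lemma to_fun_zero: "to_fun (\<lambda>_. 0) = (\<lambda>_. 0)"
  by (auto simp: to_fun_def)

lemma of_fun_zero: "of_fun (\<lambda>_. 0) = (\<lambda>_. 0)"
  by (auto simp: of_fun_def)

text \<open>By definition a projective module is a summand of a free module whose basis has the type
  of its own elements. Hence \<open>B\<close> is replaced by its unit vectors
  \<open>e b\<close>.\<close>

lemma projective_free_module:
  "projective_module mpoly_ring (free_module (mpoly_ring :: ('x, 'k::field) mpoly ring) B)"
  for B :: "'b set"
proof -
  define e :: "'b \<Rightarrow> 'b \<Rightarrow> ('x, 'k) mpoly" where "e b = (\<lambda>b'. if b' = b then 1 else 0)" for b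
  have inj: "inj_on e B"
  proof (rule inj_onI)
    fix x y assume "e x = e y"
    then have "e x y = e y y" by simp
    then show "x = y" by (simp add: e_def split: if_splits)
  qed
  define \<iota> where "\<iota> v = (\<lambda>u. if u \<in> e ` B then v (the_inv_into B e u) else 0)" for v :: "'b \<Rightarrow> ('x, 'k) mpoly"
  define \<pi> where "\<pi> w = (\<lambda>b. if b \<in> B then w (e b) else 0)" for w :: "('b \<Rightarrow> ('x, 'k) mpoly) \<Rightarrow> ('x, 'k) mpoly"
  let ?F = "free_module (mpoly_ring :: ('x, 'k) mpoly ring) B"
  let ?G = "free_module (mpoly_ring :: ('x, 'k) mpoly ring) (e ` B)"
  have "\<iota> \<in> module_hom_set mpoly_ring ?F ?G"
  proof -
    have "finite {u. \<iota> v u \<noteq> 0}" if "finite {b. v b \<noteq> 0}" for v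
    proof (rule finite_subset)
      show "{u. \<iota> v u \<noteq> 0} \<subseteq> e ` {b. v b \<noteq> 0}"
        by (auto simp: \<iota>_def the_inv_into_f_f[OF inj] split: if_splits)
    qed (use that in simp)
    then show ?thesis by (auto simp: module_hom_set_def free_module_def) (auto simp: \<iota>_def)
  qed
  moreover have "\<pi> \<in> module_hom_set mpoly_ring ?G ?F"
  proof -
    have "finite {b. \<pi> w b \<noteq> 0}" if "finite {u. w u \<noteq> 0}" for w
    proof (rule inj_on_finite)
      show "inj_on e {b. \<pi> w b \<noteq> 0}"
        by (rule inj_on_subset[OF inj]) (auto simp: \<pi>_def split: if_splits)
      show "e ` {b. \<pi> w b \<noteq> 0} \<subseteq> {u. w u \<noteq> 0}"
        by (auto simp: \<pi>_def split: if_splits)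
    qed (use that in simp)
    then show ?thesis by (auto simp: module_hom_set_def free_module_def) (auto simp: \<pi>_def)
  qed
  moreover have "\<pi> (\<iota> v) = v" if "v \<in> carrier ?F" for v
    using that by (auto simp: \<pi>_def \<iota>_def the_inv_into_f_f[OF inj] free_module_def fun_eq_iff)
  ultimately show ?thesis
    unfolding projective_module_def using module_free_module[OF cring_mpoly_ring] by blast
qed

lemma projective_vec_module: "projective_module mpoly_ring (vec_module \<delta>)"
  unfolding vec_module_def by (rule projective_free_module)

lemma vec_module_hom:
  assumes "graded_linear \<gamma> \<delta> \<pi>"
  shows "(\<lambda>w. to_fun (\<pi> (of_fun w))) \<in> module_hom_set mpoly_ring (vec_module \<gamma>) (vec_module \<delta>)"
  unfolding module_hom_set_def
  by (auto simp: to_fun_in graded_linearD[OF assms] of_fun_in of_fun_add of_fun_scale to_fun_add to_fun_scale)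

lemma vec_module_image:
  fixes \<pi> :: "('x::finite, 'k::field) vec \<Rightarrow> ('x, 'k) vec"
  shows "(\<lambda>w. to_fun (\<pi> (of_fun w))) ` carrier (vec_module \<gamma>) = (to_fun ` \<pi> ` free_vecs \<gamma> :: ('c list \<Rightarrow> _) set)"
proof (intro equalityI subsetI)
  fix x :: "'c list \<Rightarrow> ('x, 'k) mpoly"
  assume "x \<in> to_fun ` \<pi> ` free_vecs \<gamma>"
  then obtain v where v: "v \<in> free_vecs \<gamma>" "x = to_fun (\<pi> v)" by blast
  then show "x \<in> (\<lambda>w. to_fun (\<pi> (of_fun w))) ` carrier (vec_module \<gamma>)"
    by (intro image_eqI[of _ _ "to_fun v"]) (simp_all add: to_fun_in)
qed (auto dest: of_fun_in)

lemma to_fun_eq_zero_iff: "to_fun v = (\<lambda>_. 0) \<longleftrightarrow> v = (\<lambda>_. 0)"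
  by (metis of_fun_to_fun of_fun_zero to_fun_zero)

lemma vec_module_kernel:
  fixes \<pi> :: "('x::finite, 'k::field) vec \<Rightarrow> ('x, 'k) vec"
  shows "{w \<in> carrier (vec_module \<gamma>). (to_fun (\<pi> (of_fun w)) :: 'c list \<Rightarrow> _) = (\<lambda>_. 0 :: ('x, 'k) mpoly)} = (to_fun ` graded_kernel \<gamma> \<pi> :: ('c list \<Rightarrow> _) set)"
proof (intro equalityI subsetI)
  fix w :: "'c list \<Rightarrow> ('x, 'k) mpoly"
  assume "w \<in> {w \<in> carrier (vec_module \<gamma>). (to_fun (\<pi> (of_fun w)) :: 'c list \<Rightarrow> _) = (\<lambda>_. 0 :: ('x, 'k) mpoly)}"
  then show "w \<in> to_fun ` graded_kernel \<gamma> \<pi>"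
    by (intro image_eqI[of _ _ "of_fun w"])
      (auto simp: to_fun_of_fun graded_kernel_def of_fun_in to_fun_eq_zero_iff)
qed (auto simp: graded_kernel_def to_fun_in to_fun_zero)

text \<open>The augmentation is left general, so that quotients, ideals and the zero module are all
  covered.\<close>

lemma vec_module_resolution:
  fixes M :: "(('x::finite, 'k::field) mpoly, 'm, 'e) module_scheme"
    and \<epsilon> :: "('c list \<Rightarrow> ('x, 'k) mpoly) \<Rightarrow> 'm"
  assumes "\<And>i. graded_linear (d (Suc i)) (d i) (\<pi> i)" "\<And>i. i > n \<Longrightarrow> d i = []"
    and "\<And>i. \<pi> (Suc i) ` free_vecs (d (Suc (Suc i))) = graded_kernel (d (Suc i)) (\<pi> i)"
    and "\<epsilon> \<in> module_hom_set mpoly_ring (vec_module (d 0)) M" "\<epsilon> ` carrier (vec_module (d 0)) = carrier M"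
    and "\<And>v. v \<in> free_vecs (d 0) \<Longrightarrow> \<epsilon> (to_fun v) = \<zero>\<^bsub>M\<^esub> \<longleftrightarrow> v \<in> \<pi> 0 ` free_vecs (d (Suc 0))"
  shows "projective_resolution mpoly_ring M n (\<lambda>i. vec_module (d i)) (\<lambda>i w. to_fun (\<pi> i (of_fun w))) \<epsilon>"
  unfolding projective_resolution_def
proof (intro conjI allI impI)
  let ?P = "\<lambda>i. vec_module (d i) :: (('x, 'k) mpoly, 'c list \<Rightarrow> ('x, 'k) mpoly) module"
  show "projective_module mpoly_ring (?P i)" for i by (rule projective_vec_module)
  show "carrier (?P i) = {\<zero>\<^bsub>?P i\<^esub>}" if "n < i" for i
    using assms(2)[OF that] by (auto simp: in_vec_module_iff)
  show "(\<lambda>w. to_fun (\<pi> i (of_fun w))) \<in> module_hom_set mpoly_ring (?P (Suc i)) (?P i)" for i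
    by (rule vec_module_hom) (rule assms)
  show "(\<lambda>w. to_fun (\<pi> (Suc i) (of_fun w))) ` carrier (?P (Suc (Suc i))) =
      a_kernel (?P (Suc i)) (?P i) (\<lambda>w. to_fun (\<pi> i (of_fun w)))" for i
    unfolding vec_module_image a_kernel_def' vec_module_simps assms(3)
    by (rule vec_module_kernel[symmetric])
  show "(\<lambda>w. to_fun (\<pi> 0 (of_fun w))) ` carrier (?P 1) = a_kernel (?P 0) M \<epsilon>"
    unfolding vec_module_image a_kernel_def' One_nat_def
  proof (intro equalityI subsetI)
    fix w assume w: "w \<in> {x \<in> carrier (?P 0). \<epsilon> x = \<zero>\<^bsub>M\<^esub>}"
    then have "of_fun w \<in> \<pi> 0 ` free_vecs (d (Suc 0))"
      using assms(6)[of "of_fun w"] by (simp add: to_fun_of_fun[of w "d 0"] of_fun_in)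
    moreover have "w = to_fun (of_fun w)" using w by (simp add: to_fun_of_fun[of w "d 0"])
    ultimately show "w \<in> to_fun ` \<pi> 0 ` free_vecs (d (Suc 0))" by blast
  next
    fix w :: "'c list \<Rightarrow> ('x, 'k) mpoly" assume "w \<in> to_fun ` \<pi> 0 ` free_vecs (d (Suc 0))"
    then show "w \<in> {x \<in> carrier (?P 0). \<epsilon> x = \<zero>\<^bsub>M\<^esub>}"
      using assms(6) graded_linearD(1)[OF assms(1)] by (auto simp: to_fun_in)
  qed
qed (use assms in auto)

lemma quotient_module_simps:
  "carrier (quotient_module mpoly_ring J) = range (\<lambda>p. J +>\<^bsub>mpoly_ring\<^esub> p)"
  "\<zero>\<^bsub>quotient_module mpoly_ring J\<^esub> = J"
  by (auto simp: quotient_module_def FactRing_def A_RCOSETS_def')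

lemma quotient_resolution:
  fixes J :: "('x::finite, 'k::field) mpoly set"
  assumes "ideal J mpoly_ring"
    and d: "\<And>i. graded_linear (d (Suc i)) (d i) (\<pi> i)" "\<And>i. i > n \<Longrightarrow> d i = []"
    "\<And>i. \<pi> (Suc i) ` free_vecs (d (Suc (Suc i))) = graded_kernel (d (Suc i)) (\<pi> i)"
    "d 0 = [0]" "\<pi> 0 ` free_vecs (d (Suc 0)) = ideal_vecs J"
  shows "projective_resolution mpoly_ring (quotient_module mpoly_ring J) n
    (\<lambda>i. vec_module (d i) :: (_, 'c list \<Rightarrow> _) module) (\<lambda>i w. to_fun (\<pi> i (of_fun w))) (\<lambda>w. J +>\<^bsub>mpoly_ring\<^esub> of_fun w 0)"
proof (rule vec_module_resolution[where d = d and \<pi> = \<pi>, OF d(1-3)])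
  interpret C: cring "mpoly_ring :: ('x, 'k) mpoly ring" by (rule cring_mpoly_ring)
  interpret J: ideal J mpoly_ring by fact
  note hom = J.rcos_ring_hom
  show "(\<lambda>w. J +>\<^bsub>mpoly_ring\<^esub> of_fun w 0) \<in> module_hom_set mpoly_ring (vec_module (d 0)) (quotient_module mpoly_ring J)"
    using ring_hom_add[OF hom] ring_hom_mult[OF hom]
    by (auto simp: module_hom_set_def quotient_module_simps of_fun_add of_fun_scale)
      (auto simp: quotient_module_def)
  show "(\<lambda>w. J +>\<^bsub>mpoly_ring\<^esub> of_fun w 0) ` carrier (vec_module (d 0) :: (_, 'c list \<Rightarrow> _) module) =
      carrier (quotient_module mpoly_ring J)"
  proof (intro equalityI subsetI)
    fix c assume "c \<in> carrier (quotient_module mpoly_ring J)"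
    then obtain p where p: "c = J +>\<^bsub>mpoly_ring\<^esub> p" by (auto simp: quotient_module_simps)
    have "(\<lambda>i. if i = 0 then p else 0) \<in> free_vecs (d 0)" by (simp add: d(4) free_vecs_def)
    from to_fun_in[OF this] show "c \<in> (\<lambda>w. J +>\<^bsub>mpoly_ring\<^esub> of_fun w 0) ` carrier (vec_module (d 0) :: (_, 'c list \<Rightarrow> _) module)"
      by (rule image_eqI[rotated]) (simp add: p)
  qed (auto simp: quotient_module_simps)
  fix v :: "('x, 'k) vec" assume v: "v \<in> free_vecs (d 0)"
  have "J +>\<^bsub>mpoly_ring\<^esub> p = J \<longleftrightarrow> p \<in> J" for p
    using J.rcos_const_imp_mem[of p] J.a_rcos_const[of p] by auto
  then show "J +>\<^bsub>mpoly_ring\<^esub> of_fun (to_fun v :: 'c list \<Rightarrow> _) 0 = \<zero>\<^bsub>quotient_module mpoly_ring J\<^esub> \<longleftrightarrow>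
      v \<in> \<pi> 0 ` free_vecs (d (Suc 0))"
    using v by (simp add: quotient_module_simps d(4,5) in_ideal_vecs_iff[of _ _ 0])
qed

text \<open>The first term of the resolution of the quotient is dropped, and its first map becomes
  the augmentation onto the ideal.\<close>

lemma ideal_resolution:
  fixes J :: "('x::finite, 'k::field) mpoly set"
  assumes d: "\<And>i. graded_linear (d (Suc i)) (d i) (\<pi> i)" "\<And>i. i > Suc n \<Longrightarrow> d i = []"
    "\<And>i. \<pi> (Suc i) ` free_vecs (d (Suc (Suc i))) = graded_kernel (d (Suc i)) (\<pi> i)"
    "\<pi> 0 ` free_vecs (d (Suc 0)) = ideal_vecs J"
  shows "projective_resolution mpoly_ring (ideal_module mpoly_ring J) n
    (\<lambda>i. vec_module (d (Suc i)) :: (_, 'c list \<Rightarrow> _) module) (\<lambda>i w. to_fun (\<pi> (Suc i) (of_fun w)))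
    (\<lambda>w. \<pi> 0 (of_fun w) 0)"
proof (rule vec_module_resolution)
  have J: "\<pi> 0 v \<in> ideal_vecs J" if "v \<in> free_vecs (d (Suc 0))" for v using d(4) that by blast
  then show "(\<lambda>w. \<pi> 0 (of_fun w) 0) \<in> module_hom_set mpoly_ring (vec_module (d (Suc 0))) (ideal_module mpoly_ring J)"
    by (auto simp: module_hom_set_def ideal_module_def of_fun_add of_fun_scale of_fun_in
        graded_linearD[OF d(1)] ideal_vecs_def)
  show "(\<lambda>w. \<pi> 0 (of_fun w) 0) ` carrier (vec_module (d (Suc 0)) :: (_, 'c list \<Rightarrow> _) module) =
      carrier (ideal_module mpoly_ring J)"
  proof (intro equalityI subsetI)
    fix p assume "p \<in> carrier (ideal_module mpoly_ring J)"
    then have "(\<lambda>i. if i = 0 then p else 0) \<in> ideal_vecs J" by (simp add: ideal_vecs_def ideal_module_def)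
    then obtain v where v: "v \<in> free_vecs (d (Suc 0))" "(\<lambda>i. if i = 0 then p else 0) = \<pi> 0 v"
      using d(4) by blast
    from to_fun_in[OF v(1)] show "p \<in> (\<lambda>w. \<pi> 0 (of_fun w) 0) ` carrier (vec_module (d (Suc 0)) :: (_, 'c list \<Rightarrow> _) module)"
      by (rule image_eqI[rotated]) (simp flip: v(2))
  qed (use J of_fun_in in \<open>force simp: ideal_module_def ideal_vecs_def\<close>)
  fix v :: "('x, 'k) vec" assume v: "v \<in> free_vecs (d (Suc 0))"
  have "\<pi> 0 v 0 = 0 \<longleftrightarrow> \<pi> 0 v = (\<lambda>_. 0)"
    using J[OF v] by (auto simp: ideal_vecs_def fun_eq_iff) (metis gr0I)
  then show "\<pi> 0 (of_fun (to_fun v :: 'c list \<Rightarrow> _)) 0 = \<zero>\<^bsub>ideal_module mpoly_ring J\<^esub> \<longleftrightarrow>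
      v \<in> \<pi> (Suc 0) ` free_vecs (d (Suc (Suc 0)))"
    using v by (simp add: d(3) graded_kernel_def ideal_module_def)
qed (use d in auto)

lemma proj_dim_upper:
  fixes P :: "nat \<Rightarrow> ('a, ('a + 'm) list \<Rightarrow> 'a) module" and M :: "('a, 'm, 'c) module_scheme"
  assumes "projective_resolution R M n P d \<epsilon>"
  shows "proj_dim R M \<le> enat n"
  unfolding proj_dim_def using assms by (intro Inf_lower) blast

lemma proj_dim_quotient_upper:
  fixes J :: "('x::finite, 'k::field) mpoly set"
  assumes "ideal J mpoly_ring" "free_resolution b n d (ideal_vecs J)" "d 0 = [0]"
  shows "proj_dim mpoly_ring (quotient_module mpoly_ring J) \<le> enat n"
  using assms(2)
proof (rule free_resolution_sequence)
  fix d' :: "nat \<Rightarrow> nat list" and \<pi> :: "nat \<Rightarrow> ('x, 'k) vec \<Rightarrow> ('x, 'k) vec"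
  assume d': "\<And>i. graded_linear (d' (Suc i)) (d' i) (\<pi> i)" "d' 0 = d 0"
    "\<And>i. i > n \<Longrightarrow> d' i = []" "\<pi> 0 ` free_vecs (d' (Suc 0)) = ideal_vecs J"
    "\<And>i. \<pi> (Suc i) ` free_vecs (d' (Suc (Suc i))) = graded_kernel (d' (Suc i)) (\<pi> i)"
  show ?thesis
    by (rule proj_dim_upper[OF quotient_resolution[where d = d' and \<pi> = \<pi>, OF assms(1) d'(1,3,5)]])
      (use assms d' in auto)
qed

section \<open>Lower bounds for the projective dimension\<close>

lemma proj_dim_lower:
  assumes "\<And>n P d \<epsilon>. projective_resolution R M n (P :: nat \<Rightarrow> ('a, ('a + 'm) list \<Rightarrow> 'a) module) d \<epsilon> \<Longrightarrow> q \<le> n"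
  shows "enat q \<le> proj_dim R (M :: ('a, 'm, 'c) module_scheme)"
  unfolding proj_dim_def using assms by (intro Inf_greatest) auto

text \<open>The constant term is a substitution, hence multiplicative; \<open>lookup_mult_0\<close>
  follows without computing a convolution.\<close>

lemma mpoly_subst_zero:
  fixes p :: "('x::finite, 'k::field) mpoly"
  shows "mpoly_subst (\<lambda>_. 0 :: ('x, 'k) mpoly) p = mpoly_const (lookup p 0)"
proof -
  have prod: "(\<Prod>i\<in>UNIV. (0 :: ('x, 'k) mpoly) ^ lookup m i) = (if m = 0 then 1 else 0)" for m :: "'x \<Rightarrow>\<^sub>0 nat"
  proof (cases "m = 0")
    case False
    then obtain i where "lookup m i \<noteq> 0" by (metis lookup_zero poly_mapping_eqI)
    then have "\<exists>i\<in>UNIV. (0 :: ('x, 'k) mpoly) ^ lookup m i = 0" by (intro bexI[of _ i]) (simp_all add: zero_power)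
    then have "(\<Prod>i\<in>UNIV. (0 :: ('x, 'k) mpoly) ^ lookup m i) = 0" by (intro prod_zero) simp_all
    with False show ?thesis by simp
  qed simp
  have "mpoly_subst (\<lambda>_. 0 :: ('x, 'k) mpoly) p = (\<Sum>m\<in>insert 0 (keys p).
      mpoly_const (lookup p m) * (if m = 0 then 1 else 0))"
    by (subst mpoly_subst_superset[of "insert 0 (keys p)"]) (auto simp only: prod finite_insert finite_keys)
  also have "\<dots> = (\<Sum>m\<in>insert 0 (keys p). if m = 0 then mpoly_const (lookup p 0) else 0)"
    by (rule sum.cong) auto
  also have "\<dots> = mpoly_const (lookup p 0)"
    by (subst sum.delta) simp_all
  finally show ?thesis .
qed

lemma lookup_mult_0:
  fixes p q :: "('x::finite, 'k::field) mpoly"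
  shows "lookup (p * q) 0 = lookup p 0 * lookup q 0"
proof -
  have "(mpoly_const (lookup (p * q) 0) :: ('x, 'k) mpoly) =
      mpoly_const (lookup p 0 * lookup q 0)"
    unfolding mpoly_subst_zero[symmetric] mpoly_subst_mult
    unfolding mpoly_subst_zero by (simp add: mpoly_const_def mult_single)
  from arg_cong[OF this, of "\<lambda>p. lookup p 0"] show ?thesis by (simp add: mpoly_const_def)
qed

text \<open>A retraction would write 1, the \<open>j\<close>-th coordinate of
  \<open>unit_vec j\<close>, as a combination of the coordinates of
  \<open>\<pi> (unit_vec j)\<close>, which all lie in the irrelevant ideal.\<close>

lemma minimal_no_retraction:
  fixes \<pi> :: "('x::finite, 'k::field) vec \<Rightarrow> ('x, 'k) vec"
  assumes \<pi>: "graded_linear \<gamma> \<delta> \<pi>" and j: "j < length \<gamma>" "minimal_vec (\<pi> (unit_vec j))"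
    and s: "s \<in> module_hom_set mpoly_ring (vec_module \<delta>) (vec_module \<gamma> :: (_, 'c list \<Rightarrow> _) module)"
    and retr: "\<And>x. x \<in> carrier (vec_module \<gamma>) \<Longrightarrow> s (to_fun (\<pi> (of_fun x))) = x"
  shows False
proof -
  define f where "f v = of_fun (s (to_fun v))" for v
  have add: "f (\<lambda>i. v i + w i) = (\<lambda>i. f v i + f w i)" if "v \<in> free_vecs \<delta>" "w \<in> free_vecs \<delta>" for v w
    using module_hom_add[OF s to_fun_in[OF that(1)] to_fun_in[OF that(2)]]
    by (simp add: f_def to_fun_add of_fun_add)
  have scale: "f (\<lambda>i. r * v i) = (\<lambda>i. r * f v i)" if "v \<in> free_vecs \<delta>" for r v
    using module_hom_smult[OF s _ to_fun_in[OF that], of r]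
    by (simp add: f_def to_fun_scale of_fun_scale)
  have uj: "unit_vec j \<in> free_vecs \<gamma>" by (rule unit_vec_in_free_vecs[OF j(1)])
  have "f (\<pi> (unit_vec j)) = unit_vec j"
    using retr[OF to_fun_in[OF uj]] by (simp add: f_def)
  moreover have "f (\<pi> (unit_vec j)) = lincomb (length \<delta>) (\<lambda>i. f (unit_vec i)) (\<pi> (unit_vec j))"
    by (rule free_linear_eq_lincomb[OF add scale]) (simp_all add: graded_linearD(1)[OF \<pi> uj])
  ultimately have "unit_vec j j = lincomb (length \<delta>) (\<lambda>i. f (unit_vec i)) (\<pi> (unit_vec j)) j"
    by simp
  then have "(1 :: ('x, 'k) mpoly) = (\<Sum>i<length \<delta>. \<pi> (unit_vec j) i * f (unit_vec i) j)"
    by (simp only: lincomb_def) (simp add: unit_vec_def)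
  then have "lookup (1 :: ('x, 'k) mpoly) 0 =
      (\<Sum>i<length \<delta>. lookup (\<pi> (unit_vec j) i * f (unit_vec i) j) 0)"
    unfolding lookup_sum[symmetric] by (rule arg_cong)
  also have "\<dots> = 0" using j(2) by (simp add: lookup_mult_0 minimal_vec_def)
  finally show False by simp
qed

text \<open>A resolution that is too short would split the marked last map by
  \<open>resolution_retraction\<close>. For the ideal the first map is lost as an augmentation, so
  the marked map survives only for \<open>k > 0\<close>; for \<open>k = 0\<close> the bound is
  trivial.\<close>

lemma proj_dim_marked_lower:
  fixes J :: "('x::finite, 'k::field) mpoly set"
  assumes J: "ideal J mpoly_ring" and res: "free_resolution True (Suc k) d (ideal_vecs J)" "d 0 = [0]"
  shows "enat (Suc k) \<le> proj_dim mpoly_ring (quotient_module mpoly_ring J)"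
    and "enat k \<le> proj_dim mpoly_ring (ideal_module mpoly_ring J)"
proof -
  obtain d' \<pi> where d': "\<And>i. graded_linear (d' (Suc i)) (d' i) (\<pi> i)" "d' 0 = d 0"
    "\<And>i. i > Suc k \<Longrightarrow> d' i = []" "\<pi> 0 ` free_vecs (d' (Suc 0)) = ideal_vecs J"
    "\<And>i. \<pi> (Suc i) ` free_vecs (d' (Suc (Suc i))) = graded_kernel (d' (Suc i)) (\<pi> i)"
    "\<exists>j<length (d' (Suc k)). minimal_vec (\<pi> k (unit_vec j))"
    using free_resolution_sequence[OF res(1)] by (metis diff_Suc_1)
  from d'(6) obtain j where j: "j < length (d' (Suc k))" "minimal_vec (\<pi> k (unit_vec j))" by blast
  have d0: "d' 0 = [0]" by (simp add: d'(2) res(2))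
  show "enat (Suc k) \<le> proj_dim mpoly_ring (quotient_module mpoly_ring J)"
  proof (rule proj_dim_lower)
    fix p and P :: "nat \<Rightarrow> (('x, 'k) mpoly, (('x, 'k) mpoly + ('x, 'k) mpoly set) list \<Rightarrow> ('x, 'k) mpoly) module"
      and dP \<epsilon>P
    assume P: "projective_resolution mpoly_ring (quotient_module mpoly_ring J) p P dP \<epsilon>P"
    \<comment> \<open>The entry type of the lists is free here, since the two resolutions to be
      compared may live in different types.\<close>
    note G = quotient_resolution[where d = d' and \<pi> = \<pi> and ?'c = unit, OF J d'(1,3,5) d0 d'(4)]
    show "Suc k \<le> p"
    proof (rule ccontr)
      assume "\<not> Suc k \<le> p"
      then have "p < Suc k" by simp
      from resolution_retraction[OF cring_mpoly_ring module_quotient_module[OF cring_mpoly_ring J] P G this]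
      show False using minimal_no_retraction[OF d'(1) j] by blast
    qed
  qed
  show "enat k \<le> proj_dim mpoly_ring (ideal_module mpoly_ring J)"
  proof (cases k)
    case 0
    then show ?thesis by (simp flip: zero_enat_def)
  next
    case (Suc r)
    show ?thesis
    proof (rule proj_dim_lower)
      fix p and P :: "nat \<Rightarrow> (('x, 'k) mpoly, (('x, 'k) mpoly + ('x, 'k) mpoly) list \<Rightarrow> ('x, 'k) mpoly) module"
        and dP \<epsilon>P
      assume P: "projective_resolution mpoly_ring (ideal_module mpoly_ring J) p P dP \<epsilon>P"
      note G = ideal_resolution[where d = d' and \<pi> = \<pi> and ?'c = unit, OF d'(1,3,5,4), unfolded Suc]
      show "k \<le> p"
      proof (rule ccontr)
        assume "\<not> k \<le> p"
        then have "p < Suc r" by (simp add: Suc)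
        from resolution_retraction[OF cring_mpoly_ring module_ideal_module[OF cring_mpoly_ring J] P G this]
        show False using minimal_no_retraction[OF d'(1) j] unfolding Suc by blast
      qed
    qed
  qed
qed

text \<open>This covers the unit ideal, for which the quotient is the zero module.\<close>

lemma proj_dim_quotient_UNIV:
  "proj_dim mpoly_ring (quotient_module (mpoly_ring :: ('x::finite, 'k::field) mpoly ring) UNIV) = 0"
proof -
  interpret C: cring "mpoly_ring :: ('x, 'k) mpoly ring" by (rule cring_mpoly_ring)
  let ?M = "quotient_module (mpoly_ring :: ('x, 'k) mpoly ring) UNIV"
  have one: "ideal UNIV (mpoly_ring :: ('x, 'k) mpoly ring)" using C.oneideal by simp
  interpret M: Module.module mpoly_ring ?M by (rule module_quotient_module[OF cring_mpoly_ring one])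
  have c: "carrier ?M = {\<zero>\<^bsub>?M\<^esub>}"
  proof -
    interpret J: ideal UNIV "mpoly_ring :: ('x, 'k) mpoly ring" by (rule one)
    show ?thesis using J.a_rcos_const by (auto simp: quotient_module_simps)
  qed
  have free_Nil: "free_vecs [] = {\<lambda>_. 0}" by (auto simp: free_vecs_def)
  have "projective_resolution mpoly_ring ?M 0
      (\<lambda>i. vec_module [] :: (_, (('x, 'k) mpoly + ('x, 'k) mpoly set) list \<Rightarrow> _) module)
      (\<lambda>i w. to_fun ((\<lambda>_ _ _. 0) i (of_fun w))) (\<lambda>_. \<zero>\<^bsub>?M\<^esub>)"
    by (rule vec_module_resolution[where d = "\<lambda>_. []"])
      (use c graded_linear_zero_map in \<open>auto simp: free_Nil graded_kernel_def module_hom_set_def in_vec_module_iff\<close>)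
  from proj_dim_upper[OF this] show ?thesis by (simp add: zero_enat_def[symmetric])
qed


section \<open>Linear quotients and iterated mapping cones\<close>

declare free_resolution.simps(2) [simp del]

text \<open>The image of the monomial \<open>u\<close> under the substitution \<open>f\<close>. With
  \<open>f = mpoly_var\<close> it is the monomial itself, so one colon computation serves both
  \<open>T\<close> and \<open>R\<close>.\<close>

definition monom_value :: "('z::finite \<Rightarrow> 'a::comm_ring_1) \<Rightarrow> ('z \<Rightarrow>\<^sub>0 nat) \<Rightarrow> 'a"
  where "monom_value f u = (\<Prod>i\<in>UNIV. f i ^ lookup u i)"

definition mono_dvd :: "('z \<Rightarrow>\<^sub>0 nat) \<Rightarrow> ('z \<Rightarrow>\<^sub>0 nat) \<Rightarrow> bool"
  where "mono_dvd u m \<longleftrightarrow> (\<forall>i. lookup u i \<le> lookup m i)"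

text \<open>The colon ideal of \<open>U\<close> by \<open>u\<close> is generated by the variables in
  \<open>V\<close>, expressed through divisibility of monomials and hence without reference to a
  field.\<close>

definition quotient_step :: "('z \<Rightarrow>\<^sub>0 nat) set \<Rightarrow> ('z \<Rightarrow>\<^sub>0 nat) \<Rightarrow> 'z set \<Rightarrow> bool"
  where "quotient_step U u V \<longleftrightarrow>
    (\<forall>m. (\<exists>v\<in>U. mono_dvd v (m + u)) \<longleftrightarrow> (\<exists>z\<in>V. 0 < lookup m z))"

text \<open>The list starts with the last generator; each is paired with the variables of its colon ideal.\<close>

fun quotient_list :: "(('z \<Rightarrow>\<^sub>0 nat) \<times> 'z set) list \<Rightarrow> bool"
  where "quotient_list [] \<longleftrightarrow> True"
  | "quotient_list ((u, V) # L) \<longleftrightarrow> quotient_list L \<and> quotient_step (fst ` set L) u V"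

lemma monom_value_add: "monom_value f (u + v) = monom_value f u * monom_value f v"
  by (simp add: monom_value_def lookup_add power_add prod.distrib)

lemma monom_value_0: "monom_value f 0 = 1"
  by (simp add: monom_value_def)

lemma mpoly_subst_monom: "mpoly_subst f (mpoly_monom u) = monom_value f u"
  by (simp add: mpoly_monom_def mpoly_subst_single monom_value_def mpoly_const_def)

lemma monom_value_single: "monom_value f (single z 1) = f z"
proof -
  have "monom_value f (single z 1) = (\<Prod>i\<in>UNIV. if i = z then f i else 1)"
    unfolding monom_value_def by (rule prod.cong) (auto simp: lookup_single when_def)
  then show ?thesis by simp
qed

lemma homogeneous_power: "homogeneous d p \<Longrightarrow> homogeneous (e * d) (p ^ e)"
  by (induction e) (simp_all add: homogeneous_1 homogeneous_mult)

lemma homogeneous_prod: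
  "(\<And>a. a \<in> A \<Longrightarrow> homogeneous (d a) (f a)) \<Longrightarrow> homogeneous (sum d A) (prod f A)"
  by (induction A rule: infinite_finite_induct) (simp_all add: homogeneous_1 homogeneous_mult)

lemma homogeneous_monom_value:
  assumes "\<And>z. homogeneous (d z) (f z)"
  shows "homogeneous (\<Sum>z\<in>UNIV. lookup u z * d z) (monom_value f u)"
  unfolding monom_value_def by (intro homogeneous_prod homogeneous_power assms)

section \<open>Divisibility of monomials and sorting the generators by degree\<close>

lemma mono_dvd_iff: "mono_dvd u m \<longleftrightarrow> (\<exists>l. m = l + u)"
proof
  assume "mono_dvd u m"
  then have "m = (m - u) + u"
    by (intro poly_mapping_eqI) (simp add: lookup_add lookup_minus mono_dvd_def)
  then show "\<exists>l. m = l + u" by blast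
qed (auto simp: mono_dvd_def lookup_add)

lemma mono_dvd_add: "mono_dvd u v \<Longrightarrow> mono_dvd u (m + v)"
  by (auto simp: mono_dvd_def lookup_add intro: trans_le_add2)

lemma mono_dvd_mdegree:
  assumes "mono_dvd u m"
  shows "mdegree u \<le> mdegree m" and "mdegree u = mdegree m \<Longrightarrow> u = m"
proof -
  from assms obtain l where l: "m = l + u" by (auto simp: mono_dvd_iff)
  then show "mdegree u \<le> mdegree m" by (simp add: mdegree_add)
  assume "mdegree u = mdegree m"
  then have "mdegree l = 0" by (simp add: l mdegree_add)
  then have "l = 0" by (intro poly_mapping_eqI) (simp add: mdegree_def)
  then show "u = m" by (simp add: l)
qed

lemma mdegree_single: "mdegree (single z (Suc 0)) = 1"
  by (simp add: mdegree_def lookup_single when_def)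

lemma split_variable:
  assumes "0 < lookup m z"
  obtains m' where "m = m' + single z (1::nat)"
proof -
  have "mono_dvd (single z 1) m"
    using assms by (auto simp: mono_dvd_def lookup_single when_def)
  then show ?thesis using that by (auto simp: mono_dvd_iff)
qed

text \<open>The larger generator \<open>p\<close> contributes no variable to the colon ideal of
  \<open>q\<close>, so that ideal is already the one over \<open>U\<close>. Conversely, a common
  multiple of \<open>p\<close> and \<open>q\<close> is then divisible by a member of
  \<open>U\<close>, so placing \<open>q\<close> before \<open>p\<close> adds nothing to the colon
  ideal of \<open>p\<close>.\<close>

lemma quotient_step_swap:
  assumes p: "quotient_step U p V" and q: "quotient_step (insert p U) q W"
    and deg: "mdegree q < mdegree p" and nd: "\<not> mono_dvd q p"
  shows "quotient_step U q W" and "quotient_step (insert q U) p V"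
proof -
  have *: "\<exists>v\<in>U. mono_dvd v (m + q)" if z: "z \<in> W" "0 < lookup m z" for m z
  proof -
    have "0 < lookup (single z (1::nat)) z" by simp
    with q z(1) have "\<exists>v\<in>insert p U. mono_dvd v (single z 1 + q)"
      unfolding quotient_step_def by blast
    \<comment> \<open>As \<open>p\<close> has degree at least that of \<open>z * q\<close>,
      divisibility would force \<open>p = z * q\<close>, and \<open>q\<close> would divide
      \<open>p\<close>.\<close>
    moreover have "\<not> mono_dvd p (single z 1 + q)"
    proof
      assume d: "mono_dvd p (single z 1 + q)"
      from mono_dvd_mdegree(1)[OF d] deg have "mdegree p = mdegree (single z 1 + q)"
        by (simp add: mdegree_add mdegree_single)
      from mono_dvd_mdegree(2)[OF d this] nd show False by (auto simp: mono_dvd_iff)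
    qed
    ultimately obtain v where v: "v \<in> U" "mono_dvd v (single z 1 + q)" by blast
    obtain m' where "m = m' + single z 1" using z(2) by (rule split_variable)
    with mono_dvd_add[OF v(2), of m'] v(1) show ?thesis by (auto simp: add.assoc)
  qed
  show "quotient_step U q W"
    unfolding quotient_step_def using * q unfolding quotient_step_def by blast
  have "\<exists>z\<in>V. 0 < lookup m z" if d: "mono_dvd q (m + p)" for m
  proof -
    from d obtain m' where m': "m + p = m' + q" by (auto simp: mono_dvd_iff)
    have "mono_dvd p (m' + q)" by (simp flip: m' add: mono_dvd_def lookup_add)
    then obtain z where "z \<in> W" "0 < lookup m' z"
      using q unfolding quotient_step_def by blast
    from *[OF this] p show ?thesis unfolding quotient_step_def m'[symmetric] by blast
  qed
  then show "quotient_step (insert q U) p V"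
    using p unfolding quotient_step_def by blast
qed

text \<open>The degrees decrease along the list because it starts with the last generator.\<close>

abbreviation degree_sorted :: "(('z::finite \<Rightarrow>\<^sub>0 nat) \<times> 'z set) list \<Rightarrow> bool"
  where "degree_sorted \<equiv> sorted_wrt (\<lambda>a b. mdegree (fst b) \<le> mdegree (fst a))"

text \<open>Insertion by adjacent exchanges. Whole pairs are permuted, so each generator keeps its
  set of variables.\<close>

lemma quotient_list_insert:
  assumes "quotient_list L" "degree_sorted L" "quotient_step (fst ` set L) u V"
    and "\<And>p. p \<in> fst ` set L \<Longrightarrow> \<not> mono_dvd u p"
  shows "\<exists>L'. quotient_list L' \<and> degree_sorted L' \<and> mset L' = mset ((u, V) # L)"
  using assms
proof (induction L)
  case Nil
  then show ?case by (intro exI[of _ "[(u, V)]"]) simp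
next
  case (Cons a L)
  obtain p W where a: "a = (p, W)" by fastforce
  show ?case
  proof (cases "mdegree p \<le> mdegree u")
    case True
    then show ?thesis
      using Cons.prems by (intro exI[of _ "(u, V) # a # L"]) (auto simp: a)
  next
    case False
    have p: "quotient_step (fst ` set L) p W" and u: "quotient_step (insert p (fst ` set L)) u V"
      using Cons.prems by (simp_all add: a)
    have nd: "\<not> mono_dvd u p" using Cons.prems(4) by (simp add: a)
    note swap = quotient_step_swap[OF p u _ nd]
    have "\<exists>L'. quotient_list L' \<and> degree_sorted L' \<and> mset L' = mset ((u, V) # L)"
      using Cons.prems swap(1) False by (intro Cons.IH) (auto simp: a)
    then obtain L' where L': "quotient_list L'" "degree_sorted L'" "mset L' = mset ((u, V) # L)"
      by blast
    have set: "set L' = insert (u, V) (set L)" using mset_eq_setD[OF L'(3)] by simp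
    show ?thesis
      using L' swap(2) False Cons.prems(2)
      by (intro exI[of _ "(p, W) # L'"]) (auto simp: a set)
  qed
qed

lemma quotient_list_sort:
  assumes "quotient_list L" "sorted_wrt (\<lambda>a b. \<not> mono_dvd (fst a) (fst b)) L"
  shows "\<exists>L'. quotient_list L' \<and> degree_sorted L' \<and> set L' = set L"
  using assms
proof (induction L)
  case Nil
  then show ?case by (intro exI[of _ "[]"]) simp
next
  case (Cons a L)
  obtain u V where a: "a = (u, V)" by fastforce
  from Cons obtain L1 where L1: "quotient_list L1" "degree_sorted L1" "set L1 = set L"
    by (auto simp: a)
  have "\<exists>L'. quotient_list L' \<and> degree_sorted L' \<and> mset L' = mset ((u, V) # L1)"
    using Cons.prems L1 by (intro quotient_list_insert) (auto simp: a)
  then show ?case using L1(3) a by (metis list.simps(15) mset_eq_setD)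
qed

lemma values_mult_colon:
  fixes f :: "'z::finite \<Rightarrow> 'a::comm_ring_1"
  assumes "quotient_step U u V" "z \<in> V"
  shows "f z * monom_value f u \<in> rspan (monom_value f ` U)"
proof -
  have "0 < lookup (single z (1::nat)) z" by simp
  then obtain v l where v: "v \<in> U" "single z 1 + u = l + v"
    using assms unfolding quotient_step_def mono_dvd_iff by blast
  have "f z * monom_value f u = monom_value f l * monom_value f v"
    by (metis monom_value_add monom_value_single v(2))
  then show ?thesis using v(1) by (simp add: rspan_mult_left ideals.span_base)
qed

text \<open>
  Every generator in \<open>U\<close> has some \<open>v \<in> V\<close> with a larger exponent than in \<open>u\<close>, so a relation
  \<open>g * \<phi>(u) \<in> \<phi>(U)\<close> lands in \<open>(f v ^ (u v + 1) | v \<in> V)\<close>, where quasi-regularity applies.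
\<close>

lemma colon_of_values:
  fixes f :: "'z::finite \<Rightarrow> 'a::comm_ring_1"
  assumes step: "quotient_step U u V" and reg: "permutable_regular f V"
    and out: "\<And>w. w \<notin> V \<Longrightarrow> regular_mod (f ` V) (f w)"
  shows "g * monom_value f u \<in> rspan (monom_value f ` U) \<longleftrightarrow> g \<in> rspan (f ` V)"
proof
  assume g: "g \<in> rspan (f ` V)"
  show "g * monom_value f u \<in> rspan (monom_value f ` U)"
    by (rule rspan_colon[OF _ g]) (use values_mult_colon[OF step] in blast)
next
  assume g: "g * monom_value f u \<in> rspan (monom_value f ` U)"
  have "monom_value f ` U \<subseteq> rspan ((\<lambda>v. f v ^ Suc (lookup u v)) ` V)"
  proof clarify
    fix q assume q: "q \<in> U"
    have "\<exists>v\<in>V. lookup u v < lookup q v"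
    proof (rule ccontr)
      assume "\<not> (\<exists>v\<in>V. lookup u v < lookup q v)"
      then have le: "lookup q v \<le> lookup u v" if "v \<in> V" for v
        using that by (meson not_le)
      have fin: "finite {v. (if v \<in> V then 0 else lookup q v) \<noteq> 0}" by simp
      \<comment> \<open>The part of \<open>q\<close> in the variables outside \<open>V\<close>: if
        no exponent of \<open>q\<close> in \<open>V\<close> exceeded that of \<open>u\<close>, then
        \<open>q\<close> would divide \<open>m + u\<close>, although \<open>m\<close> has no
        variable in \<open>V\<close>.\<close>
      define m where "m = Poly_Mapping.Abs_poly_mapping (\<lambda>v. if v \<in> V then 0 else lookup q v)"
      have m: "lookup m v = (if v \<in> V then 0 else lookup q v)" for v
        unfolding m_def by (simp add: Poly_Mapping.lookup_Abs_poly_mapping[OF fin])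
      have "mono_dvd q (m + u)" using le by (auto simp: mono_dvd_def lookup_add m)
      with q step obtain z where "z \<in> V" "0 < lookup m z"
        unfolding quotient_step_def by blast
      then show False by (simp add: m)
    qed
    then obtain v where v: "v \<in> V" "Suc (lookup u v) \<le> lookup q v" by auto
    have "monom_value f q = f v ^ lookup q v * (\<Prod>i\<in>UNIV - {v}. f i ^ lookup q i)"
      unfolding monom_value_def by (subst prod.remove[of UNIV v]) simp_all
    also have "f v ^ lookup q v =
        f v ^ (lookup q v - Suc (lookup u v)) * f v ^ Suc (lookup u v)"
      by (subst power_add[symmetric]) (use v(2) in simp)
    finally show "monom_value f q \<in> rspan ((\<lambda>v. f v ^ Suc (lookup u v)) ` V)"
      using v(1) ideals.span_base[of "f v ^ Suc (lookup u v)" "(\<lambda>v. f v ^ Suc (lookup u v)) ` V"]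
      by (metis (no_types, lifting) imageI rspan_mult_left rspan_mult_right)
  qed
  then have "g * monom_value f u \<in> rspan ((\<lambda>v. f v ^ Suc (lookup u v)) ` V)"
    using g rspan_mono_span by blast
  \<comment> \<open>Quasi-regularity removes the factors from \<open>V\<close>; the others are
    regular modulo the ideal of the \<open>f v\<close> by \<open>out\<close>.\<close>
  moreover have "monom_value f u = (\<Prod>i\<in>- V. f i ^ lookup u i) * (\<Prod>i\<in>V. f i ^ lookup u i)"
    unfolding monom_value_def
    by (subst prod.union_disjoint[symmetric]) (auto intro: prod.cong)
  ultimately have "g * (\<Prod>i\<in>- V. f i ^ lookup u i) \<in> rspan (f ` V)"
    by (intro quasi_regular[OF _ reg]) (simp_all add: mult.assoc)
  then have *: "(\<Prod>i\<in>- V. f i ^ lookup u i) * g \<in> rspan (f ` V)"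
    by (simp only: mult.commute)
  have "regular_mod (f ` V) (\<Prod>i\<in>- V. f i ^ lookup u i)"
    by (intro regular_mod_prod regular_mod_power out) simp
  from regular_modD[OF this *] show "g \<in> rspan (f ` V)" .
qed

section \<open>Degree shifts, Koszul resolutions and iterated cones\<close>

lemma free_vecs_shift: "free_vecs (map ((+) c) \<delta>) = free_vecs \<delta>"
  by (simp add: free_vecs_def)

lemma graded_linear_shift:
  assumes "graded_linear \<gamma> \<delta> \<pi>"
  shows "graded_linear (map ((+) c) \<gamma>) (map ((+) c) \<delta>) \<pi>"
proof -
  have "vcomp (map ((+) c) \<alpha>) e v = (if c \<le> e then vcomp \<alpha> (e - c) v else (\<lambda>_. 0))"
    for \<alpha> e and v :: "nat \<Rightarrow> ('a, 'b) mpoly"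
    by (auto simp: vcomp_def fun_eq_iff)
  then show ?thesis
    using assms graded_linear_zero[OF assms] unfolding graded_linear_def free_vecs_shift by simp
qed

lemma free_resolution_shift:
  "free_resolution b n d N \<Longrightarrow> free_resolution b n (\<lambda>i. map ((+) c) (d i)) N"
proof (induction n arbitrary: b d N)
  case 0
  then show ?case by simp
next
  case (Suc n)
  from Suc.prems obtain \<pi> where \<pi>: "graded_linear (d (Suc 0)) (d 0) \<pi>"
      "\<pi> ` free_vecs (d (Suc 0)) = N"
      "free_resolution (b \<and> n \<noteq> 0) n (\<lambda>i. d (Suc i)) (graded_kernel (d (Suc 0)) \<pi>)"
      "b \<and> n = 0 \<longrightarrow> (\<exists>j<length (d (Suc 0)). minimal_vec (\<pi> (unit_vec j)))" by (auto simp: free_resolution.simps(2))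
  have "graded_kernel (map ((+) c) (d (Suc 0))) \<pi> = graded_kernel (d (Suc 0)) \<pi>"
    by (simp add: graded_kernel_def free_vecs_shift)
  with Suc.IH[OF \<pi>(3)] \<pi> show ?case
    by (auto simp: free_resolution.simps(2) free_vecs_shift intro!: exI[of _ \<pi>] graded_linear_shift)
qed

lemma rspan_insert_eq: "{p + r * u |p r. p \<in> rspan S} = rspan (insert u S)"
proof (intro equalityI subsetI)
  fix x assume "x \<in> rspan (insert u S)"
  then obtain r s where "s \<in> rspan S" "x = u * r + s" by (rule rspan_insertE)
  then show "x \<in> {p + r * u |p r. p \<in> rspan S}"
    by (intro CollectI exI[of _ s] exI[of _ r]) (simp add: mult.commute[of u])
next
  fix x assume "x \<in> {p + r * u |p r. p \<in> rspan S}"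
  then obtain p r where x: "p \<in> rspan S" "x = p + r * u" by blast
  show "x \<in> rspan (insert u S)"
    using rspan_insertI[OF x(1), of u r] by (simp add: x(2) add.commute mult.commute)
qed

lemma ideal_vecs_zero: "ideal_vecs {0} = {\<lambda>_. 0}"
  by (auto simp: ideal_vecs_def fun_eq_iff) (metis gr0I)

text \<open>The Koszul complex arises as an iterated cone in which the colon ideal by the new form
  is the old ideal, by regularity. The final clause, for linear forms, supplies the exact degrees
  and the nonzero top term for the marking argument.\<close>

lemma koszul_resolution:
  fixes f :: "'z \<Rightarrow> ('x::finite, 'k::field) mpoly"
  assumes "finite V" "permutable_regular f V" "\<And>z. z \<in> V \<Longrightarrow> homogeneous (\<delta> z) (f z)"
  shows "\<exists>d. d 0 = [0] \<and> free_resolution False (card V) d (ideal_vecs (rspan (f ` V))) \<and>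
    (\<forall>i>card V. d i = []) \<and> ((\<forall>z\<in>V. \<delta> z = 1) \<longrightarrow> (\<forall>i. \<forall>x\<in>set (d i). x = i) \<and> d (card V) \<noteq> [])"
  using assms
proof (induction V rule: finite_induct)
  case empty
  show ?case
    by (intro exI[of _ "case_nat [0] (\<lambda>_. [])"]) (auto simp: ideal_vecs_zero split: nat.splits)
next
  case (insert v V)
  from insert.IH insert.prems permutable_regular_subset[OF insert.prems(1), of V] obtain d where d: "d 0 = [0]"
    "free_resolution False (card V) d (ideal_vecs (rspan (f ` V)))" "\<forall>i>card V. d i = []"
    "(\<forall>z\<in>V. \<delta> z = 1) \<longrightarrow> (\<forall>i. \<forall>x\<in>set (d i). x = i) \<and> d (card V) \<noteq> []" by auto
  have reg: "regular_mod (f ` V) (f v)"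
    using insert.prems(1) insert.hyps(2) unfolding permutable_regular_def by blast
  have colon: "g * f v \<in> rspan (f ` V) \<longleftrightarrow> g \<in> rspan (f ` V)" for g
    using regular_modD[OF reg, of g] rspan_mult_right[of g "f ` V" "f v"] by (auto simp: mult.commute)
  define d' where "d' = case_nat [0] (\<lambda>i. d (Suc i) @ map ((+) (\<delta> v)) (d i))"
  have "free_resolution False (Suc (card V)) d' (ideal_vecs {p + r * f v |p r. p \<in> rspan (f ` V)})"
    unfolding d'_def
    using d insert.prems(2)[of v] colon
    by (intro mapping_cone[where du = "\<delta> v" and A = "rspan (f ` V)"] free_resolution_lengthen free_resolution_shift) auto
  then have "free_resolution False (card (insert v V)) d' (ideal_vecs (rspan (f ` insert v V)))"
    using insert.hyps by (simp only: rspan_insert_eq) simp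
  then show ?case
    using d insert.hyps
    by (intro exI[of _ d']) (auto simp: d'_def split: nat.splits)
qed

lemma ideal_rspan: "ideal (rspan S) (mpoly_ring :: ('x, 'k::field) mpoly ring)"
proof -
  interpret C: cring "mpoly_ring :: ('x, 'k) mpoly ring" by (rule cring_mpoly_ring)
  show ?thesis using C.genideal_ideal[of S] by (simp add: genideal_mpoly_ring)
qed

text \<open>What the cones over \<open>R\<close> require. The first alternative allows for a
  generator with redundant image; in the second, \<open>V\<close> need not be the set of variables
  of the colon ideal in \<open>T\<close>.\<close>

fun colon_steps :: "nat \<Rightarrow> ('z::finite \<Rightarrow> ('x::finite, 'k::field) mpoly) \<Rightarrow> ('z \<Rightarrow>\<^sub>0 nat) list \<Rightarrow> bool"
  where "colon_steps k f [] \<longleftrightarrow> True"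
  | "colon_steps k f (u # us) \<longleftrightarrow> colon_steps k f us \<and>
      (monom_value f u \<in> rspan (monom_value f ` set us) \<or>
       (\<exists>V. card V \<le> k \<and> permutable_regular f V \<and>
         (\<forall>g. g * monom_value f u \<in> rspan (monom_value f ` set us) \<longleftrightarrow> g \<in> rspan (f ` V))))"

lemma colon_steps_resolution:
  fixes f :: "'z::finite \<Rightarrow> ('x::finite, 'k::field) mpoly"
  assumes "colon_steps k f us" and hom: "\<And>z. homogeneous (\<delta> z) (f z)"
  shows "\<exists>d. d 0 = [0] \<and> free_resolution False (Suc k) d (ideal_vecs (rspan (monom_value f ` set us)))"
  using assms(1)
proof (induction us)
  case Nil
  have "free_resolution False (Suc k) (case_nat [0] (\<lambda>_. [])) (ideal_vecs {0 :: ('x, 'k) mpoly})"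
    by (rule free_resolution_mono[of 0]) (auto simp: ideal_vecs_zero split: nat.splits)
  then show ?case by (intro exI[of _ "case_nat [0] (\<lambda>_. [])"]) simp
next
  case (Cons u us)
  then obtain d where d: "d 0 = [0]"
    "free_resolution False (Suc k) d (ideal_vecs (rspan (monom_value f ` set us)))" by auto
  show ?case
  proof (cases "monom_value f u \<in> rspan (monom_value f ` set us)")
    case True
    then have "rspan (monom_value f ` set (u # us)) = rspan (monom_value f ` set us)"
      using ideals.span_superset[of "monom_value f ` set us"]
        ideals.span_superset[of "insert (monom_value f u) (monom_value f ` set us)"]
      unfolding ideals.span_eq by auto
    with d show ?thesis by metis
  next
    case False
    with Cons.prems obtain V where V: "card V \<le> k" "permutable_regular f V"
      "\<And>g. g * monom_value f u \<in> rspan (monom_value f ` set us) \<longleftrightarrow> g \<in> rspan (f ` V)" by auto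
    from koszul_resolution[OF _ V(2), of \<delta>] hom obtain dV where dV: "dV 0 = [0]"
      "free_resolution False (card V) dV (ideal_vecs (rspan (f ` V)))" "\<forall>i>card V. dV i = []" by auto
    define du where "du = (\<Sum>z\<in>UNIV. lookup u z * \<delta> z)"
    have "free_resolution False k dV (ideal_vecs (rspan (f ` V)))"
      using dV V(1) by (intro free_resolution_mono[OF dV(2)]) auto
    from free_resolution_shift[OF this, of du]
    have "free_resolution False (Suc k) (case_nat [0] (\<lambda>i. d (Suc i) @ map ((+) du) (dV i)))
        (ideal_vecs {p + r * monom_value f u |p r. p \<in> rspan (monom_value f ` set us)})"
      by (intro mapping_cone[OF d(2,1), where du = du])
        (simp_all add: V(3) dV(1) du_def homogeneous_monom_value[OF hom])
    then show ?thesis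
      unfolding rspan_insert_eq by (intro exI[of _ "case_nat [0] (\<lambda>i. d (Suc i) @ map ((+) du) (dV i))"]) simp
  qed
qed

section \<open>Monomial ideals and ideals of variables\<close>

lemma mpoly_var_value: "monom_value mpoly_var u = (mpoly_monom u :: ('z::finite, 'k::field) mpoly)"
proof -
  have single: "mpoly_var i ^ e = mpoly_monom (single i e)" for i :: 'z and e
    by (induction e) (simp_all add: mpoly_var_def mpoly_monom_def mult_single single_add[symmetric])
  have "(\<Prod>i\<in>A. mpoly_var i ^ lookup u i) =
      (mpoly_monom (\<Sum>i\<in>A. single i (lookup u i)) :: ('z, 'k) mpoly)"
    if "finite A" for A
    using that by (induction A rule: finite_induct) (simp_all add: single mpoly_monom_def mult_single)
  moreover have "(\<Sum>i\<in>UNIV. single i (lookup u i)) = u"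
    by (rule poly_mapping_eqI) (simp add: lookup_sum lookup_single when_def)
  ultimately show ?thesis by (simp add: monom_value_def)
qed

lemma lookup_monom_mult: "lookup (mpoly_monom m * p) (m + l) = lookup p l"
  for p :: "('z, 'k::field) mpoly"
proof -
  have "mpoly_monom m * p = (\<Sum>j\<in>keys p. single (m + j) (lookup p j))"
    by (subst mpoly_eq_sum_single[of p]) (simp add: sum_distrib_left mpoly_monom_def mult_single)
  then show ?thesis
    by (simp add: lookup_sum lookup_single when_def in_keys_iff)
qed

lemma in_monomial_rspan_iff:
  "p \<in> rspan (mpoly_monom ` G) \<longleftrightarrow> (\<forall>m\<in>keys p. \<exists>g\<in>G. mono_dvd g m)"
  for p :: "('z, 'k::field) mpoly"
proof
  have "ideals.subspace {p :: ('z, 'k) mpoly. \<forall>m\<in>keys p. \<exists>g\<in>G. mono_dvd g m}"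
    unfolding ideals.subspace_def
  proof (intro conjI ballI allI)
    fix p q :: "('z, 'k) mpoly"
    assume pq: "p \<in> {p. \<forall>m\<in>keys p. \<exists>g\<in>G. mono_dvd g m}"
    show "q \<in> {p. \<forall>m\<in>keys p. \<exists>g\<in>G. mono_dvd g m} \<Longrightarrow>
        p + q \<in> {p. \<forall>m\<in>keys p. \<exists>g\<in>G. mono_dvd g m}"
      using pq Poly_Mapping.keys_add[of p q] by blast
    show "q * p \<in> {p. \<forall>m\<in>keys p. \<exists>g\<in>G. mono_dvd g m}"
    proof (intro CollectI ballI)
      fix m assume "m \<in> keys (q * p)"
      then obtain a b where "m = a + b" "b \<in> keys p" using Poly_Mapping.keys_mult[of q p] by blast
      with pq show "\<exists>g\<in>G. mono_dvd g m" using mono_dvd_add by blast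
    qed
  qed simp
  moreover have "mpoly_monom ` G \<subseteq> {p :: ('z, 'k) mpoly. \<forall>m\<in>keys p. \<exists>g\<in>G. mono_dvd g m}"
    by (auto simp: mpoly_monom_def mono_dvd_def)
  ultimately show "p \<in> rspan (mpoly_monom ` G) \<Longrightarrow> \<forall>m\<in>keys p. \<exists>g\<in>G. mono_dvd g m"
    using ideals.span_minimal by blast
next
  assume G: "\<forall>m\<in>keys p. \<exists>g\<in>G. mono_dvd g m"
  have "single m c \<in> rspan (mpoly_monom ` G)" if "m \<in> keys p" for m and c :: 'k
  proof -
    from G that obtain g l where g: "g \<in> G" "m = l + g" unfolding mono_dvd_iff by blast
    have "single m c = single l c * mpoly_monom g"
      by (simp add: g(2) mpoly_monom_def mult_single)
    with g(1) show ?thesis by (simp add: rspan_mult_left ideals.span_base)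
  qed
  then show "p \<in> rspan (mpoly_monom ` G)"
    by (subst mpoly_eq_sum_single) (rule ideals.span_sum)
qed

lemma monom_in_rspan_iff:
  "(mpoly_monom m :: ('z, 'k::field) mpoly) \<in> rspan (mpoly_monom ` G) \<longleftrightarrow> (\<exists>g\<in>G. mono_dvd g m)"
  unfolding in_monomial_rspan_iff by (simp add: mpoly_monom_def)

lemma var_dvd_iff: "mono_dvd (single z 1) m \<longleftrightarrow> 0 < lookup m z"
  by (auto simp: mono_dvd_def lookup_single when_def Suc_le_eq)

lemma mpoly_var_image: "mpoly_var ` V = mpoly_monom ` (\<lambda>z. single z 1) ` V"
  by (simp add: image_image mpoly_var_def)

lemma in_var_rspan_iff:
  "p \<in> rspan (mpoly_var ` V) \<longleftrightarrow> (\<forall>m\<in>keys p. \<exists>z\<in>V. 0 < lookup m z)"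
  for p :: "('z, 'k::field) mpoly"
  unfolding mpoly_var_image in_monomial_rspan_iff by (simp add: var_dvd_iff[simplified])

lemma regular_mod_var:
  assumes "w \<notin> V"
  shows "regular_mod (mpoly_var ` V) (mpoly_var w :: ('z, 'k::field) mpoly)"
  unfolding regular_mod_def in_var_rspan_iff
proof (intro allI impI ballI)
  fix g :: "('z, 'k) mpoly" and m
  assume *: "\<forall>m\<in>keys (mpoly_var w * g). \<exists>z\<in>V. 0 < lookup m z"
    and m: "m \<in> keys g"
  have "single w 1 + m \<in> keys (mpoly_var w * g)"
    using m unfolding mpoly_var_def in_keys_iff lookup_monom_mult .
  with * obtain z where "z \<in> V" "0 < lookup (single w 1 + m) z" by blast
  then show "\<exists>z\<in>V. 0 < lookup m z"
    using assms by (intro bexI[of _ z]) (auto simp: lookup_add lookup_single when_def split: if_splits)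
qed

lemma permutable_regular_var: "permutable_regular (mpoly_var :: 'z \<Rightarrow> ('z, 'k::field) mpoly) V"
  unfolding permutable_regular_def by (auto intro: regular_mod_var)

lemma homogeneous_var: "homogeneous 1 (mpoly_var z)"
  by (auto simp: homogeneous_def mpoly_var_def mpoly_monom_def mdegree_single split: if_splits)

text \<open>The bound \<open>D + i\<close> on degrees is carried along for the marking. A generator
  \<open>u\<close> with \<open>card V = k\<close> adds a basis vector of degree
  \<open>mdegree u + k\<close> at position \<open>Suc k\<close>. By sorting, all degrees at position
  \<open>k\<close> are smaller; for \<open>k = 0\<close> this position has degree 0, which is where
  \<open>u \<noteq> 0\<close> enters.\<close>

lemma quotient_list_resolution:
  fixes L :: "(('z::finite \<Rightarrow>\<^sub>0 nat) \<times> 'z set) list"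
  assumes "quotient_list L" "degree_sorted L" "\<And>u V. (u, V) \<in> set L \<Longrightarrow> card V \<le> k \<and> u \<noteq> 0"
  shows "\<exists>d. d 0 = [0] \<and> (\<forall>D. (\<forall>(u, V)\<in>set L. mdegree u \<le> D) \<longrightarrow> (\<forall>i. \<forall>x\<in>set (d (Suc i)). x \<le> D + i)) \<and>
    free_resolution (\<exists>(u, V)\<in>set L. card V = k) (Suc k) d
      (ideal_vecs (rspan (mpoly_monom ` fst ` set L) :: ('z, 'k::field) mpoly set))"
  using assms
proof (induction L)
  case Nil
  have "free_resolution False (Suc k) (case_nat [0] (\<lambda>_. [])) (ideal_vecs {0 :: ('z, 'k) mpoly})"
    by (rule free_resolution_mono[of 0]) (auto simp: ideal_vecs_zero split: nat.splits)
  then show ?case by (intro exI[of _ "case_nat [0] (\<lambda>_. [])"]) simp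
next
  case (Cons a L)
  obtain u V where a: "a = (u, V)" by fastforce
  define U where "U = fst ` set L"
  define b where "b \<longleftrightarrow> (\<exists>(u, V)\<in>set L. card V = k)"
  have "\<exists>d. d 0 = [0] \<and> (\<forall>D. (\<forall>(u, V)\<in>set L. mdegree u \<le> D) \<longrightarrow> (\<forall>i. \<forall>x\<in>set (d (Suc i)). x \<le> D + i)) \<and>
    free_resolution b (Suc k) d (ideal_vecs (rspan (mpoly_monom ` U) :: ('z, 'k) mpoly set))"
    unfolding b_def U_def by (rule Cons.IH) (use Cons.prems in \<open>auto simp: a\<close>)
  then obtain d where d: "d 0 = [0]"
    "\<And>D i x. \<forall>(u, V)\<in>set L. mdegree u \<le> D \<Longrightarrow> x \<in> set (d (Suc i)) \<Longrightarrow> x \<le> D + i"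
    "free_resolution b (Suc k) d (ideal_vecs (rspan (mpoly_monom ` U) :: ('z, 'k) mpoly set))"
    by blast
  have step: "quotient_step U u V" using Cons.prems by (simp add: a U_def)
  have V: "card V \<le> k" "u \<noteq> 0" using Cons.prems(3)[of u V] by (simp_all add: a)
  have colon: "g * mpoly_monom u \<in> rspan (mpoly_monom ` U) \<longleftrightarrow> g \<in> rspan (mpoly_var ` V)"
    for g :: "('z, 'k) mpoly"
    using colon_of_values[OF step permutable_regular_var regular_mod_var]
    by (simp add: mpoly_var_value)
  obtain dV where dV: "dV 0 = [0]"
    "free_resolution False (card V) dV (ideal_vecs (rspan (mpoly_var ` V) :: ('z, 'k) mpoly set))"
    "\<forall>i>card V. dV i = []" "\<And>i x. x \<in> set (dV i) \<Longrightarrow> x = i" "dV (card V) \<noteq> []"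
    using koszul_resolution[OF finite[of V] permutable_regular_var homogeneous_var, where ?'k = 'k]
    by auto
  define du where "du = mdegree u"
  define d' where "d' = case_nat [0] (\<lambda>i. d (Suc i) @ map ((+) du) (dV i))"
  have "free_resolution False k dV (ideal_vecs (rspan (mpoly_var ` V) :: ('z, 'k) mpoly set))"
    using dV V(1) by (intro free_resolution_mono[OF dV(2)]) auto
  moreover have "homogeneous du (mpoly_monom u :: ('z, 'k) mpoly)"
    by (simp add: homogeneous_def mpoly_monom_def du_def)
  ultimately have "free_resolution b (Suc k) d'
      (ideal_vecs {p + r * mpoly_monom u |p r. p \<in> (rspan (mpoly_monom ` U) :: ('z, 'k) mpoly set)})"
    unfolding d'_def
    by (intro mapping_cone[OF d(3,1) free_resolution_shift[of _ _ _ _ du]]) (simp_all add: colon dV(1))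
  then have res: "free_resolution b (Suc k) d'
      (ideal_vecs (rspan (mpoly_monom ` fst ` set (a # L)) :: ('z, 'k) mpoly set))"
    unfolding rspan_insert_eq by (simp add: a U_def)
  have dL: "\<forall>(p, W)\<in>set L. mdegree p \<le> du"
    using Cons.prems(2) by (auto simp: a du_def)
  have "free_resolution (b \<or> card V = k) (Suc k) d'
      (ideal_vecs (rspan (mpoly_monom ` fst ` set (a # L)) :: ('z, 'k) mpoly set))"
  \<comment> \<open>A mark set by an earlier generator is preserved by the cone. Only the first
    generator that attains \<open>k\<close> requires a new mark.\<close>
  proof (cases "\<not> b \<and> card V = k")
    case True
    then obtain j where j: "j < length (dV k)" "dV k ! j = k"
      using dV(4)[of "dV k ! 0" k] dV(5) by (metis length_greater_0_conv nth_mem)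
    have "free_resolution True (Suc k) d'
        (ideal_vecs (rspan (mpoly_monom ` fst ` set (a # L)) :: ('z, 'k) mpoly set))"
    proof (rule free_resolution_mark)
      show "free_resolution False (Suc k) d'
          (ideal_vecs (rspan (mpoly_monom ` fst ` set (a # L)) :: ('z, 'k) mpoly set))"
        using res True by simp
      \<comment> \<open>The basis of the cone lists the old resolution first, so the top Koszul
        vector has this index.\<close>
      show "length (d (Suc k)) + j < length (d' (Suc k))" using j by (simp add: d'_def)
      have top: "d' (Suc k) ! (length (d (Suc k)) + j) = du + k" using j by (simp add: d'_def nth_append)
      fix e assume e: "e \<in> set (d' k)"
      have "du \<noteq> 0"
      proof
        assume "du = 0"
        then have "u = 0" by (intro poly_mapping_eqI) (simp add: du_def mdegree_def)
        with V(2) show False by simp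
      qed
      then have "e < du + k"
        using e d(2)[OF dL, of e "k - 1"] dV(4)[of _ "k - 1"] by (cases k) (auto simp: d'_def less_Suc_eq_le)
      then show "e < d' (Suc k) ! (length (d (Suc k)) + j)" by (simp add: top)
    qed
    with True show ?thesis by simp
  next
    case False
    then have "(b \<or> card V = k) = b" by blast
    with res show ?thesis by simp
  qed
  moreover have "(b \<or> card V = k) \<longleftrightarrow> (\<exists>(u, V)\<in>set (a # L). card V = k)"
    by (auto simp: b_def a)
  moreover have "x \<le> D + i" if "\<forall>(u, V)\<in>set (a # L). mdegree u \<le> D" "x \<in> set (d' (Suc i))" for D i x
    using that d(2)[of D x i] dV(4)[of _ i] by (auto simp: a d'_def du_def dest!: dV(4))
  ultimately show ?case
    by (intro exI[of _ d']) (auto simp: d'_def)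
qed


section \<open>Freeness over the subring generated by a regular sequence\<close>

lemma homogeneous_const: "homogeneous 0 (mpoly_const a :: ('x::finite, 'k::field) mpoly)"
  by (simp add: homogeneous_def mpoly_const_def mdegree_def)

lemma hcomp_kscale: "hcomp e (kscale a p) = kscale a (hcomp e p)"
  by (simp add: kscale_def hcomp_mult_homogeneous[OF homogeneous_const])

lemma vector_space_field: "vector_space ((*) :: 'k::field \<Rightarrow> 'k \<Rightarrow> 'k)"
  by unfold_locales (simp_all add: algebra_simps)

lemma separating_functional:
  fixes A :: "('x, 'k::field) mpoly set"
  assumes "Modules.module.subspace kscale A" "u \<notin> A"
  obtains \<theta> :: "('x, 'k) mpoly \<Rightarrow> 'k" where "\<And>p q. \<theta> (p + q) = \<theta> p + \<theta> q"
    "\<And>a p. \<theta> (kscale a p) = a * \<theta> p" "\<And>p. p \<in> A \<Longrightarrow> \<theta> p = 0" "\<theta> u = 1"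
proof -
  interpret K: vector_space "kscale :: 'k \<Rightarrow> ('x, 'k) mpoly \<Rightarrow> _" by (rule vector_space_kscale)
  interpret F: vector_space "(*) :: 'k \<Rightarrow> 'k \<Rightarrow> 'k" by (rule vector_space_field)
  interpret KF: vector_space_pair "kscale :: 'k \<Rightarrow> ('x, 'k) mpoly \<Rightarrow> _" "(*) :: 'k \<Rightarrow> 'k \<Rightarrow> 'k" ..
  obtain B where B: "B \<subseteq> A" "K.independent B" "A \<subseteq> K.span B"
    using K.maximal_independent_subset[of A] by blast
  have span: "K.span B = A" using B assms(1) by (metis K.span_subspace)
  have "K.independent (insert u B)" using B(2) assms(2) by (simp add: K.independent_insertI span)
  from KF.linear_independent_extend[OF this, of "\<lambda>x. if x = u then 1 else 0"] obtain \<theta>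
    where \<theta>: "Vector_Spaces.linear kscale (*) \<theta>" "\<And>x. x \<in> insert u B \<Longrightarrow> \<theta> x = (if x = u then 1 else 0)"
    by blast
  interpret \<theta>: Vector_Spaces.linear kscale "(*)" \<theta> by (rule \<theta>(1))
  have "\<theta> p = 0" if "p \<in> A" for p
  proof -
    have "p \<in> K.span B" using that span by simp
    then show ?thesis
    proof (rule K.span_induct)
      show "K.subspace {p. \<theta> p = 0}" by (simp add: K.subspace_def \<theta>.add \<theta>.scale)
      show "\<theta> x = 0" if "x \<in> B" for x using that \<theta>(2)[of x] B(1) assms(2) by auto
    qed
  qed
  then show ?thesis using \<theta>(2)[of u] by (intro that[of \<theta>]) (simp_all add: \<theta>.add \<theta>.scale)
qed

lemma mpoly_eqI_hcomp: "(\<And>e. hcomp e p = hcomp e q) \<Longrightarrow> p = q"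
  by (rule poly_mapping_eqI) (metis lookup_hcomp)

lemma kscale_subspace_rspan: "Modules.module.subspace kscale (rspan S :: ('x, 'k::field) mpoly set)"
proof -
  interpret K: vector_space "kscale :: 'k \<Rightarrow> ('x, 'k) mpoly \<Rightarrow> _" by (rule vector_space_kscale)
  show ?thesis
    by (auto simp: K.subspace_def kscale_def ideals.span_zero intro: ideals.span_add rspan_mult_left)
qed

text \<open>The operator \<rho> projects along the ideal onto a graded vector space
  complement.\<close>

lemma graded_complement:
  fixes S :: "('x::finite, 'k::field) mpoly set"
  assumes S: "\<And>s. s \<in> S \<Longrightarrow> \<exists>e. homogeneous e s"
  obtains \<rho> where "\<And>p q. \<rho> (p + q) = \<rho> p + \<rho> q" "\<And>a p. \<rho> (kscale a p) = kscale a (\<rho> p)"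
    "\<And>p. p \<in> rspan S \<Longrightarrow> \<rho> p = 0" "\<And>p. p - \<rho> p \<in> rspan S" "\<And>e p. hcomp e (\<rho> p) = \<rho> (hcomp e p)"
proof -
  interpret K: vector_space "kscale :: 'k \<Rightarrow> ('x, 'k) mpoly \<Rightarrow> _" by (rule vector_space_kscale)
  interpret KK: vector_space_pair "kscale :: 'k \<Rightarrow> ('x, 'k) mpoly \<Rightarrow> _" "kscale :: 'k \<Rightarrow> ('x, 'k) mpoly \<Rightarrow> _" ..
  obtain B where B: "B \<subseteq> rspan S" "K.independent B" "rspan S \<subseteq> K.span B"
    using K.maximal_independent_subset[of "rspan S"] by blast
  have span: "K.span B = rspan S" using B kscale_subspace_rspan by (metis K.span_subspace)
  from KK.linear_independent_extend[OF K.independent_extend_basis[OF B(2)], of "\<lambda>x. if x \<in> B then 0 else x"]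
  obtain g where g: "Vector_Spaces.linear kscale kscale g"
    "\<And>x. x \<in> K.extend_basis B \<Longrightarrow> g x = (if x \<in> B then 0 else x)" by blast
  interpret g: Vector_Spaces.linear kscale kscale g by (rule g(1))
  have g_zero: "g p = 0" if "p \<in> rspan S" for p
  proof -
    have "p \<in> K.span B" using that span by simp
    then show ?thesis
    proof (rule K.span_induct)
      show "K.subspace {p. g p = 0}" by (simp add: K.subspace_def g.add g.scale)
      show "g x = 0" if "x \<in> B" for x
        using that g(2)[of x] K.extend_basis_superset[OF B(2)] by auto
    qed
  qed
  have g_diff: "p - g p \<in> rspan S" for p
  proof -
    have "p \<in> K.span (K.extend_basis B)" using K.span_extend_basis[OF B(2)] by simp
    then show ?thesis
    proof (rule K.span_induct)
      show "K.subspace {p. p - g p \<in> rspan S}"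
        unfolding K.subspace_def
      proof (intro conjI ballI allI; clarsimp simp: ideals.span_zero g.add g.scale)
        fix p q assume "p - g p \<in> rspan S" "q - g q \<in> rspan S"
        from ideals.span_add[OF this] show "p + q - (g p + g q) \<in> rspan S" by (simp add: algebra_simps)
      next
        fix c p assume "p - g p \<in> rspan S"
        from rspan_mult_left[OF this, of "mpoly_const c"] show "kscale c p - kscale c (g p) \<in> rspan S"
          by (simp add: kscale_def right_diff_distrib)
      qed
      show "x - g x \<in> rspan S" if "x \<in> K.extend_basis B" for x
        using g(2)[OF that] B(1) ideals.span_zero by auto
    qed
  qed
  \<comment> \<open>An arbitrary linear projection \<open>g\<close> need not respect degrees, so
    only the degree \<open>e\<close> part of its value on the degree \<open>e\<close> component is
    kept. Modulo the ideal nothing changes, because the ideal is homogeneous.\<close>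
  define \<rho> where "\<rho> p = (\<Sum>e\<in>mdegree ` keys p. hcomp e (g (hcomp e p)))" for p
  have hcomp_\<rho>: "hcomp e (\<rho> p) = hcomp e (g (hcomp e p))" for e p
  proof -
    have "hcomp e (\<rho> p) = (\<Sum>i\<in>mdegree ` keys p. if i = e then hcomp e (g (hcomp e p)) else 0)"
      unfolding \<rho>_def hcomp_sum by (rule sum.cong) (auto simp: hcomp_homogeneous[OF homogeneous_hcomp])
    also have "\<dots> = (if e \<in> mdegree ` keys p then hcomp e (g (hcomp e p)) else 0)"
      by (rule sum.delta) simp
    also have "\<dots> = hcomp e (g (hcomp e p))"
    proof (cases "e \<in> mdegree ` keys p")
      case False
      have "hcomp e p = 0"
      proof (rule poly_mapping_eqI)
        fix m show "lookup (hcomp e p) m = lookup 0 m"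
          using False by (auto simp: lookup_hcomp in_keys_iff image_iff)
      qed
      then show ?thesis by (simp add:)
    qed simp
    finally show ?thesis .
  qed
  have hS: "hcomp e p \<in> rspan S" if "p \<in> rspan S" for e p
    using homogeneous_closed_rspan[OF S] that by (auto simp: homogeneous_closed_def)
  show ?thesis
  proof
    show "\<rho> (p + q) = \<rho> p + \<rho> q" for p q
      by (rule mpoly_eqI_hcomp) (simp add: hcomp_\<rho> hcomp_add g.add)
    show "\<rho> (kscale a p) = kscale a (\<rho> p)" for a p
      by (rule mpoly_eqI_hcomp) (simp add: hcomp_\<rho> hcomp_kscale g.scale)
    show "\<rho> p = 0" if "p \<in> rspan S" for p
      by (rule mpoly_eqI_hcomp) (simp add: hcomp_\<rho> g_zero hS that)
    show "hcomp e (\<rho> p) = \<rho> (hcomp e p)" for e p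
      by (rule mpoly_eqI_hcomp) (simp add: hcomp_\<rho> hcomp_homogeneous[OF homogeneous_hcomp])
    show "p - \<rho> p \<in> rspan S" for p
    proof -
      obtain N where N: "p - \<rho> p = (\<Sum>e\<le>N. hcomp e (p - \<rho> p))" by (rule sum_hcomp[of "p - \<rho> p"]) blast
      have "hcomp e (p - \<rho> p) = hcomp e (hcomp e p - g (hcomp e p))" for e
        by (simp add: hcomp_diff hcomp_\<rho> hcomp_homogeneous[OF homogeneous_hcomp])
      then have "hcomp e (p - \<rho> p) \<in> rspan S" for e by (simp add: hS[OF g_diff])
      then show ?thesis by (subst N) (rule ideals.span_sum)
    qed
  qed
qed

lemma rspan_image_coeffs:
  assumes "finite A" "x \<in> rspan (f ` A)"
  obtains r where "x = (\<Sum>i\<in>A. f i * r i)"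
proof -
  have "rspan (f ` A) \<subseteq> {x. \<exists>r. x = (\<Sum>i\<in>A. f i * r i)}"
  proof (rule ideals.span_minimal)
    show "f ` A \<subseteq> {x. \<exists>r. x = (\<Sum>i\<in>A. f i * r i)}"
    proof clarify
      fix a assume "a \<in> A"
      have "(\<Sum>i\<in>A. f i * (if i = a then 1 else 0)) = (\<Sum>i\<in>A. if i = a then f a else 0)"
        by (rule sum.cong) auto
      also have "\<dots> = f a" using assms(1) \<open>a \<in> A\<close> by simp
      finally show "\<exists>r. f a = (\<Sum>i\<in>A. f i * r i)" by metis
    qed
    show "ideals.subspace {x. \<exists>r. x = (\<Sum>i\<in>A. f i * r i)}"
      unfolding ideals.subspace_def
    proof (intro conjI ballI allI; clarify)
      show "\<exists>r. 0 = (\<Sum>i\<in>A. f i * r i)" by (rule exI[of _ "\<lambda>_. 0"]) simp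
      show "\<exists>t. (\<Sum>i\<in>A. f i * r i) + (\<Sum>i\<in>A. f i * s i) = (\<Sum>i\<in>A. f i * t i)" for r s
        by (rule exI[of _ "\<lambda>i. r i + s i"]) (simp add: distrib_left sum.distrib)
      show "\<exists>t. c * (\<Sum>i\<in>A. f i * r i) = (\<Sum>i\<in>A. f i * t i)" for c r
        by (rule exI[of _ "\<lambda>i. c * r i"]) (simp add: sum_distrib_left mult.left_commute)
    qed
  qed
  with assms(2) that show ?thesis by blast
qed

lemma mpoly_subst_rspan:
  assumes "p \<in> rspan P"
  shows "mpoly_subst y p \<in> rspan (mpoly_subst y ` P)"
proof -
  have "rspan P \<subseteq> {p. mpoly_subst y p \<in> rspan (mpoly_subst y ` P)}"
  proof (rule ideals.span_minimal)
    show "ideals.subspace {p. mpoly_subst y p \<in> rspan (mpoly_subst y ` P)}"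
      by (auto simp: ideals.subspace_def mpoly_subst_add mpoly_subst_mult mpoly_subst_def[of _ 0]
          ideals.span_zero intro: ideals.span_add rspan_mult_left)
  qed (auto intro: ideals.span_base)
  with assms show ?thesis by blast
qed

text \<open>
  For a regular sequence \<open>y\<close> of forms, \<open>R\<close> is free over \<open>K[y]\<close>: if \<open>W\<close> is a graded complement of
  the ideal \<open>(y)\<close>, here the range of \<open>\<rho>\<close>, then every element of \<open>R\<close> is \<open>\<Sum> w\<^sub>\<alpha> y\<^sup>\<alpha>\<close> for unique
  coefficients in \<open>W\<close>. Such expansions are polynomials \<open>G\<close> over \<open>R\<close>, with value \<open>ev G\<close>. In terms of
  them, functionals \<open>l\<close> on \<open>R/(y)\<close> and \<open>\<theta>\<close> on \<open>K[y]/(P)\<close> combine to a functional \<open>T\<close> on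
  \<open>R/(P)R\<close> that detects \<open>g U\<close>.
\<close>

lemma socle_colon:
  fixes y :: "'y::finite \<Rightarrow> ('x::finite, 'k::field) mpoly"
  assumes reg: "permutable_regular y UNIV" and hom: "\<And>i. homogeneous (\<delta> i) (y i)" "\<And>i. 0 < \<delta> i"
    and U: "U \<notin> rspan P" "\<And>i. mpoly_var i * U \<in> rspan P"
    and g: "g * mpoly_subst y U \<in> rspan (mpoly_subst y ` P)"
  shows "g \<in> rspan (range y)"
proof (rule ccontr)
  assume gQ: "g \<notin> rspan (range y)"
  have homs: "\<exists>e. homogeneous e s" if "s \<in> range y" for s using that hom(1) by blast
  obtain \<rho> where \<rho>: "\<And>p q. \<rho> (p + q) = \<rho> p + \<rho> q" "\<And>a p. \<rho> (kscale a p) = kscale a (\<rho> p)"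
    "\<And>p. p \<in> rspan (range y) \<Longrightarrow> \<rho> p = 0" "\<And>p. p - \<rho> p \<in> rspan (range y)"
    "\<And>e p. hcomp e (\<rho> p) = \<rho> (hcomp e p)"
    by (rule graded_complement[of "range y", OF homs], assumption, rule that)
  have \<rho>0: "\<rho> 0 = 0" by (rule \<rho>(3)) (rule ideals.span_zero)
  have \<rho>\<rho>: "\<rho> (\<rho> p) = \<rho> p" for p
    using \<rho>(1)[of "p - \<rho> p" "\<rho> p"] \<rho>(3)[OF \<rho>(4), of p] by simp
  obtain l where l: "\<And>p q. l (p + q) = l p + l q" "\<And>a p. l (kscale a p) = a * l p"
    "\<And>p. p \<in> rspan (range y) \<Longrightarrow> l p = 0" "l g = 1"
    using separating_functional[OF kscale_subspace_rspan gQ] by blast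
  obtain \<theta> where \<theta>: "\<And>p q. \<theta> (p + q) = \<theta> p + \<theta> q" "\<And>a p. \<theta> (kscale a p) = a * \<theta> p"
    "\<And>p. p \<in> rspan P \<Longrightarrow> \<theta> p = 0" "\<theta> U = 1"
    using separating_functional[OF kscale_subspace_rspan U(1)] by blast
  have l0: "l 0 = 0" using l(3) ideals.span_zero by blast
  have \<theta>0: "\<theta> 0 = 0" using \<theta>(3) ideals.span_zero by blast
  have \<theta>_sum: "\<theta> (sum h A) = (\<Sum>a\<in>A. \<theta> (h a))" for h :: "('y \<Rightarrow>\<^sub>0 nat) \<Rightarrow> _" and A
    by (induction A rule: infinite_finite_induct) (simp_all add: \<theta> \<theta>0)

  define ev :: "(('y \<Rightarrow>\<^sub>0 nat) \<Rightarrow>\<^sub>0 ('x, 'k) mpoly) \<Rightarrow> ('x, 'k) mpoly"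
    where "ev G = (\<Sum>\<alpha>\<in>keys G. lookup G \<alpha> * monom_value y \<alpha>)" for G
  define T :: "(('y \<Rightarrow>\<^sub>0 nat) \<Rightarrow>\<^sub>0 ('x, 'k) mpoly) \<Rightarrow> 'k"
    where "T G = (\<Sum>\<alpha>\<in>keys G. l (lookup G \<alpha>) * \<theta> (mpoly_monom \<alpha>))" for G
  define W :: "(('y \<Rightarrow>\<^sub>0 nat) \<Rightarrow>\<^sub>0 ('x, 'k) mpoly) set"
    where "W = {G. \<forall>\<alpha>. \<rho> (lookup G \<alpha>) = lookup G \<alpha>}"
  have ev_superset: "ev G = (\<Sum>\<alpha>\<in>A. lookup G \<alpha> * monom_value y \<alpha>)"
    if "finite A" "keys G \<subseteq> A" for G A
    unfolding ev_def using that by (intro sum.mono_neutral_left) (auto simp: in_keys_iff)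
  have T_superset: "T G = (\<Sum>\<alpha>\<in>A. l (lookup G \<alpha>) * \<theta> (mpoly_monom \<alpha>))"
    if "finite A" "keys G \<subseteq> A" for G A
    unfolding T_def using that by (intro sum.mono_neutral_left) (auto simp: in_keys_iff l0)
  have ev_add: "ev (G + Y) = ev G + ev Y" for G Y
    using Poly_Mapping.keys_add[of G Y]
    by (simp add: ev_superset[of "keys G \<union> keys Y"] lookup_add
        distrib_right sum.distrib)
  have T_add: "T (G + Y) = T G + T Y" for G Y
    using Poly_Mapping.keys_add[of G Y]
    by (simp add: T_superset[of "keys G \<union> keys Y"] lookup_add l(1)
        distrib_right sum.distrib)
  have ev0: "ev 0 = 0" and T0: "T 0 = 0" by (simp_all add: ev_def T_def)
  have W0: "0 \<in> W" by (simp add: W_def \<rho>0)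
  have W_add: "G + Y \<in> W" if "G \<in> W" "Y \<in> W" for G Y using that by (simp add: W_def lookup_add \<rho>(1))
  have W_single: "single \<alpha> w \<in> W" if "\<rho> w = w" for \<alpha> w
    using that by (auto simp: W_def lookup_single when_def \<rho>0)
  have ev_single: "ev (single \<alpha> w) = w * monom_value y \<alpha>" for \<alpha> w
    by (subst ev_superset[of "{\<alpha>}"]) auto
  have T_single: "T (single \<alpha> w) = l w * \<theta> (mpoly_monom \<alpha>)" for \<alpha> w
    by (subst T_superset[of "{\<alpha>}"]) auto
  have ev_sum: "ev (sum h A) = (\<Sum>a\<in>A. ev (h a))" for h :: "('y \<Rightarrow>\<^sub>0 nat) \<Rightarrow> _" and A
    by (induction A rule: infinite_finite_induct) (simp_all add: ev_add ev0)
  have T_sum: "T (sum h A) = (\<Sum>a\<in>A. T (h a))" for h :: "('y \<Rightarrow>\<^sub>0 nat) \<Rightarrow> _" and A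
    by (induction A rule: infinite_finite_induct) (simp_all add: T_add T0)
  have W_sum: "sum h A \<in> W" if "\<And>a. a \<in> A \<Longrightarrow> h a \<in> W" for h :: "('y \<Rightarrow>\<^sub>0 nat) \<Rightarrow> _" and A
    using that by (induction A rule: infinite_finite_induct) (auto intro: W_add W0)

  \<comment> \<open>For \<alpha> of least degree in \<open>G\<close>, every other exponent exceeds
    \<alpha> in some variable. Hence the term of \<alpha> lies in the ideal of the powers
    \<open>y i ^ Suc (lookup \<alpha> i)\<close>, and quasi-regularity puts its coefficient into the
    ideal of the \<open>y i\<close>, where \<rho> vanishes.\<close>
  have unique: "G = 0" if G: "G \<in> W" "ev G = 0" for G
  proof (rule ccontr)
    assume "G \<noteq> 0"
    then have "keys G \<noteq> {}" by simp
    then obtain \<alpha> where \<alpha>: "\<alpha> \<in> keys G"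
      "\<And>\<beta>. \<beta> \<in> keys G \<Longrightarrow> mdegree \<alpha> \<le> mdegree \<beta>"
      using arg_min_if_finite(1)[of "keys G" mdegree]
        arg_min_least[of "keys G" _ mdegree] by (metis finite_keys)
    let ?Q = "rspan ((\<lambda>i. y i ^ Suc (lookup \<alpha> i)) ` UNIV)"
    have "lookup G \<beta> * monom_value y \<beta> \<in> ?Q"
      if \<beta>: "\<beta> \<in> keys G - {\<alpha>}" for \<beta>
    proof -
      have "\<exists>i. lookup \<alpha> i < lookup \<beta> i"
      proof (rule ccontr)
        assume "\<not> (\<exists>i. lookup \<alpha> i < lookup \<beta> i)"
        then have d: "mono_dvd \<beta> \<alpha>" by (simp add: mono_dvd_def not_less)
        from mono_dvd_mdegree[OF d] \<alpha>(2)[of \<beta>] \<beta> show False by auto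
      qed
      then obtain i where "Suc (lookup \<alpha> i) \<le> lookup \<beta> i" by (auto simp: Suc_le_eq)
      then obtain e where e: "lookup \<beta> i = e + Suc (lookup \<alpha> i)"
        by (metis add.commute le_Suc_ex)
      have "monom_value y \<beta> = (y i ^ e * (\<Prod>j\<in>UNIV - {i}. y j ^ lookup \<beta> j)) *
          y i ^ Suc (lookup \<alpha> i)"
        unfolding monom_value_def by (subst prod.remove[of UNIV i]) (simp_all add: e power_add mult_ac)
      moreover have "y i ^ Suc (lookup \<alpha> i) \<in> ?Q" by (rule ideals.span_base) blast
      ultimately show ?thesis by (simp only: rspan_mult_left)
    qed
    then have rest: "(\<Sum>\<beta>\<in>keys G - {\<alpha>}. lookup G \<beta> * monom_value y \<beta>) \<in> ?Q"
      by (rule ideals.span_sum)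
    have "ev G = lookup G \<alpha> * monom_value y \<alpha> +
        (\<Sum>\<beta>\<in>keys G - {\<alpha>}. lookup G \<beta> * monom_value y \<beta>)"
      unfolding ev_def using \<alpha>(1) by (intro sum.remove) simp_all
    then have "lookup G \<alpha> * monom_value y \<alpha> =
        - (\<Sum>\<beta>\<in>keys G - {\<alpha>}. lookup G \<beta> * monom_value y \<beta>)"
      using G(2) by (simp only: eq_neg_iff_add_eq_0)
    then have "lookup G \<alpha> * monom_value y \<alpha> \<in> ?Q"
      using ideals.span_neg[OF rest] by (simp only:)
    then have "lookup G \<alpha> \<in> rspan (range y)"
      unfolding monom_value_def by (intro quasi_regular[OF _ reg]) simp_all
    from \<rho>(3)[OF this] have "lookup G \<alpha> = 0" using G(1) by (simp add: W_def)
    with \<alpha>(1) show False by (simp add: in_keys_iff)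
  qed

  \<comment> \<open>Existence by induction on the degree: \<open>h - \<rho> h\<close> is a
    combination of the \<open>y i\<close>, whose coefficients can be taken homogeneous of smaller
    degree.\<close>
  have expand_hom: "\<exists>G\<in>W. ev G = h" if "homogeneous e h" for e h
    using that
  proof (induction e arbitrary: h rule: less_induct)
    case (less e)
    obtain r where r: "h - \<rho> h = (\<Sum>i\<in>UNIV. y i * r i)"
      using rspan_image_coeffs[OF finite \<rho>(4)[of h]] .
    define s where "s i = (if \<delta> i \<le> e then hcomp (e - \<delta> i) (r i) else 0)" for i
    have "hcomp e (h - \<rho> h) = h - \<rho> h"
      using hcomp_homogeneous[OF less.prems, of e] by (simp add: hcomp_diff \<rho>(5))
    then have hs: "h - \<rho> h = (\<Sum>i\<in>UNIV. y i * s i)"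
      unfolding r hcomp_sum hcomp_mult_homogeneous[OF hom(1)] s_def
      by (simp add: if_distrib[of "(*) _"] cong: if_cong)
    have "\<exists>G\<in>W. ev G = s i" for i
    proof (cases "\<delta> i \<le> e")
      case True
      then have "e - \<delta> i < e" using hom(2)[of i] by linarith
      from less.IH[OF this homogeneous_hcomp] show ?thesis using True by (simp add: s_def)
    next
      case False
      then show ?thesis using W0 ev0 by (auto simp: s_def)
    qed
    then obtain G where G: "\<And>i. G i \<in> W" "\<And>i. ev (G i) = s i" by metis
    have shift: "\<exists>Y\<in>W. ev Y = y i * s i" for i
    proof -
      define Y where "Y = (\<Sum>\<alpha>\<in>keys (G i).
        single (single i 1 + \<alpha>) (lookup (G i) \<alpha>))"
      have "Y \<in> W" unfolding Y_def using G(1)[of i] by (intro W_sum W_single) (simp add: W_def)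
      moreover have "ev Y = (\<Sum>\<alpha>\<in>keys (G i).
          y i * (lookup (G i) \<alpha> * monom_value y \<alpha>))"
        unfolding Y_def ev_sum ev_single monom_value_add monom_value_single
        by (simp only: mult.left_commute)
      moreover have "\<dots> = y i * s i"
        by (simp only: G(2)[symmetric] ev_def sum_distrib_left)
      ultimately show ?thesis by metis
    qed
    have "\<exists>Y\<in>W. ev Y = (\<Sum>i\<in>A. y i * s i)" if "finite A" for A
      using that
    proof (induction A rule: finite_induct)
      case empty
      then show ?case using W0 ev0 by auto
    next
      case (insert i A)
      then obtain Y where Y: "Y \<in> W" "ev Y = (\<Sum>i\<in>A. y i * s i)" by blast
      obtain Z where Z: "Z \<in> W" "ev Z = y i * s i" using shift[of i] by blast
      show ?case
        using insert.hyps Y(2) Z(2) by (intro bexI[of _ "Z + Y"] W_add[OF Z(1) Y(1)]) (simp add: ev_add)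
    qed
    from this[OF finite] obtain Y where Y: "Y \<in> W" "ev Y = (\<Sum>i\<in>UNIV. y i * s i)" by blast
    have "ev (single 0 (\<rho> h) + Y) = \<rho> h + (h - \<rho> h)"
      by (simp only: ev_add ev_single Y(2) hs monom_value_0 mult_1_right)
    moreover have "single 0 (\<rho> h) + Y \<in> W" by (intro W_add W_single Y \<rho>\<rho>)
    ultimately show ?case by (intro bexI[of _ "single 0 (\<rho> h) + Y"]) simp
  qed
  have expand: "\<exists>G\<in>W. ev G = h" for h
  proof -
    obtain N where N: "h = (\<Sum>e\<le>N. hcomp e h)" by (rule sum_hcomp[of h]) blast
    have "\<exists>G\<in>W. ev G = (\<Sum>e\<le>n. hcomp e h)" for n
    proof (induction n)
      case 0
      then show ?case using expand_hom[OF homogeneous_hcomp] by simp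
    next
      case (Suc n)
      then obtain Y where Y: "Y \<in> W" "ev Y = (\<Sum>e\<le>n. hcomp e h)" by blast
      obtain Z where Z: "Z \<in> W" "ev Z = hcomp (Suc n) h"
        using expand_hom[OF homogeneous_hcomp, of "Suc n" h] by blast
      show ?case
        using Y(2) Z(2) by (intro bexI[of _ "Y + Z"] W_add[OF Y(1) Z(1)]) (simp add: ev_add)
    qed
    from this[of N] show ?thesis by (simp only: N[symmetric])
  qed

  \<comment> \<open>The expansion of \<open>w * mpoly_subst y s\<close>, with all coefficients
    multiples of \<open>w\<close>.\<close>
  define E where "E w s = (\<Sum>m\<in>keys s. single m (kscale (lookup s m) w))"
    for w :: "('x, 'k) mpoly" and s :: "('y, 'k) mpoly"
  have E_W: "E w s \<in> W" if "\<rho> w = w" for w s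
    unfolding E_def by (intro W_sum W_single) (simp add: \<rho>(2) that)
  have E_ev: "ev (E w s) = w * mpoly_subst y s" for w s
    unfolding E_def ev_sum ev_single mpoly_subst_def sum_distrib_left
    by (intro sum.cong) (simp_all add: kscale_def monom_value_def mult_ac)
  have E_T: "T (E w s) = l w * \<theta> s" for w s
  proof -
    have "\<theta> s = (\<Sum>m\<in>keys s. \<theta> (kscale (lookup s m) (mpoly_monom m)))"
      by (subst mpoly_eq_sum_single[of s])
        (simp add: \<theta>_sum kscale_def mpoly_const_def mpoly_monom_def mult_single)
    then show ?thesis
      unfolding E_def T_sum T_single by (simp add: \<theta>(2) l(2) sum_distrib_left mult_ac)
  qed

  \<comment> \<open>Expanding the multiplier \<open>c\<close> writes a multiple of an element of
    \<open>P\<close> as a sum of terms \<open>w * mpoly_subst y (mpoly_monom \<alpha> * p)\<close>,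
    and \<theta> vanishes on the ideal of \<open>P\<close>.\<close>
  have vanish: "\<exists>G\<in>W. ev G = x \<and> T G = 0" if "x \<in> rspan (mpoly_subst y ` P)" for x
    using that
  proof (induction rule: ideals.span_induct_alt)
    case base
    then show ?case using W0 ev0 T0 by auto
  next
    case (step c x z)
    from step(1) obtain p where p: "p \<in> P" "x = mpoly_subst y p" by blast
    from step(2) obtain Z where Z: "Z \<in> W" "ev Z = z" "T Z = 0" by blast
    obtain C where C: "C \<in> W" "ev C = c" using expand by blast
    define D where "D = (\<Sum>\<alpha>\<in>keys C. E (lookup C \<alpha>) (mpoly_monom \<alpha> * p))"
    have "D \<in> W" unfolding D_def using C(1) by (intro W_sum E_W) (simp add: W_def)
    moreover have "ev D = c * x"
      unfolding D_def ev_sum E_ev mpoly_subst_mult mpoly_subst_monom C(2)[symmetric] p(2) ev_def[of C]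
      by (simp add: sum_distrib_right mult.assoc)
    moreover have "T D = 0"
      unfolding D_def T_sum E_T using p(1) by (simp add: \<theta>(3) rspan_mult_left ideals.span_base)
    ultimately show ?case
      using Z by (intro bexI[of _ "D + Z"]) (simp_all add: W_add ev_add T_add)
  qed

  \<comment> \<open>Here \<open>g\<close> is replaced by its representative in the complement: the
    difference lies in the ideal of the \<open>y i\<close>, and these multiply the image of
    \<open>U\<close> into the ideal.\<close>
  have "(g - \<rho> g) * mpoly_subst y U \<in> rspan (mpoly_subst y ` P)"
  proof -
    obtain r where r: "g - \<rho> g = (\<Sum>i\<in>UNIV. y i * r i)"
      using rspan_image_coeffs[OF finite \<rho>(4)[of g]] .
    have "r i * (y i * mpoly_subst y U) \<in> rspan (mpoly_subst y ` P)" for i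
      using mpoly_subst_rspan[OF U(2), of y i] by (simp add: mpoly_subst_mult mpoly_subst_var rspan_mult_left)
    then have "(\<Sum>i\<in>UNIV. r i * (y i * mpoly_subst y U)) \<in> rspan (mpoly_subst y ` P)"
      by (rule ideals.span_sum)
    moreover have "y i * r i * mpoly_subst y U = r i * (y i * mpoly_subst y U)" for i
      by (simp only: mult_ac)
    ultimately show ?thesis unfolding r sum_distrib_right by (simp only:)
  qed
  from ideals.span_diff[OF g this] have "\<rho> g * mpoly_subst y U \<in> rspan (mpoly_subst y ` P)"
    by (simp add: algebra_simps)
  from vanish[OF this] obtain G where G: "G \<in> W" "ev G = \<rho> g * mpoly_subst y U" "T G = 0" by blast
  define Y where "Y = E (\<rho> g) U"
  have Y: "Y \<in> W" "ev Y = \<rho> g * mpoly_subst y U" "T Y = 1"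
  proof -
    show "Y \<in> W" unfolding Y_def by (rule E_W) (rule \<rho>\<rho>)
    have "l (\<rho> g) = l g" using l(1)[of "g - \<rho> g" "\<rho> g"] l(3)[OF \<rho>(4), of g] by simp
    then show "ev Y = \<rho> g * mpoly_subst y U" "T Y = 1" by (simp_all add: Y_def E_ev E_T l(4) \<theta>(4))
  qed
  \<comment> \<open>\<open>M\<close> has value \<open>- ev Y\<close>, so \<open>G + M\<close> has
    value 0 and is zero by uniqueness. Then \<open>T G = T Y\<close>, although these are 0 and
    1.\<close>
  define M where "M = (\<Sum>\<alpha>\<in>keys Y. single \<alpha> (kscale (-1) (lookup Y \<alpha>)))"
  have M: "M \<in> W" "ev M = - ev Y" "T M = - T Y"
  proof -
    have neg: "kscale (-1) p = - p" for p :: "('x, 'k) mpoly"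
      by (simp add: kscale_def mpoly_const_def single_uminus)
    have lneg: "l (- p) = - l p" for p using l(2)[of "-1" p] by (simp add: neg)
    show "M \<in> W" unfolding M_def using Y(1) by (intro W_sum W_single) (simp add: \<rho>(2) W_def)
    show "ev M = - ev Y" unfolding M_def ev_sum ev_single by (simp add: ev_def neg sum_negf)
    show "T M = - T Y" unfolding M_def T_sum T_single by (simp add: T_def neg lneg sum_negf)
  qed
  have "G + M = 0"
    by (rule unique[OF W_add[OF G(1) M(1)]]) (simp add: ev_add M(2) G(2) Y(2))
  then have "T G + T M = 0" using T_add T0 by metis
  with G(3) M(3) Y(3) show False by simp
qed


section \<open>The main theorem\<close>

lemma mpoly_subst_1: "mpoly_subst f 1 = 1"
  using mpoly_subst_const[of f 1] by (simp add: mpoly_const_def)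

lemma mpoly_subst_power: "mpoly_subst f (p ^ e) = mpoly_subst f p ^ e"
  by (induction e) (simp_all add: mpoly_subst_1 mpoly_subst_mult)

lemma mpoly_subst_prod: "mpoly_subst f (prod g A) = (\<Prod>a\<in>A. mpoly_subst f (g a))"
  by (induction A rule: infinite_finite_induct) (simp_all add: mpoly_subst_1 mpoly_subst_mult)

lemma mpoly_subst_monom_value: "mpoly_subst f (monom_value g u) = monom_value (\<lambda>z. mpoly_subst f (g z)) u"
  by (simp add: monom_value_def mpoly_subst_prod mpoly_subst_power)

lemma rspan_mpoly_subst_image: "rspan (mpoly_subst y ` rspan P) = rspan (mpoly_subst y ` P)"
  unfolding ideals.span_eq
proof
  show "mpoly_subst y ` rspan P \<subseteq> rspan (mpoly_subst y ` P)" using mpoly_subst_rspan by blast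
  show "mpoly_subst y ` P \<subseteq> rspan (mpoly_subst y ` rspan P)"
    by (rule order_trans[OF image_mono[OF ideals.span_superset] ideals.span_superset])
qed

lemma one_notin_rspan_forms:
  fixes S :: "('x::finite, 'k::field) mpoly set"
  assumes "\<And>s. s \<in> S \<Longrightarrow> \<exists>e>0. homogeneous e s"
  shows "1 \<notin> rspan S"
proof -
  have "rspan S \<subseteq> {p. lookup p 0 = 0}"
  proof (rule ideals.span_minimal)
    show "S \<subseteq> {p. lookup p 0 = 0}"
    proof
      fix s assume "s \<in> S"
      then obtain e where "0 < e" "homogeneous e s" using assms by blast
      then show "s \<in> {p. lookup p 0 = 0}"
        by (force simp: homogeneous_def in_keys_iff mdegree_def)
    qed
    show "ideals.subspace {p :: ('x, 'k) mpoly. lookup p 0 = 0}"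
      by (simp add: ideals.subspace_def lookup_add lookup_mult_0)
  qed
  then show ?thesis by auto
qed

text \<open>A linear relation would put some \<open>f v\<close> into the ideal of the others.
  Regularity would then put 1 into it, which is impossible for an ideal generated by forms of
  positive degree.\<close>

lemma regular_forms_independent:
  fixes f :: "'z \<Rightarrow> ('x::finite, 'k::field) mpoly"
  assumes "inj f" "permutable_regular f V" "\<And>z. z \<in> V \<Longrightarrow> homogeneous (\<delta> z) (f z) \<and> 0 < \<delta> z"
  shows "\<not> Modules.module.dependent kscale (f ` V)"
proof -
  interpret K: vector_space "kscale :: 'k \<Rightarrow> ('x, 'k) mpoly \<Rightarrow> _" by (rule vector_space_kscale)
  show ?thesis
  proof
    assume "K.dependent (f ` V)"
    then obtain v where v: "v \<in> V" "f v \<in> K.span (f ` V - {f v})"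
      unfolding K.dependent_def by blast
    have "f ` V - {f v} = f ` (V - {v})" using assms(1) by (auto dest: injD)
    with v(2) have "f v \<in> K.span (f ` (V - {v}))" by (simp only:)
    moreover have "K.span (f ` (V - {v})) \<subseteq> rspan (f ` (V - {v}))"
      by (rule K.span_minimal[OF ideals.span_superset kscale_subspace_rspan])
    ultimately have "f v \<in> rspan (f ` (V - {v}))" by (rule subsetD[rotated])
    then have "f v * 1 \<in> rspan (f ` (V - {v}))" by (simp only: mult_1_right)
    moreover have "regular_mod (f ` (V - {v})) (f v)"
      using assms(2) v(1) unfolding permutable_regular_def by blast
    ultimately have "1 \<in> rspan (f ` (V - {v}))" by (rule regular_modD[rotated])
    moreover have "\<exists>e>0. homogeneous e s" if "s \<in> f ` (V - {v})" for s
      using assms(3) that by blast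
    ultimately show False using one_notin_rspan_forms by blast
  qed
qed

lemma span_of_full_independent:
  fixes F :: "('x, 'k::field) mpoly set"
  assumes "finite F" "B \<subseteq> F" "\<not> Modules.module.dependent kscale B" "card B = vector_space.dim kscale F"
  shows "F \<subseteq> Modules.module.span kscale B"
proof -
  interpret K: vector_space "kscale :: 'k \<Rightarrow> ('x, 'k) mpoly \<Rightarrow> _" by (rule vector_space_kscale)
  obtain C where C: "C \<subseteq> F" "K.independent C" "F \<subseteq> K.span C" "card C = K.dim F"
    by (rule K.basis_exists)
  have fC: "finite C" using C(1) assms(1) by (rule finite_subset)
  show ?thesis
  proof (rule ccontr)
    assume "\<not> F \<subseteq> K.span B"
    then obtain p where p: "p \<in> F" "p \<notin> K.span B" by blast
    have "K.independent (insert p B)" using p(2) assms(3) by (rule K.independent_insertI)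
    moreover have "insert p B \<subseteq> K.span C" using p(1) assms(2) C(3) by blast
    ultimately have "card (insert p B) \<le> card C" using K.independent_span_bound[OF fC] by blast
    moreover have "p \<notin> B" using p(2) K.span_base by blast
    ultimately show False using finite_subset[OF assms(2,1)] assms(4) C(4) by simp
  qed
qed

text \<open>
  The forms are linear combinations \<open>L z\<close> of the regular sequence \<open>y\<close> of the \<open>f v\<close> with
  \<open>v \<in> V'\<close>. In the polynomial ring in \<open>y\<close>, the colon ideal contains all variables; unless it is the
  unit ideal, \<open>socle_colon\<close> applies.
\<close>

lemma strongly_generic_step:
  fixes f :: "'z::finite \<Rightarrow> ('x::finite, 'k::field) mpoly"
  assumes form: "\<And>z. homogeneous d (f z)" "0 < d" and inj: "inj f"
    and dim: "vector_space.dim kscale (range f) = CARD('x)"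
    and reg: "permutable_regular f V'" and V': "V' \<subseteq> V" "card V' = CARD('x)"
    and step: "quotient_step U u V"
  shows "monom_value f u \<in> rspan (monom_value f ` U) \<or>
    (\<forall>g. g * monom_value f u \<in> rspan (monom_value f ` U) \<longleftrightarrow> g \<in> rspan (f ` V'))"
proof -
  interpret K: vector_space "kscale :: 'k \<Rightarrow> ('x, 'k) mpoly \<Rightarrow> _" by (rule vector_space_kscale)
  have indep: "\<not> K.dependent (f ` V')"
    by (rule regular_forms_independent[OF inj reg, where \<delta> = "\<lambda>_. d"]) (simp add: form)
  have "card (f ` V') = K.dim (range f)"
    by (simp add: dim V'(2) card_image[OF inj_on_subset[OF inj]])
  then have span: "f z \<in> K.span (f ` V')" for z
    using span_of_full_independent[of "range f" "f ` V'"] indep by auto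
  \<comment> \<open>Since \<open>V'\<close> has as many elements as there are variables of
    \<open>R\<close>, the type of these variables also indexes the new variables
    \<open>y\<close>.\<close>
  obtain b :: "'x \<Rightarrow> 'z" where b: "bij_betw b UNIV V'"
    using finite_same_card_bij[of "UNIV :: 'x set" V'] V'(2) by auto
  have inj_b: "inj b" and b_in: "b i \<in> V'" for i using b by (auto simp: bij_betw_def)
  define y where "y i = f (b i)" for i
  have range_y: "range y = f ` V'" using b by (auto simp: y_def bij_betw_def)
  have inj_y: "inj y" using inj inj_b by (auto simp: y_def inj_def)
  have "\<exists>c. f z = (\<Sum>i\<in>UNIV. kscale (c i) (y i))" for z
  proof -
    have "f z \<in> K.span (range y)" using span by (simp add: range_y)
    then obtain w where w: "f z = (\<Sum>a\<in>range y. kscale (w a) a)" by (auto simp: K.span_finite)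
    show ?thesis
      by (rule exI[of _ "\<lambda>i. w (y i)"]) (simp add: w sum.reindex[OF inj_y])
  qed
  then obtain c where c: "\<And>z. f z = (\<Sum>i\<in>UNIV. kscale (c z i) (y i))" by metis
  \<comment> \<open>On \<open>V'\<close> the linear form is set to a single variable outright, so
    the chosen coefficients \<open>c\<close> need not be determined there.\<close>
  define L :: "'z \<Rightarrow> ('x, 'k) mpoly"
    where "L z = (if z \<in> V' then mpoly_var (inv b z) else (\<Sum>i\<in>UNIV. kscale (c z i) (mpoly_var i)))" for z
  have L_b: "L (b i) = mpoly_var i" for i by (simp add: L_def b_in inv_f_f[OF inj_b])
  have L: "mpoly_subst y (L z) = f z" for z
  proof (cases "z \<in> V'")
    case True
    then obtain i where "z = b i" using b by (auto simp: bij_betw_def)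
    then show ?thesis by (simp add: L_b mpoly_subst_var y_def)
  next
    case False
    then show ?thesis
      by (simp add: L_def c[of z] mpoly_subst_sum kscale_def mpoly_subst_mult mpoly_subst_const mpoly_subst_var)
  qed
  have value_L: "mpoly_subst y (monom_value L v) = monom_value f v" for v
    by (simp add: mpoly_subst_monom_value L)
  then have image_L: "mpoly_subst y ` monom_value L ` U = monom_value f ` U" by (simp add: image_image)
  show ?thesis
  proof (cases "monom_value L u \<in> rspan (monom_value L ` U)")
    case True
    from mpoly_subst_rspan[OF this, of y] show ?thesis by (simp add: value_L image_L)
  next
    case False
    \<comment> \<open>All variables of the new polynomial ring come from \<open>V'\<close>, a subset
      of \<open>V\<close>, so they lie in the colon ideal.\<close>
    have var: "mpoly_var i * monom_value L u \<in> rspan (monom_value L ` U)" for i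
      using values_mult_colon[OF step, of "b i" L] b_in[of i] V'(1) by (auto simp: L_b)
    have reg_y: "permutable_regular y UNIV"
      unfolding permutable_regular_def
    proof (intro allI impI ballI)
      fix B :: "'x set" and i assume "i \<in> UNIV - B"
      then have "b i \<in> V' - b ` B" "b ` B \<subseteq> V'" using b_in inj_b by (auto dest: injD)
      then have "regular_mod (f ` b ` B) (f (b i))" using reg unfolding permutable_regular_def by blast
      then show "regular_mod (y ` B) (y i)" by (simp add: y_def image_image)
    qed
    have "g \<in> rspan (f ` V')" if "g * monom_value f u \<in> rspan (monom_value f ` U)" for g
      unfolding range_y[symmetric]
      by (rule socle_colon[OF reg_y _ _ False var, where \<delta> = "\<lambda>_. d"])
        (use that in \<open>simp_all add: y_def form value_L image_L\<close>)
    moreover have "g * monom_value f u \<in> rspan (monom_value f ` U)" if "g \<in> rspan (f ` V')" for g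
      by (rule rspan_colon[OF _ that]) (use values_mult_colon[OF step] V'(1) in blast)
    ultimately show ?thesis by blast
  qed
qed

lemma quotient_list_colon_steps:
  assumes "quotient_list L"
    and "\<And>U u V. (u, V) \<in> set L \<Longrightarrow> quotient_step U u V \<Longrightarrow>
      monom_value f u \<in> rspan (monom_value f ` U) \<or>
      (\<exists>V'. card V' \<le> k \<and> permutable_regular f V' \<and>
        (\<forall>g. g * monom_value f u \<in> rspan (monom_value f ` U) \<longleftrightarrow> g \<in> rspan (f ` V')))"
  shows "colon_steps k f (map fst L)"
  using assms
proof (induction L)
  case (Cons a L)
  obtain u V where a: "a = (u, V)" by fastforce
  have "colon_steps k f (map fst L)" using Cons.prems by (intro Cons.IH) (auto simp: a)
  moreover have "quotient_step (fst ` set L) u V" using Cons.prems(1) by (simp add: a)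
  ultimately show ?case using Cons.prems(2)[of u V "fst ` set L"] by (simp add: a)
qed simp

lemma linear_quotients_list:
  fixes I :: "('z::finite, 'k::field) mpoly set"
  assumes "linear_quotients I"
  obtains L where "quotient_list L" "degree_sorted L" "I = rspan (mpoly_monom ` fst ` set L)"
proof -
  from assms obtain us where us: "distinct us" "minimal_monomial_generators I (set us)"
    and quot: "\<And>i. 1 \<le> i \<Longrightarrow> i < length us \<Longrightarrow>
      \<exists>V. colon_ideal mpoly_ring (Idl\<^bsub>mpoly_ring\<^esub> (mpoly_monom ` set (take i us))) (mpoly_monom (us ! i))
        = Idl\<^bsub>mpoly_ring\<^esub> ((mpoly_var :: 'z \<Rightarrow> ('z, 'k) mpoly) ` V)"
    unfolding linear_quotients_def by blast
  have I: "I = rspan (mpoly_monom ` set us)"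
    and min: "\<And>G. G \<subset> set us \<Longrightarrow> I \<noteq> rspan (mpoly_monom ` G)"
    using us(2) unfolding minimal_monomial_generators_def genideal_mpoly_ring by blast+
  have "\<exists>V. quotient_step (set (take i us)) (us ! i) V" if i: "i < length us" for i
  \<comment> \<open>The definition imposes no condition on the first generator, whose colon ideal is
    zero: it gets the empty set of variables.\<close>
  proof (cases "i = 0")
    case True
    then show ?thesis by (intro exI[of _ "{}"]) (simp add: quotient_step_def)
  next
    case False
    then obtain V where V: "colon_ideal mpoly_ring (rspan (mpoly_monom ` set (take i us))) (mpoly_monom (us ! i))
        = rspan ((mpoly_var :: 'z \<Rightarrow> ('z, 'k) mpoly) ` V)"
      using quot[OF _ i] by (auto simp: genideal_mpoly_ring)
    have "quotient_step (set (take i us)) (us ! i) V"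
      unfolding quotient_step_def
    proof
      fix m
      have "(\<exists>v\<in>set (take i us). mono_dvd v (m + us ! i)) \<longleftrightarrow>
          (mpoly_monom m * mpoly_monom (us ! i) :: ('z, 'k) mpoly) \<in> rspan (mpoly_monom ` set (take i us))"
        by (simp only: monom_in_rspan_iff[symmetric, where ?'k = 'k]) (simp add: mpoly_monom_def mult_single)
      also have "\<dots> \<longleftrightarrow> (mpoly_monom m :: ('z, 'k) mpoly) \<in> rspan (mpoly_var ` V)"
        using V by (auto simp: colon_ideal_def)
      also have "\<dots> \<longleftrightarrow> (\<exists>z\<in>V. 0 < lookup m z)"
        unfolding in_var_rspan_iff by (simp add: mpoly_monom_def)
      finally show "(\<exists>v\<in>set (take i us). mono_dvd v (m + us ! i)) \<longleftrightarrow> (\<exists>z\<in>V. 0 < lookup m z)" .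
    qed
    then show ?thesis ..
  qed
  then obtain V where V: "\<And>i. i < length us \<Longrightarrow> quotient_step (set (take i us)) (us ! i) (V i)" by metis
  have "quotient_list (rev (map (\<lambda>i. (us ! i, V i)) [0..<n])) \<and>
      fst ` set (rev (map (\<lambda>i. (us ! i, V i)) [0..<n])) = set (take n us)" if "n \<le> length us" for n
    using that
  proof (induction n)
    case (Suc n)
    then show ?case using V[of n] by (auto simp: take_Suc_conv_app_nth)
  qed simp
  from this[of "length us"] have L: "quotient_list (rev (map (\<lambda>i. (us ! i, V i)) [0..<length us]))"
    "fst ` set (rev (map (\<lambda>i. (us ! i, V i)) [0..<length us])) = set us" by auto
  \<comment> \<open>A generator divisible by another one could be left out, against
    minimality.\<close>
  have antichain: "\<not> mono_dvd (us ! i) (us ! j)" if ij: "i < length us" "j < length us" "i \<noteq> j" for i j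
  proof
    assume d: "mono_dvd (us ! i) (us ! j)"
    define G where "G = set us - {us ! j}"
    have i: "us ! i \<in> G" using us(1) ij by (simp add: G_def nth_eq_iff_index_eq)
    have "mpoly_monom ` set us \<subseteq> rspan (mpoly_monom ` G :: ('z, 'k) mpoly set)"
    proof clarify
      fix u assume "u \<in> set us"
      then have "\<exists>g\<in>G. mono_dvd g u"
        using d i by (cases "u = us ! j") (auto simp: G_def mono_dvd_def)
      then show "(mpoly_monom u :: ('z, 'k) mpoly) \<in> rspan (mpoly_monom ` G)"
        by (simp only: monom_in_rspan_iff)
    qed
    then have "I \<subseteq> rspan (mpoly_monom ` G)" unfolding I by (rule rspan_mono_span)
    moreover have "rspan (mpoly_monom ` G) \<subseteq> I" unfolding I by (rule ideals.span_mono) (auto simp: G_def)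
    ultimately show False using min[of G] nth_mem[OF ij(2)] unfolding G_def by blast
  qed
  have "sorted_wrt (\<lambda>a b. \<not> mono_dvd (fst a) (fst b)) (rev (map (\<lambda>i. (us ! i, V i)) [0..<length us]))"
    unfolding sorted_wrt_rev sorted_wrt_map by (auto simp: sorted_wrt_iff_nth_less antichain)
  from quotient_list_sort[OF L(1) this] obtain L' where L': "quotient_list L'" "degree_sorted L'"
    "set L' = set (rev (map (\<lambda>i. (us ! i, V i)) [0..<length us]))" by blast
  have "I = rspan (mpoly_monom ` fst ` set L')" unfolding L'(3) L(2) by (rule I)
  with L' that show ?thesis by blast
qed

theorem corollary3p11:
  fixes I :: "('z::finite, 'k::field) mpoly set"
    and F :: "('x::finite, 'k) mpoly set"
    and f :: "'z \<Rightarrow> ('x, 'k) mpoly"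
    and n :: nat
  assumes "infinite (UNIV :: 'k set)"
    and "CARD('x) = n + 1"
    and "monomial_ideal I" and "linear_quotients I"
    and "bij_betw f UNIV F" and "\<forall>p\<in>F. is_form p"
    and "(\<exists>d. (\<forall>p\<in>F. form_of_degree d p) \<and> strongly_generic F) \<or>
         (\<exists>c::nat. c_generic c F \<and> proj_dim mpoly_ring (ideal_module mpoly_ring I) \<le> enat c \<and> c < n + 1)"
  shows "proj_dim mpoly_ring (quotient_module mpoly_ring (Idl\<^bsub>mpoly_ring\<^esub> (mpoly_subst f ` I)))
       \<le> proj_dim mpoly_ring (quotient_module mpoly_ring I)"
proof -
  obtain L where L: "quotient_list L" "degree_sorted L" "I = rspan (mpoly_monom ` fst ` set L)"
    using linear_quotients_list[OF assms(4)] .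
  have inj: "inj f" and F: "F = range f" using assms(5) by (auto simp: bij_betw_def)
  have "\<exists>e>0. homogeneous e (f z)" for z
    using assms(6) by (auto simp: F is_form_def form_of_degree_def homogeneous_def)
  then obtain \<delta> where \<delta>: "\<And>z. 0 < \<delta> z" "\<And>z. homogeneous (\<delta> z) (f z)" by metis
  have J: "Idl\<^bsub>mpoly_ring\<^esub> (mpoly_subst f ` I) = rspan (monom_value f ` fst ` set L)"
  proof -
    have "mpoly_subst f ` mpoly_monom ` fst ` set L = monom_value f ` fst ` set L"
      by (simp add: image_image mpoly_subst_monom)
    then have "rspan (mpoly_subst f ` I) = rspan (monom_value f ` fst ` set L)"
      unfolding L(3) rspan_mpoly_subst_image by (simp only:)
    then show ?thesis by (simp add: genideal_mpoly_ring)
  qed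
  show ?thesis
  \<comment> \<open>The monomial 1 among the generators makes the extended ideal all of
    \<open>R\<close>. Otherwise all generators are nonconstant, as the marking requires.\<close>
  proof (cases "0 \<in> fst ` set L")
    case True
    then have "monom_value f 0 \<in> rspan (monom_value f ` fst ` set L)" by (intro ideals.span_base) blast
    then have "p \<in> rspan (monom_value f ` fst ` set L)" for p
      using rspan_mult_left[of 1 _ p] by (simp add: monom_value_0)
    then have "rspan (monom_value f ` fst ` set L) = UNIV" by blast
    then show ?thesis by (simp add: J proj_dim_quotient_UNIV)
  next
    case nonzero: False
    show ?thesis
    \<comment> \<open>For the zero ideal there is no largest \<open>card V\<close>, and both sides
      are handled directly.\<close>
    proof (cases "L = []")
      case True
      have "free_resolution False 0 (\<lambda>_. [0]) (ideal_vecs {0 :: ('x, 'k) mpoly})"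
        by (simp add: ideal_vecs_zero)
      from proj_dim_quotient_upper[OF ideal_rspan[of "{}", simplified] this]
      show ?thesis by (simp add: J True flip: zero_enat_def)
    next
      case False
      define k where "k = Max (card ` snd ` set L)"
      have k: "card V \<le> k" if "(u, V) \<in> set L" for u V
        unfolding k_def using that by (intro Max_ge) force+
      have "k \<in> card ` snd ` set L" unfolding k_def using False by (intro Max_in) auto
      then have top: "(\<exists>(u, V)\<in>set L. card V = k) = True" by force
      obtain d where d: "d 0 = [0]" "free_resolution True (Suc k) d (ideal_vecs I)"
        using quotient_list_resolution[OF L(1,2), of k, where ?'k = 'k] k nonzero
        unfolding top L(3) by force
      have "ideal I mpoly_ring" unfolding L(3) by (rule ideal_rspan)
      note lower = proj_dim_marked_lower[OF this d(2,1)]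
      \<comment> \<open>With \<open>card V \<le> c\<close>, adding one more variable stays within
        \<open>c + 1\<close> forms. So genericity gives both the regularity inside \<open>V\<close>
        and that of every other form modulo \<open>V\<close>.\<close>
      have generic_step: "\<exists>V'. card V' \<le> k \<and> permutable_regular f V' \<and>
          (\<forall>g. g * monom_value f u \<in> rspan (monom_value f ` U) \<longleftrightarrow> g \<in> rspan (f ` V'))"
        if c: "c_generic c F" "card V \<le> c" and V: "(u, V) \<in> set L" "quotient_step U u V" for c U u V
      proof -
        have reg: "permutable_regular f V" "permutable_regular f (insert w V)" for w
          using c(2) by (auto intro!: c_generic_permutable_regular[OF c(1) assms(5,6)] simp: card_insert_if)
        have "regular_mod (f ` V) (f w)" if "w \<notin> V" for w
          using reg(2)[of w] that unfolding permutable_regular_def by blast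
        from colon_of_values[OF V(2) reg(1) this] k[OF V(1)] reg(1) show ?thesis by blast
      qed
      have "colon_steps k f (map fst L)"
      proof (rule quotient_list_colon_steps[OF L(1)])
        fix U u V assume V: "(u, V) \<in> set L" "quotient_step U u V"
        from assms(7) show "monom_value f u \<in> rspan (monom_value f ` U) \<or>
          (\<exists>V'. card V' \<le> k \<and> permutable_regular f V' \<and>
            (\<forall>g. g * monom_value f u \<in> rspan (monom_value f ` U) \<longleftrightarrow> g \<in> rspan (f ` V')))"
        proof
          assume "\<exists>c. c_generic c F \<and> proj_dim mpoly_ring (ideal_module mpoly_ring I) \<le> enat c \<and> c < n + 1"
          then obtain c where c: "c_generic c F" "proj_dim mpoly_ring (ideal_module mpoly_ring I) \<le> enat c" by blast
          \<comment> \<open>The hypothesis on the projective dimension of \<open>I\<close> enters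
            through the lower bound \<open>k\<close> from the marked resolution.\<close>
          have "k \<le> c" using order_trans[OF lower(2) c(2)] by simp
          then show ?thesis using generic_step[OF c(1) _ V] k[OF V(1)] by simp
        next
          assume "\<exists>d. (\<forall>p\<in>F. form_of_degree d p) \<and> strongly_generic F"
          then obtain e where e: "\<And>z. form_of_degree e (f z)"
            and gen: "c_generic n F" "vector_space.dim kscale (range f) = CARD('x)"
            using assms(2) by (auto simp: F strongly_generic_def generic_def)
          show ?thesis
          \<comment> \<open>Up to \<open>n\<close> variables genericity leaves room for one more
            form. Beyond that, the forms of any \<open>n + 1\<close> of the variables span all of
            them.\<close>
          proof (cases "card V \<le> n")
            case True
            then show ?thesis using generic_step[OF gen(1) True V] by blast
          next
            case False
            then obtain V' where V': "V' \<subseteq> V" "card V' = CARD('x)"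
              using obtain_subset_with_card_n[of "CARD('x)" V] assms(2) by auto
            have reg: "permutable_regular f V'"
              using c_generic_permutable_regular[OF gen(1) assms(5,6)] V'(2) assms(2) by simp
            \<comment> \<open>The replacement has at most as many elements as \<open>V\<close>, so
              the Koszul resolution stays within length \<open>k\<close>.\<close>
            have "card V' \<le> k" using card_mono[OF _ V'(1)] k[OF V(1)] by simp
            moreover have "homogeneous e (f z)" "0 < e" for z
              using e[of z] by (simp_all add: form_of_degree_def homogeneous_def)
            ultimately show ?thesis
              using strongly_generic_step[OF _ _ inj gen(2) reg V' V(2)] reg by blast
          qed
        qed
      qed
      from colon_steps_resolution[OF this \<delta>(2)] obtain d'
        where d': "d' 0 = [0]" "free_resolution False (Suc k) d' (ideal_vecs (rspan (monom_value f ` fst ` set L)))"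
        by auto
      from proj_dim_quotient_upper[OF ideal_rspan d'(2,1)] lower(1) show ?thesis
        unfolding J by (rule order_trans)
    qed
  qed
qed

end
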